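(* Let $O\subset\mathbb{R}^n$ be a convex open set with $0\in O$, and let $V\in H'(\mathbb{R}^n;O)$ be a distribution of exponential growth whose support is contained in some proper (i.e. containing no straight line) closed convex cone $C^*\subset\mathbb{R}^n$ with vertex at the origin. Let $U=\mathscr{F}^{-1}[V]$. If $V\neq 0$, then the only closed cone $C\subset\mathbb{R}^n$ that can be a carrier of $U$ is $C=\mathbb{R}^n$; equivalently, if $U$ is carried by a closed cone $C\subset\mathbb{R}^n$ with $C\neq\mathbb{R}^n$, then $V=0$.
   Context: A cone is a set $C\subset\mathbb{R}^n$ (vertex at the origin) with $\lambda C\subset C$ for all $\lambda>0$. The space $H(\mathbb{R}^n;O)$. For a compact convex $K\subset\mathbb{R}^n$ let $h_K(\xi)=\sup_{x\in K}\langle \xi,x\rangle$. $H_b(\mathbb{R}^n;K)$ is the space of all $\varphi\in C^\infty(\mathbb{R}^n)$ such that $e^{h_K(\xi)}D^\alpha\varphi(\xi)$ is bounded on $\mathbb{R}^n$ for every multi-index $\alpha$, with seminorms $\sup_{\xi,\,|\alpha|\le N}e^{h_K(\xi)}|D^\alpha\varphi(\xi)|$, $N\in\mathbb{N}$. For a convex open $O\subset\mathbb{R}^n$, $H(\mathbb{R}^n;O)$ is the projective limit of the spaces $H_b(\mathbb{R}^n;K)$ over the compact convex $K\subset O$. Its dual $H'(\mathbb{R}^n;O)$ is the space of distributions of exponential growth. Since $\mathscr{D}(\mathbb{R}^n)$ is dense in $H(\mathbb{R}^n;O)$, $H'(\mathbb{R}^n;O)$ embeds in $\mathscr{D}'(\mathbb{R}^n)$;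 supports are understood in the sense of distributions. The space $\mathfrak{H}(T(O))$. For $A\subset\mathbb{R}^n$ put $T(A)=\mathbb{R}^n+iA\subset\mathbb{C}^n$. For compact convex $K$, $\mathfrak{H}_b(T(K))$ is the space of continuous functions $\psi$ on $T(K)$, holomorphic in the interior of $T(K)$, with $\sup_{z\in T(K)}(1+|z|)^N|\psi(z)|<\infty$ for all $N\in\mathbb{N}$, topologized by these seminorms. For convex open $O$, $\mathfrak{H}(T(O))$ is the projective limit of $\mathfrak{H}_b(T(K))$ over compact convex $K\subset O$, and $\mathfrak{H}'(T(O))$ is its dual. Fourier transform. $\mathscr{F}[\varphi](z)=\int_{\mathbb{R}^n}\varphi(\xi)e^{i\langle\xi,z\rangle}d^n\xi$ is a topological isomorphism from $H(\mathbb{R}^n;O)$ onto $\mathfrak{H}(T(-O))$, with inverse $\mathscr{F}^{-1}[\psi](\xi)=(2\pi)^{-n}\int_{\mathbb{R}^n}\psi(x)e^{-i\langle\xi,x\rangle}d^nx$. For $V\in H'(\mathbb{R}^n;O)$, the functional $U=\mathscr{F}^{-1}[V]\in\mathfrak{H}'(T(-O))$ is defined by $\langle U,\psi\rangle=\langle V,\mathscr{F}^{-1}[\psi]\rangle$ for all $\psi\in\mathfrak{H}(T(-O))$. Carriers. Let $\Omega\subset\mathbb{R}^n\subset\mathbb{C}^n$ be closed and let $\Omega_m=\{z\in\mathbb{C}^n \mid \mathrm{dist}(z,\Omega)\le 1/m\}$, $m=1,2,\dots$. The functional $U\in\mathfrak{H}'(T(-O))$ is carried by $\Omega$ (and $\Omega$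 is a carrier of $U$) if for every $m$ (such that $\Omega_m\subset T(-O)$) $U$ is continuous on the restrictions to $\Omega_m$ of functions in $\mathfrak{H}(T(-O))$, i.e. there exist $N\in\mathbb{N}$ and $M>0$ with $|\langle U,\psi\rangle|\le M\sup_{z\in\Omega_m}(1+|z|)^N|\psi(z)|$ for all $\psi\in\mathfrak{H}(T(-O))$. *)

theory Defs
  imports "HOL-Analysis.Analysis"
begin

section \<open>Smooth functions, test functions\<close>

definition partial_deriv :: "'n \<Rightarrow> (real^'n \<Rightarrow> complex) \<Rightarrow> real^'n \<Rightarrow> complex" where
  "partial_deriv i \<phi> \<xi> = vector_derivative (\<lambda>t. \<phi> (\<xi> + t *\<^sub>R axis i 1)) (at 0)"

text \<open>A multi-index is encoded by a list of coordinate directions, its order being the length of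
  the list.  On smooth functions partial derivatives commute, so all lists that encode the same
  multi-index yield the same derivative.\<close>

primrec multi_deriv :: "'n list \<Rightarrow> (real^'n \<Rightarrow> complex) \<Rightarrow> real^'n \<Rightarrow> complex" where
  "multi_deriv [] \<phi> = \<phi>"
| "multi_deriv (i # \<alpha>) \<phi> = partial_deriv i (multi_deriv \<alpha> \<phi>)"

definition smooth_fun :: "(real^'n \<Rightarrow> complex) \<Rightarrow> bool" where
  "smooth_fun \<phi> \<longleftrightarrow> (\<forall>\<alpha>. multi_deriv \<alpha> \<phi> differentiable_on UNIV)"

definition test_functions :: "(real^'n) set \<Rightarrow> (real^'n \<Rightarrow> complex) set" where
  "test_functions W = {\<phi>. smooth_fun \<phi> \<and> compact (closure {\<xi>. \<phi> \<xi> \<noteq> 0})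
                          \<and> closure {\<xi>. \<phi> \<xi> \<noteq> 0} \<subseteq> W}"


section \<open>The space \<open>H(\<real>\<^sup>n; O)\<close> and its dual\<close>

definition seminorm_topology ::
    "('a \<Rightarrow> complex) set \<Rightarrow> (('a \<Rightarrow> complex) \<Rightarrow> real) set \<Rightarrow> ('a \<Rightarrow> complex) topology" where
  "seminorm_topology X P = topology_generated_by
     (insert X {{\<psi>\<in>X. p (\<lambda>x. \<psi> x - \<phi> x) < \<epsilon>} | p \<phi> \<epsilon>. p \<in> P \<and> \<phi> \<in> X \<and> 0 < \<epsilon>})"

definition support_fun :: "(real^'n) set \<Rightarrow> real^'n \<Rightarrow> real" where
  "support_fun K \<xi> = (SUP x\<in>K. \<xi> \<bullet> x)"

definition Hb :: "(real^'n) set \<Rightarrow> (real^'n \<Rightarrow> complex) set" where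
  "Hb K = {\<phi>. smooth_fun \<phi> \<and>
     (\<forall>\<alpha>. bounded (range (\<lambda>\<xi>. exp (support_fun K \<xi>) *\<^sub>R multi_deriv \<alpha> \<phi> \<xi>)))}"

definition Hb_seminorm :: "(real^'n) set \<Rightarrow> nat \<Rightarrow> (real^'n \<Rightarrow> complex) \<Rightarrow> real" where
  "Hb_seminorm K N \<phi> =
     (SUP (\<xi>, \<alpha>) \<in> UNIV \<times> {\<alpha>. length \<alpha> \<le> N}. exp (support_fun K \<xi>) * cmod (multi_deriv \<alpha> \<phi> \<xi>))"

definition Hb_topology :: "(real^'n) set \<Rightarrow> (real^'n \<Rightarrow> complex) topology" where
  "Hb_topology K = seminorm_topology (Hb K) (range (Hb_seminorm K))"

text \<open>Nonemptiness keeps \<open>support_fun K\<close> meaningful.  For nonempty \<open>O\<close> it does not affect the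
  projective limits below.\<close>

definition convex_compacts :: "(real^'n) set \<Rightarrow> (real^'n) set set" where
  "convex_compacts \<O> = {K. compact K \<and> convex K \<and> K \<noteq> {} \<and> K \<subseteq> \<O>}"

definition H_space :: "(real^'n) set \<Rightarrow> (real^'n \<Rightarrow> complex) set" where
  "H_space \<O> = (\<Inter>K \<in> convex_compacts \<O>. Hb K)"

text \<open>The projective limit topology: the coarsest one for which all the inclusions of
  \<open>H_space \<O>\<close> into \<open>Hb K\<close> are continuous.\<close>

definition H_topology :: "(real^'n) set \<Rightarrow> (real^'n \<Rightarrow> complex) topology" where
  "H_topology \<O> = topology_generated_by
     (\<Union>K \<in> convex_compacts \<O>. {S. openin (subtopology (Hb_topology K) (H_space \<O>)) S})"

text \<open>A functional is a HOL function on all of \<open>real^'n \<Rightarrow> complex\<close>; only its values on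
  \<open>H_space \<O>\<close> matter.\<close>

definition H_dual :: "(real^'n) set \<Rightarrow> ((real^'n \<Rightarrow> complex) \<Rightarrow> complex) set" where
  "H_dual \<O> = {V. (\<forall>\<phi>\<in>H_space \<O>. \<forall>\<psi>\<in>H_space \<O>. V (\<lambda>\<xi>. \<phi> \<xi> + \<psi> \<xi>) = V \<phi> + V \<psi>)
                \<and> (\<forall>c. \<forall>\<phi>\<in>H_space \<O>. V (\<lambda>\<xi>. c * \<phi> \<xi>) = c * V \<phi>)
                \<and> continuous_map (H_topology \<O>) euclidean V}"

definition dist_support :: "((real^'n \<Rightarrow> complex) \<Rightarrow> complex) \<Rightarrow> (real^'n) set" where
  "dist_support V = - \<Union>{W. open W \<and> (\<forall>\<phi>\<in>test_functions W. V \<phi> = 0)}"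


section \<open>Holomorphic functions on tubes\<close>

definition cvec :: "real^'n \<Rightarrow> complex^'n" where
  "cvec x = (\<chi> i. complex_of_real (x $ i))"

definition tube :: "(real^'n) set \<Rightarrow> (complex^'n) set" where
  "tube A = {z. (\<chi> i. Im (z $ i)) \<in> A}"

definition holomorphic_several :: "(complex^'n \<Rightarrow> complex) \<Rightarrow> (complex^'n) set \<Rightarrow> bool" where
  "holomorphic_several \<psi> S \<longleftrightarrow>
     (\<forall>z\<in>S. \<exists>L. (\<psi> has_derivative L) (at z) \<and> (\<forall>c v. L (c *s v) = c * L v))"

definition Holb :: "(real^'n) set \<Rightarrow> (complex^'n \<Rightarrow> complex) set" where
  "Holb K = {\<psi>. continuous_on (tube K) \<psi> \<and> holomorphic_several \<psi> (interior (tube K)) \<and>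
     (\<forall>N::nat. bdd_above ((\<lambda>z. (1 + norm z) ^ N * cmod (\<psi> z)) ` tube K))}"

text \<open>An element of \<open>Hol_space \<O>\<close> represents its restriction to \<open>tube \<O>\<close>; its values elsewhere are
  arbitrary and never enter below.\<close>

definition Hol_space :: "(real^'n) set \<Rightarrow> (complex^'n \<Rightarrow> complex) set" where
  "Hol_space \<O> = (\<Inter>K \<in> convex_compacts \<O>. Holb K)"


section \<open>Inverse Fourier transform and carriers\<close>

definition inv_fourier :: "(complex^'n \<Rightarrow> complex) \<Rightarrow> real^'n \<Rightarrow> complex" where
  "inv_fourier \<psi> \<xi> = (1 / (2 * of_real pi) ^ CARD('n)) *
     (\<integral>x. \<psi> (cvec x) * exp (- (\<i> * of_real (\<xi> \<bullet> x))) \<partial>lborel)"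

definition inv_fourier_dual ::
    "((real^'n \<Rightarrow> complex) \<Rightarrow> complex) \<Rightarrow> (complex^'n \<Rightarrow> complex) \<Rightarrow> complex" where
  "inv_fourier_dual V \<psi> = V (inv_fourier \<psi>)"

text \<open>The distance to the empty set is infinite here, whereas \<open>infdist\<close> makes it zero.\<close>

definition carrier_nbhd :: "(real^'n) set \<Rightarrow> nat \<Rightarrow> (complex^'n) set" where
  "carrier_nbhd \<Omega> m = {z. \<Omega> \<noteq> {} \<and> infdist z (cvec ` \<Omega>) \<le> 1 / real m}"

text \<open>The supremum is taken in \<open>ennreal\<close>, so that it is \<open>0\<close> over the empty set.\<close>

definition carried_by ::
    "(real^'n) set \<Rightarrow> ((complex^'n \<Rightarrow> complex) \<Rightarrow> complex) \<Rightarrow> (real^'n) set \<Rightarrow> bool" where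
  "carried_by \<O> U \<Omega> \<longleftrightarrow>
     (\<forall>m\<ge>1. carrier_nbhd \<Omega> m \<subseteq> tube \<O> \<longrightarrow>
       (\<exists>(N::nat) (M::real). M > 0 \<and> (\<forall>\<psi>\<in>Hol_space \<O>.
          ennreal (cmod (U \<psi>)) \<le>
            ennreal M * (SUP z\<in>carrier_nbhd \<Omega> m. ennreal ((1 + norm z) ^ N * cmod (\<psi> z))))))"


section \<open>Cones\<close>

text \<open>The library's \<open>cone\<close> also demands closure under the scalar \<open>0\<close>.\<close>

definition origin_cone :: "(real^'n) set \<Rightarrow> bool" where
  "origin_cone C \<longleftrightarrow> (\<forall>c>0. (\<lambda>x. c *\<^sub>R x) ` C \<subseteq> C)"

definition contains_line :: "(real^'n) set \<Rightarrow> bool" where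
  "contains_line S \<longleftrightarrow> (\<exists>a v. v \<noteq> 0 \<and> (\<forall>t. a + t *\<^sub>R v \<in> S))"

end

theory Submission
  imports Defs "HOL-Complex_Analysis.Conformal_Mappings" "HOL-Probability.Characteristic_Functions"
    "HOL-Real_Asymp.Real_Asymp"
begin

text \<open>
  For a test function \<open>\<rho>\<close> put \<open>b \<eta> = V (\<rho>(\<cdot> - \<eta>))\<close>.  This is a continuous function of at most
  exponential growth, supported in a bounded neighbourhood of the cone \<open>Cstar\<close>.  The convolution of
  \<open>\<rho>\<close> with the Gaussian \<open>exp (- \<bar>\<eta>\<bar>\<^sup>2 / (4 l) - \<i> \<langle>\<eta>, z\<rangle>)\<close> is the inverse Fourier transform of a multiple of
  \<open>exp (- l (t - z)\<^sup>2)\<close> times the Fourier--Laplace transform of \<open>\<rho>\<close>, so the carrier estimate shows that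
  the integral of \<open>b\<close> against this Gaussian tends to \<open>0\<close> as \<open>l \<longlonglongrightarrow> \<infinity>\<close> whenever
  \<open>\<bar>Im z\<bar> < dist (Re z, C)\<close> with a margin.  If \<open>y = Im z\<close> is chosen far out in the negative dual cone of
  \<open>Cstar\<close>, then \<open>b \<eta> exp \<langle>\<eta>, y\<rangle>\<close> decays exponentially and the limit \<open>l \<longlonglongrightarrow> \<infinity>\<close> is its Fourier transform at
  \<open>Re z\<close>.  As \<open>C\<close> is a cone and not all of \<open>\<real>\<^sup>n\<close>, its complement contains points at any distance from \<open>C\<close>; near such a
  point the Fourier transform vanishes, hence everywhere by analytic continuation.  Thus \<open>b = 0\<close>
  and \<open>V \<rho> = b 0 = 0\<close>, and test functions are dense.
\<close>

section \<open>Calculus of smooth functions\<close>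

text \<open>Two scales compete. The growth rate of \<open>b\<close> is dictated by \<open>V\<close>,
  so \<open>y = Im z\<close> must be large before the integrand decays. But
  \<open>exp (- l (t - z)^2)\<close> has modulus
  \<open>exp (- l (|Re (t - z)|^2 - |Im (t - z)|^2))\<close>, which is small near \<open>C\<close>
  only if \<open>Re z\<close> lies farther from \<open>C\<close> than about \<open>|y|\<close>.
  Dilation invariance of \<open>C\<close> resolves the conflict, because it turns one ball in the
  complement into balls of every radius. Pointedness of \<open>Cstar\<close> is what lets a single
  \<open>y\<close> force decay in all directions of the cone at once. Gaussians are chosen because
  they are entire and beat every polynomial on tubes over bounded sets, so they are admissible
  whatever \<open>\<O>\<close> is. The Fourier--Laplace factor of \<open>\<rho>\<close> is bounded
  on such tubes and does no harm there, while on the other side it replaces the distribution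
  \<open>V\<close> by the function \<open>b\<close>, for which injectivity of the Fourier transform
  is elementary.\<close>

lemma has_derivative_imp_has_partial_deriv:
  assumes "(f has_derivative D) (at \<xi>)"
  shows "((\<lambda>t. f (\<xi> + t *\<^sub>R axis i 1)) has_vector_derivative D (axis i 1)) (at 0)"
proof -
  interpret D: linear D using assms has_derivative_linear by blast
  have "((\<lambda>t::real. \<xi> + t *\<^sub>R axis i 1) has_derivative (\<lambda>t. t *\<^sub>R axis i 1)) (at 0)"
    by (auto intro!: derivative_eq_intros)
  then have "((\<lambda>t. f (\<xi> + t *\<^sub>R axis i 1)) has_derivative (\<lambda>t. D (t *\<^sub>R axis i 1))) (at 0)"
    using has_derivative_compose[of "\<lambda>t. \<xi> + t *\<^sub>R axis i 1"] assms by fastforce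
  then show ?thesis
    by (simp add: has_vector_derivative_def D.scaleR)
qed

lemma partial_deriv_eq:
  assumes "(f has_derivative D) (at \<xi>)"
  shows "partial_deriv i f \<xi> = D (axis i 1)"
  unfolding partial_deriv_def
  by (rule vector_derivative_at[OF has_derivative_imp_has_partial_deriv[OF assms]])

lemma has_partial_deriv:
  assumes "f differentiable (at \<xi>)"
  shows "((\<lambda>t. f (\<xi> + t *\<^sub>R axis i 1)) has_vector_derivative partial_deriv i f \<xi>) (at 0)"
proof -
  obtain D where D: "(f has_derivative D) (at \<xi>)"
    using assms unfolding differentiable_def by blast
  show ?thesis
    using has_derivative_imp_has_partial_deriv[OF D] by (simp add: partial_deriv_eq[OF D])
qed

lemma partial_deriv_const [simp]: "partial_deriv i (\<lambda>\<xi>. c) = (\<lambda>\<xi>. 0)"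
  by (simp add: partial_deriv_def fun_eq_iff)

lemma partial_deriv_add:
  assumes "f differentiable (at \<xi>)" "g differentiable (at \<xi>)"
  shows "partial_deriv i (\<lambda>\<xi>. f \<xi> + g \<xi>) \<xi> = partial_deriv i f \<xi> + partial_deriv i g \<xi>"
  unfolding partial_deriv_def[of _ "\<lambda>\<xi>. f \<xi> + g \<xi>"]
  by (rule vector_derivative_at[OF has_vector_derivative_add[OF has_partial_deriv[OF assms(1)]
      has_partial_deriv[OF assms(2)]]])

lemma partial_deriv_mult:
  assumes "f differentiable (at \<xi>)" "g differentiable (at \<xi>)"
  shows "partial_deriv i (\<lambda>\<xi>. f \<xi> * g \<xi>) \<xi> = f \<xi> * partial_deriv i g \<xi> + partial_deriv i f \<xi> * g \<xi>"
  unfolding partial_deriv_def[of _ "\<lambda>\<xi>. f \<xi> * g \<xi>"]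
  using vector_derivative_at[OF has_vector_derivative_mult[OF has_partial_deriv[OF assms(1),
      of i] has_partial_deriv[OF assms(2), of i]]]
  by simp

lemma partial_deriv_cong_open:
  assumes "open W" "\<xi> \<in> W" "\<And>x. x \<in> W \<Longrightarrow> f x = g x"
  shows "partial_deriv i f \<xi> = partial_deriv i g \<xi>"
proof -
  have "open ((\<lambda>t::real. \<xi> + t *\<^sub>R axis i 1) -` W)"
    by (intro open_vimage assms(1) continuous_intros)
  then have "\<forall>\<^sub>F t in nhds 0. t \<in> (\<lambda>t::real. \<xi> + t *\<^sub>R axis i 1) -` W"
    by (rule eventually_nhds_in_open) (use assms(2) in simp)
  then have "\<forall>\<^sub>F t in nhds 0. f (\<xi> + t *\<^sub>R axis i 1) = g (\<xi> + t *\<^sub>R axis i 1)"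
    by eventually_elim (use assms in auto)
  then show ?thesis
    unfolding partial_deriv_def by (intro vector_derivative_cong_eq) auto
qed

lemma multi_deriv_cong_open:
  assumes "open W" "\<xi> \<in> W" "\<And>x. x \<in> W \<Longrightarrow> f x = g x"
  shows "multi_deriv \<alpha> f \<xi> = multi_deriv \<alpha> g \<xi>"
  using assms(2)
proof (induction \<alpha> arbitrary: \<xi>)
  case (Cons i \<alpha>)
  then show ?case
    unfolding multi_deriv.simps by (intro partial_deriv_cong_open[OF assms(1)])
qed (use assms in auto)

lemma multi_deriv_append: "multi_deriv (\<alpha> @ \<beta>) f = multi_deriv \<alpha> (multi_deriv \<beta> f)"
  by (induction \<alpha>) auto

lemma multi_deriv_const: "multi_deriv \<alpha> (\<lambda>\<xi>. c) = (\<lambda>\<xi>. if \<alpha> = [] then c else 0)"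
  by (induction \<alpha>) auto

lemma smooth_fun_differentiable: "smooth_fun f \<Longrightarrow> f differentiable (at \<xi>)"
  unfolding smooth_fun_def differentiable_on_def
  by (metis UNIV_I multi_deriv.simps(1))

lemma smooth_fun_multi_deriv: "smooth_fun f \<Longrightarrow> smooth_fun (multi_deriv \<alpha> f)"
  unfolding smooth_fun_def by (metis multi_deriv_append)

lemma smooth_fun_partial_deriv: "smooth_fun f \<Longrightarrow> smooth_fun (partial_deriv i f)"
  using smooth_fun_multi_deriv[of f "[i]"] by simp

lemma smooth_fun_continuous: "smooth_fun f \<Longrightarrow> continuous_on S f"
  by (meson continuous_at_imp_continuous_on differentiable_imp_continuous_within smooth_fun_differentiable)

lemma smooth_fun_const: "smooth_fun (\<lambda>\<xi>. c)"
  by (auto simp: smooth_fun_def multi_deriv_const)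

text \<open>A class \<open>X\<close> is seldom closed under differentiation by itself: the
  derivative of \<open>inverse g\<close>, for instance, is a product of two copies of
  \<open>inverse g\<close> with a smooth factor. Smooth coefficients, sums and products make the
  class large enough for derivatives to stay inside.\<close>

inductive smooth_alg :: "((real^'n \<Rightarrow> complex) \<Rightarrow> bool) \<Rightarrow> (real^'n \<Rightarrow> complex) \<Rightarrow> bool" for X where
  smooth: "smooth_fun f \<Longrightarrow> smooth_alg X f"
| base: "X f \<Longrightarrow> smooth_alg X f"
| add: "smooth_alg X f \<Longrightarrow> smooth_alg X g \<Longrightarrow> smooth_alg X (\<lambda>\<xi>. f \<xi> + g \<xi>)"
| mult: "smooth_alg X f \<Longrightarrow> smooth_alg X g \<Longrightarrow> smooth_alg X (\<lambda>\<xi>. f \<xi> * g \<xi>)"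

text \<open>A coinduction principle for smoothness, up to sums and products.\<close>

lemma smooth_alg_coinduct:
  assumes "smooth_alg X f"
    and diff: "\<And>f \<xi>. X f \<Longrightarrow> f differentiable (at \<xi>)"
    and step: "\<And>f i. X f \<Longrightarrow> smooth_alg X (partial_deriv i f)"
  shows "smooth_fun f"
proof -
  have *: "(\<forall>\<xi>. f differentiable (at \<xi>)) \<and> (\<forall>i. smooth_alg X (partial_deriv i f))"
    if "smooth_alg X f" for f
    using that
  proof induction
    case (smooth f)
    then show ?case by (auto intro: smooth_fun_differentiable smooth_alg.smooth smooth_fun_partial_deriv)
  next
    case (base f)
    then show ?case using diff step by blast
  next
    case (add f g)
    then have "partial_deriv i (\<lambda>\<xi>. f \<xi> + g \<xi>) = (\<lambda>\<xi>. partial_deriv i f \<xi> + partial_deriv i g \<xi>)" for i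
      by (auto simp: partial_deriv_add)
    then show ?case using add by (auto intro: smooth_alg.add)
  next
    case (mult f g)
    then have "partial_deriv i (\<lambda>\<xi>. f \<xi> * g \<xi>)
        = (\<lambda>\<xi>. f \<xi> * partial_deriv i g \<xi> + partial_deriv i f \<xi> * g \<xi>)" for i
      by (auto simp: partial_deriv_mult)
    then show ?case using mult by (auto intro!: smooth_alg.add smooth_alg.mult)
  qed
  have "smooth_alg X (multi_deriv \<alpha> f)" for \<alpha>
    by (induction \<alpha>) (use assms(1) * in auto)
  then show ?thesis
    using * by (auto simp: smooth_fun_def differentiable_on_def intro: differentiable_at_withinI)
qed

lemma smooth_fun_add: "smooth_fun f \<Longrightarrow> smooth_fun g \<Longrightarrow> smooth_fun (\<lambda>\<xi>. f \<xi> + g \<xi>)"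
  by (rule smooth_alg_coinduct[of "\<lambda>_. False"]) (auto intro: smooth_alg.intros)

lemma smooth_fun_mult: "smooth_fun f \<Longrightarrow> smooth_fun g \<Longrightarrow> smooth_fun (\<lambda>\<xi>. f \<xi> * g \<xi>)"
  by (rule smooth_alg_coinduct[of "\<lambda>_. False"]) (auto intro: smooth_alg.intros)

lemma smooth_fun_cmult: "smooth_fun f \<Longrightarrow> smooth_fun (\<lambda>\<xi>. c * f \<xi>)"
  by (intro smooth_fun_mult smooth_fun_const)

lemma smooth_fun_diff: "smooth_fun f \<Longrightarrow> smooth_fun g \<Longrightarrow> smooth_fun (\<lambda>\<xi>. f \<xi> - g \<xi>)"
  using smooth_fun_add[of f "\<lambda>\<xi>. -1 * g \<xi>"] smooth_fun_cmult[of g "-1"] by simp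

lemma smooth_fun_sum: "(\<And>x. x \<in> I \<Longrightarrow> smooth_fun (f x)) \<Longrightarrow> smooth_fun (\<lambda>\<xi>. \<Sum>x\<in>I. f x \<xi>)"
  by (induction I rule: infinite_finite_induct) (auto intro: smooth_fun_const smooth_fun_add)

section \<open>Linearity, product bounds and affine substitution for iterated derivatives\<close>

lemma multi_deriv_add:
  assumes "smooth_fun f" "smooth_fun g"
  shows "multi_deriv \<alpha> (\<lambda>\<xi>. f \<xi> + g \<xi>) = (\<lambda>\<xi>. multi_deriv \<alpha> f \<xi> + multi_deriv \<alpha> g \<xi>)"
proof (induction \<alpha>)
  case (Cons i \<alpha>)
  show ?case
    unfolding multi_deriv.simps Cons
    by (intro ext partial_deriv_add smooth_fun_differentiable smooth_fun_multi_deriv assms)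
qed simp

lemma multi_deriv_cmult:
  assumes "smooth_fun f"
  shows "multi_deriv \<alpha> (\<lambda>\<xi>. c * f \<xi>) = (\<lambda>\<xi>. c * multi_deriv \<alpha> f \<xi>)"
proof (induction \<alpha>)
  case (Cons i \<alpha>)
  show ?case
    unfolding multi_deriv.simps Cons
    by (simp add: fun_eq_iff partial_deriv_mult smooth_fun_differentiable smooth_fun_multi_deriv assms)
qed simp

lemma multi_deriv_diff:
  assumes "smooth_fun f" "smooth_fun g"
  shows "multi_deriv \<alpha> (\<lambda>\<xi>. f \<xi> - g \<xi>) = (\<lambda>\<xi>. multi_deriv \<alpha> f \<xi> - multi_deriv \<alpha> g \<xi>)"
  using multi_deriv_add[OF assms(1) smooth_fun_cmult[OF assms(2), of "-1"], of \<alpha>]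
    multi_deriv_cmult[OF assms(2), of \<alpha> "-1"] by simp

lemma multi_deriv_sum:
  assumes "\<And>x. x \<in> I \<Longrightarrow> smooth_fun (f x)"
  shows "multi_deriv \<alpha> (\<lambda>\<xi>. \<Sum>x\<in>I. f x \<xi>) = (\<lambda>\<xi>. \<Sum>x\<in>I. multi_deriv \<alpha> (f x) \<xi>)"
  using assms
  by (induction I rule: infinite_finite_induct)
    (auto simp: multi_deriv_const multi_deriv_add smooth_fun_sum)

text \<open>A crude Leibniz rule: every differentiation splits a product into two, which accounts
  for the power of two. The induction removes the innermost derivative, so that it falls on
  \<open>f\<close> and \<open>g\<close> themselves and the bounds \<open>A\<close> and
  \<open>B\<close> pass to their partial derivatives.\<close>

lemma norm_multi_deriv_mult_le:
  assumes "smooth_fun f" "smooth_fun g"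
    and "\<And>\<beta>. length \<beta> \<le> length \<alpha> \<Longrightarrow> cmod (multi_deriv \<beta> f \<xi>) \<le> A"
    and "\<And>\<beta>. length \<beta> \<le> length \<alpha> \<Longrightarrow> cmod (multi_deriv \<beta> g \<xi>) \<le> B"
  shows "cmod (multi_deriv \<alpha> (\<lambda>\<xi>. f \<xi> * g \<xi>) \<xi>) \<le> 2 ^ length \<alpha> * A * B"
  using assms
proof (induction \<alpha> arbitrary: f g rule: rev_induct)
  case Nil
  have "cmod (f \<xi>) \<le> A" "cmod (g \<xi>) \<le> B"
    using Nil(3)[of "[]"] Nil(4)[of "[]"] by auto
  then show ?case
    by (simp add: norm_mult mult_mono')
next
  case (snoc i \<alpha>)
  have pd: "partial_deriv i (\<lambda>\<xi>. f \<xi> * g \<xi>)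
        = (\<lambda>\<xi>. f \<xi> * partial_deriv i g \<xi> + partial_deriv i f \<xi> * g \<xi>)"
    by (auto simp: partial_deriv_mult smooth_fun_differentiable snoc)
  have sm: "smooth_fun (partial_deriv i f)" "smooth_fun (partial_deriv i g)"
    using snoc by (auto intro: smooth_fun_partial_deriv)
  have d: "cmod (multi_deriv \<beta> (partial_deriv i f) \<xi>) \<le> A" "cmod (multi_deriv \<beta> (partial_deriv i g) \<xi>) \<le> B"
    if "length \<beta> \<le> length \<alpha>" for \<beta>
    using snoc(4)[of "\<beta> @ [i]"] snoc(5)[of "\<beta> @ [i]"] that by (auto simp: multi_deriv_append)
  have "cmod (multi_deriv \<alpha> (\<lambda>\<xi>. f \<xi> * partial_deriv i g \<xi>) \<xi>) \<le> 2 ^ length \<alpha> * A * B"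
    by (rule snoc.IH) (use snoc sm d in auto)
  moreover have "cmod (multi_deriv \<alpha> (\<lambda>\<xi>. partial_deriv i f \<xi> * g \<xi>) \<xi>) \<le> 2 ^ length \<alpha> * A * B"
    by (rule snoc.IH) (use snoc sm d in auto)
  ultimately have "cmod (multi_deriv \<alpha> (\<lambda>\<xi>. f \<xi> * partial_deriv i g \<xi> + partial_deriv i f \<xi> * g \<xi>) \<xi>)
      \<le> 2 ^ length \<alpha> * A * B + 2 ^ length \<alpha> * A * B"
    by (simp only: multi_deriv_add smooth_fun_mult snoc.prems sm) (rule order_trans[OF
        norm_triangle_ineq add_mono])
  then show ?case
    by (simp add: multi_deriv_append pd mult_ac)
qed

lemma multi_deriv_affine:
  fixes f :: "real^'n \<Rightarrow> complex"
  assumes "smooth_fun f"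
  shows "multi_deriv \<alpha> (\<lambda>\<xi>. f (a + c *\<^sub>R \<xi>)) = (\<lambda>\<xi>. c ^ length \<alpha> *\<^sub>R multi_deriv \<alpha> f (a + c *\<^sub>R \<xi>))"
    and "smooth_fun (\<lambda>\<xi>. f (a + c *\<^sub>R \<xi>))"
proof -
  \<comment> \<open>The scalar \<open>k\<close> stands for the power of \<open>c\<close> produced by
    earlier differentiations.\<close>
  have der: "\<exists>D. ((\<lambda>\<xi>. k *\<^sub>R g (a + c *\<^sub>R \<xi>)) has_derivative (\<lambda>v. k *\<^sub>R D (c *\<^sub>R v))) (at \<xi>)
      \<and> (g has_derivative D) (at (a + c *\<^sub>R \<xi>))"
    if g: "smooth_fun g" for k g and \<xi> :: "real^'n"
  proof -
    obtain D where D: "(g has_derivative D) (at (a + c *\<^sub>R \<xi>))"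
      using g smooth_fun_differentiable unfolding differentiable_def by blast
    have "((\<lambda>\<xi>. a + c *\<^sub>R \<xi>) has_derivative (\<lambda>v. c *\<^sub>R v)) (at \<xi>)"
      by (auto intro!: derivative_eq_intros)
    then have "((\<lambda>\<xi>. g (a + c *\<^sub>R \<xi>)) has_derivative (\<lambda>v. D (c *\<^sub>R v))) (at \<xi>)"
      using D has_derivative_compose by blast
    then show ?thesis using D by (auto intro!: derivative_eq_intros)
  qed
  have pd: "partial_deriv i (\<lambda>\<xi>. k *\<^sub>R g (a + c *\<^sub>R \<xi>)) \<xi> = (k * c) *\<^sub>R partial_deriv i g (a + c *\<^sub>R \<xi>)"
    if g: "smooth_fun g" for k g i and \<xi> :: "real^'n"
  proof -
    obtain D where D: "((\<lambda>\<xi>. k *\<^sub>R g (a + c *\<^sub>R \<xi>)) has_derivative (\<lambda>v. k *\<^sub>R D (c *\<^sub>R v))) (at \<xi>)"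
      "(g has_derivative D) (at (a + c *\<^sub>R \<xi>))"
      using der[OF g] by blast
    show ?thesis
      using partial_deriv_eq[OF D(1), of i] partial_deriv_eq[OF D(2), of i]
        linear_scale[OF has_derivative_linear[OF D(2)]] by simp
  qed
  show *: "multi_deriv \<alpha> (\<lambda>\<xi>. f (a + c *\<^sub>R \<xi>)) = (\<lambda>\<xi>. c ^ length \<alpha> *\<^sub>R multi_deriv \<alpha> f (a + c *\<^sub>R \<xi>))" for \<alpha>
    by (induction \<alpha>) (auto simp: pd smooth_fun_multi_deriv assms mult.commute)
  show "smooth_fun (\<lambda>\<xi>. f (a + c *\<^sub>R \<xi>))"
    unfolding smooth_fun_def * differentiable_on_def
    using der[OF smooth_fun_multi_deriv[OF assms]] unfolding differentiable_def
    by (blast intro: has_derivative_at_withinI)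
qed

lemma multi_deriv_translate:
  assumes "smooth_fun f"
  shows "multi_deriv \<alpha> (\<lambda>\<xi>. f (\<xi> - a)) = (\<lambda>\<xi>. multi_deriv \<alpha> f (\<xi> - a))"
    and "smooth_fun (\<lambda>\<xi>. f (\<xi> - a))"
  using multi_deriv_affine[OF assms, where c=1 and a="-a"] by auto

lemma smooth_fun_component: "smooth_fun (\<lambda>\<xi>::real^'n. complex_of_real (\<xi> $ j))"
proof (rule smooth_alg_coinduct[of "\<lambda>f. f = (\<lambda>\<xi>. complex_of_real (\<xi> $ j))"])
  have d: "((\<lambda>\<xi>::real^'n. complex_of_real (\<xi> $ j)) has_derivative (\<lambda>v. complex_of_real (v $ j))) (at \<xi>)" for \<xi>
    by (intro bounded_linear_imp_has_derivative bounded_linear_compose[OF bounded_linear_of_real]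
        bounded_linear_vec_nth)
  show "f differentiable at \<xi>" if "f = (\<lambda>\<xi>. complex_of_real (\<xi> $ j))" for f and \<xi> :: "real^'n"
    using d that differentiable_def by blast
  show "smooth_alg (\<lambda>f. f = (\<lambda>\<xi>. complex_of_real (\<xi> $ j))) (partial_deriv i f)" 
    if "f = (\<lambda>\<xi>. complex_of_real (\<xi> $ j))" for f and i :: 'n
  proof -
    have "partial_deriv i f = (\<lambda>\<xi>. complex_of_real (axis i 1 $ j))"
      unfolding that by (intro ext partial_deriv_eq[OF d])
    then show ?thesis by (auto intro: smooth_alg.smooth smooth_fun_const)
  qed
qed (auto intro: smooth_alg.base)

lemma smooth_fun_norm_power2: "smooth_fun (\<lambda>\<xi>::real^'n. complex_of_real ((norm \<xi>)\<^sup>2))"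
proof -
  have "complex_of_real ((norm \<xi>)\<^sup>2) = (\<Sum>j\<in>UNIV. complex_of_real (\<xi> $ j) * complex_of_real (\<xi> $ j))"
      for \<xi> :: "real^'n"
    by (simp add: power2_norm_eq_inner inner_vec_def)
  then show ?thesis
    by (simp only:) (intro smooth_fun_sum smooth_fun_mult smooth_fun_component)
qed

lemma smooth_fun_inverse:
  assumes "smooth_fun g" "\<And>\<xi>. g \<xi> \<noteq> 0"
  shows "smooth_fun (\<lambda>\<xi>. inverse (g \<xi>))"
proof (rule smooth_alg_coinduct[of "\<lambda>f. f = (\<lambda>\<xi>. inverse (g \<xi>))"])
  show "f differentiable at \<xi>" if "f = (\<lambda>\<xi>. inverse (g \<xi>))" for f \<xi>
    unfolding that by (intro differentiable_inverse smooth_fun_differentiable assms)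
  show "smooth_alg (\<lambda>f. f = (\<lambda>\<xi>. inverse (g \<xi>))) (partial_deriv i f)" if f: "f = (\<lambda>\<xi>. inverse (g \<xi>))" for f i
  proof -
    have "partial_deriv i f = (\<lambda>\<xi>. (-1 * partial_deriv i g \<xi>) * (f \<xi> * f \<xi>))"
    proof
      fix \<xi>
      obtain D where D: "(g has_derivative D) (at \<xi>)"
        using smooth_fun_differentiable[OF assms(1)] differentiable_def by blast
      have "(f has_derivative (\<lambda>v. - (inverse (g \<xi>) * D v * inverse (g \<xi>)))) (at \<xi>)"
        unfolding f using D assms(2) by (auto intro!: derivative_eq_intros)
      from partial_deriv_eq[OF this, of i] partial_deriv_eq[OF D, of i]
      show "partial_deriv i f \<xi> = (-1 * partial_deriv i g \<xi>) * (f \<xi> * f \<xi>)"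
        by (simp add: f)
    qed
    then show ?thesis
      by (simp only:) (intro smooth_alg.mult smooth_alg.base f
          smooth_alg.smooth[OF smooth_fun_cmult[OF smooth_fun_partial_deriv[OF assms(1)]]])
  qed
qed (auto intro: smooth_alg.base)

subsection \<open>Smooth cutoff functions\<close>

text \<open>For \<open>k = 0\<close> this is the classical flat function. The powers of
  \<open>inverse t\<close> make the family closed under differentiation up to linear combinations,
  so that one coinduction treats all its members.\<close>

definition flat_fun :: "nat \<Rightarrow> real \<Rightarrow> real" where
  "flat_fun k t = (if t > 0 then inverse t ^ k * exp (- inverse t) else 0)"

lemma flat_fun_tendsto_0: "(flat_fun k \<longlongrightarrow> 0) (at 0)"
proof -
  have "((\<lambda>x::real. x ^ k / exp x) \<longlongrightarrow> 0) at_top"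
    by (rule tendsto_power_div_exp_0)
  then have "((\<lambda>t::real. inverse t ^ k / exp (inverse t)) \<longlongrightarrow> 0) (at_right 0)"
    using filterlim_compose[OF _ filterlim_inverse_at_top_right] by blast
  moreover have "\<forall>\<^sub>F t in at_right 0. inverse t ^ k / exp (inverse t) = flat_fun k t"
    by (auto simp: eventually_at_filter flat_fun_def exp_minus divide_inverse)
  ultimately have "(flat_fun k \<longlongrightarrow> 0) (at_right 0)"
    using tendsto_cong by fastforce
  moreover have "(flat_fun k \<longlongrightarrow> 0) (at_left 0)"
    by (rule tendsto_eventually) (auto simp: eventually_at_filter flat_fun_def)
  ultimately show ?thesis
    using filterlim_split_at_real by blast
qed

lemma flat_fun_deriv:
  "(flat_fun k has_real_derivative (flat_fun (k+2) t - real k * flat_fun (k+1) t)) (at t)"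
proof -
  consider "t > 0" | "t < 0" | "t = 0" by linarith
  then show ?thesis
  proof cases
    case 1
    have D: "((\<lambda>t. inverse t ^ k * exp (- inverse t)) has_real_derivative (flat_fun (k+2) t - real k
        * flat_fun (k+1) t)) (at t)"
      using 1 by (auto intro!: derivative_eq_intros simp: flat_fun_def power2_eq_square algebra_simps
          power_Suc[symmetric] simp del: power_Suc)
        (cases k; simp add: algebra_simps)
    have "\<forall>\<^sub>F s in nhds t. s \<in> {0<..}"
      using 1 by (intro eventually_nhds_in_open) auto
    then have "\<forall>\<^sub>F s in nhds t. inverse s ^ k * exp (- inverse s) = flat_fun k s"
      by eventually_elim (auto simp: flat_fun_def)
    from DERIV_cong_ev[OF refl this refl] D show ?thesis by blast
  next
    case 2
    have "\<forall>\<^sub>F s in nhds t. s \<in> {..<0}"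
      using 2 by (intro eventually_nhds_in_open) auto
    then have "\<forall>\<^sub>F s in nhds t. 0 = flat_fun k s"
      by eventually_elim (auto simp: flat_fun_def)
    from DERIV_cong_ev[OF refl this refl, of 0] show ?thesis
      using 2 by (simp add: flat_fun_def[of _ t])
  next
    case 3
    \<comment> \<open>Division by \<open>h\<close> raises the index by one, so the difference
      quotient at \<open>0\<close> is again a flat function and tends to \<open>0\<close>.\<close>
    have "(\<lambda>h. (flat_fun k (0 + h) - flat_fun k 0) / h) = flat_fun (k+1)"
      by (auto simp: flat_fun_def fun_eq_iff divide_inverse mult_ac)
    then show ?thesis
      using flat_fun_tendsto_0[of "k+1"] 3 by (simp add: DERIV_def flat_fun_def)
  qed
qed

lemma smooth_fun_flat_fun:
  fixes q :: "real^'n \<Rightarrow> real"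
  assumes q: "smooth_fun (\<lambda>\<xi>. complex_of_real (q \<xi>))"
  shows "smooth_fun (\<lambda>\<xi>. complex_of_real (flat_fun k (q \<xi>)))"
proof -
  let ?X = "\<lambda>f. \<exists>k. f = (\<lambda>\<xi>. complex_of_real (flat_fun k (q \<xi>)))"
  have der: "\<exists>D :: real^'n \<Rightarrow> complex. ((\<lambda>\<xi>. complex_of_real (q \<xi>)) has_derivative D) (at \<xi>) \<and>
     ((\<lambda>\<xi>. complex_of_real (flat_fun k (q \<xi>))) has_derivative
       (\<lambda>v. of_real (flat_fun (k+2) (q \<xi>) - real k * flat_fun (k+1) (q \<xi>)) * D v)) (at \<xi>)" for k \<xi>
  proof -
    obtain D where D: "((\<lambda>\<xi>. complex_of_real (q \<xi>)) has_derivative D) (at \<xi>)"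
      using smooth_fun_differentiable[OF q] differentiable_def by blast
    \<comment> \<open>The argument of \<open>flat_fun k\<close> is real, so the chain rule needs
      \<open>q\<close> as a real function. Uniqueness of derivatives then shows that
      \<open>D\<close> takes real values, which restores the complex form.\<close>
    have "((\<lambda>\<xi>. Re (complex_of_real (q \<xi>))) has_derivative (\<lambda>v. Re (D v))) (at \<xi>)"
      by (intro derivative_intros D)
    then have q': "(q has_derivative (\<lambda>v. Re (D v))) (at \<xi>)" by simp
    then have "((\<lambda>\<xi>. complex_of_real (q \<xi>)) has_derivative (\<lambda>v. of_real (Re (D v)))) (at \<xi>)"
      by (intro derivative_intros)
    with D have "D = (\<lambda>v. of_real (Re (D v)))"
      using has_derivative_unique by blast
    then have D': "of_real (Re (D v)) = D v" for v by metis
    have "((\<lambda>\<xi>. flat_fun k (q \<xi>)) has_derivative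
       (\<lambda>v. (flat_fun (k+2) (q \<xi>) - real k * flat_fun (k+1) (q \<xi>)) * Re (D v))) (at \<xi>)"
      using has_derivative_compose[OF q' flat_fun_deriv[of k "q \<xi>", unfolded has_field_derivative_def]] .
    then have "((\<lambda>\<xi>. complex_of_real (flat_fun k (q \<xi>))) has_derivative
       (\<lambda>v. of_real ((flat_fun (k+2) (q \<xi>) - real k * flat_fun (k+1) (q \<xi>)) * Re (D v)))) (at \<xi>)"
      by (intro derivative_intros)
    then show ?thesis using D unfolding of_real_mult D' by blast
  qed
  show ?thesis
  proof (rule smooth_alg_coinduct[of ?X])
    show "smooth_alg ?X (\<lambda>\<xi>. complex_of_real (flat_fun k (q \<xi>)))"
      by (auto intro: smooth_alg.base)
    show "f differentiable at \<xi>" if "?X f" for f \<xi>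
      using that der differentiable_def by blast
    show "smooth_alg ?X (partial_deriv i f)" if Xf: "?X f" for f i
    proof -
      obtain k where f: "f = (\<lambda>\<xi>. complex_of_real (flat_fun k (q \<xi>)))" using Xf by blast
      have "partial_deriv i f = (\<lambda>\<xi>. (complex_of_real (flat_fun (k+2) (q \<xi>)) + (- of_nat k)
          * complex_of_real (flat_fun (k+1) (q \<xi>)))
          * partial_deriv i (\<lambda>\<xi>. complex_of_real (q \<xi>)) \<xi>)"
      proof
        fix \<xi>
        obtain D where D: "((\<lambda>\<xi>. complex_of_real (q \<xi>)) has_derivative D) (at \<xi>)"
          and D2: "(f has_derivative (\<lambda>v. of_real (flat_fun (k+2) (q \<xi>) - real k * flat_fun (k+1) (q \<xi>))
              * D v)) (at \<xi>)"
          using der[of \<xi> k] f by blast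
        show "partial_deriv i f \<xi> = (complex_of_real (flat_fun (k+2) (q \<xi>)) + (- of_nat k)
            * complex_of_real (flat_fun (k+1) (q \<xi>)))
          * partial_deriv i (\<lambda>\<xi>. complex_of_real (q \<xi>)) \<xi>"
          using partial_deriv_eq[OF D, of i] partial_deriv_eq[OF D2, of i] by (simp add: algebra_simps)
      qed
      moreover have "smooth_alg ?X (\<lambda>\<xi>. complex_of_real (flat_fun k (q \<xi>)))" for k
        by (rule smooth_alg.base) blast
      ultimately show ?thesis
        by (simp only:) (intro smooth_alg.mult smooth_alg.add smooth_alg.smooth[OF smooth_fun_const]
              smooth_alg.smooth[OF smooth_fun_partial_deriv[OF q]])
    qed
  qed
qed

text \<open>The usual quotient of flat functions, in terms of the squared norm because the norm
  itself is not smooth at the origin. The two arguments of \<open>flat_fun\<close> have sum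
  \<open>3\<close>, so one of them is positive and the denominator never vanishes.\<close>

definition cutoff :: "real^'n \<Rightarrow> complex" where
  "cutoff \<xi> = of_real (flat_fun 0 (4 - (norm \<xi>)\<^sup>2)) *
     inverse (of_real (flat_fun 0 (4 - (norm \<xi>)\<^sup>2)) + of_real (flat_fun 0 ((norm \<xi>)\<^sup>2 - 1)))"

lemma cutoff_eq_1: "norm \<xi> \<le> 1 \<Longrightarrow> cutoff \<xi> = 1"
  using power_mono[of "norm \<xi>" 1 2] by (simp add: cutoff_def flat_fun_def)

lemma cutoff_eq_0: "norm \<xi> \<ge> 2 \<Longrightarrow> cutoff \<xi> = 0"
  using power_mono[of 2 "norm \<xi>" 2] by (simp add: cutoff_def flat_fun_def)

lemma smooth_fun_cutoff: "smooth_fun (cutoff :: real^'n \<Rightarrow> complex)"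
proof -
  have "smooth_fun (\<lambda>\<xi>::real^'n. complex_of_real 4 - complex_of_real ((norm \<xi>)\<^sup>2))"
       "smooth_fun (\<lambda>\<xi>::real^'n. complex_of_real ((norm \<xi>)\<^sup>2) - complex_of_real 1)"
    by (intro smooth_fun_diff smooth_fun_const smooth_fun_norm_power2)+
  then have q: "smooth_fun (\<lambda>\<xi>::real^'n. complex_of_real (4 - (norm \<xi>)\<^sup>2))"
       "smooth_fun (\<lambda>\<xi>::real^'n. complex_of_real ((norm \<xi>)\<^sup>2 - 1))"
    by (simp_all only: of_real_diff)
  have nz: "complex_of_real (flat_fun 0 (4 - (norm \<xi>)\<^sup>2)) + of_real (flat_fun 0 ((norm \<xi>)\<^sup>2 - 1)) \<noteq> 0"
      for \<xi> :: "real^'n"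
  proof -
    have "flat_fun 0 (4 - (norm \<xi>)\<^sup>2) + flat_fun 0 ((norm \<xi>)\<^sup>2 - 1) > 0"
      by (auto simp: flat_fun_def add_pos_pos)
    then show ?thesis by (metis of_real_add of_real_eq_0_iff order_less_irrefl)
  qed
  show ?thesis
    unfolding cutoff_def
    by (intro smooth_fun_mult smooth_fun_inverse smooth_fun_add smooth_fun_flat_fun q nz)
qed

section \<open>Functionals on \<open>H_space\<close>\<close>

lemma support_fun_bdd:
  assumes "compact K" shows "bdd_above ((\<lambda>x. \<xi> \<bullet> x) ` K)"
  by (intro bounded_imp_bdd_above compact_imp_bounded compact_continuous_image assms continuous_intros)

lemma support_fun_upper: "compact K \<Longrightarrow> x \<in> K \<Longrightarrow> \<xi> \<bullet> x \<le> support_fun K \<xi>"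
  unfolding support_fun_def by (intro cSUP_upper support_fun_bdd)

lemma support_fun_mono:
  assumes "compact K'" "K \<subseteq> K'" "K \<noteq> {}"
  shows "support_fun K \<xi> \<le> support_fun K' \<xi>"
  using assms unfolding support_fun_def by (intro cSUP_subset_mono support_fun_bdd) auto

lemma support_fun_le:
  assumes "K \<noteq> {}" "\<And>x. x \<in> K \<Longrightarrow> norm x \<le> R"
  shows "support_fun K \<xi> \<le> R * norm \<xi>"
  unfolding support_fun_def
proof (rule cSUP_least[OF assms(1)])
  fix x assume "x \<in> K"
  have "\<xi> \<bullet> x \<le> norm \<xi> * norm x" by (rule norm_cauchy_schwarz)
  also have "\<dots> \<le> norm \<xi> * R" using assms(2)[OF \<open>x \<in> K\<close>] by (intro mult_left_mono) auto
  finally show "\<xi> \<bullet> x \<le> R * norm \<xi>" by (simp add: mult.commute)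
qed

lemma finite_multi_indices: "finite {\<alpha>::('n::finite) list. length \<alpha> \<le> N}"
  using finite_lists_length_le[of "UNIV::'n set" N] by simp

abbreviation weighted :: "(real^'n) set \<Rightarrow> 'n list \<Rightarrow> (real^'n \<Rightarrow> complex) \<Rightarrow> real^'n \<Rightarrow> real" where
  "weighted K \<alpha> \<phi> \<xi> \<equiv> exp (support_fun K \<xi>) * cmod (multi_deriv \<alpha> \<phi> \<xi>)"

lemma HbD:
  assumes "\<phi> \<in> Hb K"
  shows "\<exists>B. \<forall>\<xi>. weighted K \<alpha> \<phi> \<xi> \<le> B"
proof -
  have "bounded (range (\<lambda>\<xi>. exp (support_fun K \<xi>) *\<^sub>R multi_deriv \<alpha> \<phi> \<xi>))"
    using assms unfolding Hb_def by blast
  then obtain B where "\<forall>x\<in>range (\<lambda>\<xi>. exp (support_fun K \<xi>) *\<^sub>R multi_deriv \<alpha> \<phi> \<xi>). norm x \<le> B"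
    using bounded_iff by metis
  then show ?thesis by (intro exI[of _ B]) auto
qed

lemma HbI:
  assumes "smooth_fun \<phi>" "\<And>\<alpha>. \<exists>B. \<forall>\<xi>. weighted K \<alpha> \<phi> \<xi> \<le> B"
  shows "\<phi> \<in> Hb K"
  unfolding Hb_def bounded_iff using assms by auto

lemma Hb_seminorm_bdd:
  fixes K :: "(real^'n) set"
  assumes "\<phi> \<in> Hb K"
  shows "bdd_above ((\<lambda>(\<xi>, \<alpha>). weighted K \<alpha> \<phi> \<xi>) ` (UNIV \<times> {\<alpha>. length \<alpha> \<le> N}))"
proof -
  obtain B where B: "\<And>\<alpha> \<xi>. weighted K \<alpha> \<phi> \<xi> \<le> B \<alpha>"
    using HbD[OF assms] by metis
  show ?thesis
  proof (rule bdd_aboveI2)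
    fix x :: "(real^'n) \<times> 'n list" assume "x \<in> UNIV \<times> {\<alpha>. length \<alpha> \<le> N}"
    then obtain \<xi> \<alpha> where x: "x = (\<xi>, \<alpha>)" "length \<alpha> \<le> N" by auto
    have "weighted K \<alpha> \<phi> \<xi> \<le> B \<alpha>" by (rule B)
    also have "B \<alpha> \<le> Max (B ` {\<alpha>. length \<alpha> \<le> N})"
      using x finite_multi_indices by (intro Max_ge) auto
    finally show "(case x of (\<xi>, \<alpha>) \<Rightarrow> weighted K \<alpha> \<phi> \<xi>)
        \<le> Max (B ` {\<alpha>. length \<alpha> \<le> N})"
      using x by simp
  qed
qed

lemma Hb_seminorm_upper:
  assumes "\<phi> \<in> Hb K" "length \<alpha> \<le> N"
  shows "weighted K \<alpha> \<phi> \<xi> \<le> Hb_seminorm K N \<phi>"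
  unfolding Hb_seminorm_def
  using cSUP_upper[OF _ Hb_seminorm_bdd[OF assms(1), of N], of "(\<xi>, \<alpha>)"] assms(2) by simp

lemma Hb_seminorm_least:
  assumes "\<And>\<xi> \<alpha>. length \<alpha> \<le> N \<Longrightarrow> weighted K \<alpha> \<phi> \<xi> \<le> B"
  shows "Hb_seminorm K N \<phi> \<le> B"
  unfolding Hb_seminorm_def
proof (rule cSUP_least)
  have "(0, []) \<in> UNIV \<times> {\<alpha>. length \<alpha> \<le> N}" by simp
  then show "UNIV \<times> {\<alpha>::'a list. length \<alpha> \<le> N} \<noteq> ({} :: ((real^'a) \<times> 'a list) set)" by blast
qed (use assms in auto)

lemma Hb_cmult: "\<phi> \<in> Hb K \<Longrightarrow> (\<lambda>\<xi>. c * \<phi> \<xi>) \<in> Hb K"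
proof (rule HbI)
  assume \<phi>: "\<phi> \<in> Hb K"
  then have s: "smooth_fun \<phi>" by (simp add: Hb_def)
  then show "smooth_fun (\<lambda>\<xi>. c * \<phi> \<xi>)" by (rule smooth_fun_cmult)
  fix \<alpha>
  obtain B where B: "\<And>\<xi>. weighted K \<alpha> \<phi> \<xi> \<le> B"
    using HbD[OF \<phi>] by metis
  have "weighted K \<alpha> (\<lambda>\<xi>. c * \<phi> \<xi>) \<xi> \<le> cmod c * B" for \<xi>
    using mult_left_mono[OF B[of \<xi>], of "cmod c"] by (simp add: multi_deriv_cmult s norm_mult mult_ac)
  then show "\<exists>B. \<forall>\<xi>. weighted K \<alpha> (\<lambda>\<xi>. c * \<phi> \<xi>) \<xi> \<le> B" by blast
qed

lemma Hb_add: "\<phi> \<in> Hb K \<Longrightarrow> \<psi> \<in> Hb K \<Longrightarrow> (\<lambda>\<xi>. \<phi> \<xi> + \<psi> \<xi>) \<in> Hb K"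
proof (rule HbI)
  assume \<phi>: "\<phi> \<in> Hb K" and \<psi>: "\<psi> \<in> Hb K"
  then have s: "smooth_fun \<phi>" "smooth_fun \<psi>" by (simp_all add: Hb_def)
  then show "smooth_fun (\<lambda>\<xi>. \<phi> \<xi> + \<psi> \<xi>)" by (rule smooth_fun_add)
  fix \<alpha>
  obtain B where B: "\<And>\<xi>. weighted K \<alpha> \<phi> \<xi> \<le> B"
    using HbD[OF \<phi>] by metis
  obtain B' where B': "\<And>\<xi>. weighted K \<alpha> \<psi> \<xi> \<le> B'"
    using HbD[OF \<psi>] by metis
  have "weighted K \<alpha> (\<lambda>\<xi>. \<phi> \<xi> + \<psi> \<xi>) \<xi> \<le> B + B'" for \<xi>
  proof -
    have "weighted K \<alpha> (\<lambda>\<xi>. \<phi> \<xi> + \<psi> \<xi>) \<xi>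
      \<le> exp (support_fun K \<xi>) * (cmod (multi_deriv \<alpha> \<phi> \<xi>) + cmod (multi_deriv \<alpha> \<psi> \<xi>))"
      unfolding multi_deriv_add[OF s] by (intro mult_left_mono norm_triangle_ineq) auto
    also have "\<dots> \<le> B + B'" using B[of \<xi>] B'[of \<xi>] by (simp add: distrib_left)
    finally show ?thesis .
  qed
  then show "\<exists>B. \<forall>\<xi>. weighted K \<alpha> (\<lambda>\<xi>. \<phi> \<xi> + \<psi> \<xi>) \<xi> \<le> B" by blast
qed

lemma Hb_diff: "\<phi> \<in> Hb K \<Longrightarrow> \<psi> \<in> Hb K \<Longrightarrow> (\<lambda>\<xi>. \<phi> \<xi> - \<psi> \<xi>) \<in> Hb K"
  using Hb_add[OF _ Hb_cmult[where c="-1"]] by fastforce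

lemma Hb_seminorm_triangle:
  assumes "\<phi> \<in> Hb K" "\<psi> \<in> Hb K" "\<omega> \<in> Hb K"
  shows "Hb_seminorm K N (\<lambda>\<xi>. \<phi> \<xi> - \<omega> \<xi>) \<le> Hb_seminorm K N (\<lambda>\<xi>. \<phi> \<xi> - \<psi> \<xi>) + Hb_seminorm K N (\<lambda>\<xi>. \<psi> \<xi> - \<omega> \<xi>)"
proof (rule Hb_seminorm_least)
  fix \<xi> and \<alpha> :: "'a list" assume \<alpha>: "length \<alpha> \<le> N"
  have s: "smooth_fun \<phi>" "smooth_fun \<psi>" "smooth_fun \<omega>" using assms by (simp_all add: Hb_def)
  have "weighted K \<alpha> (\<lambda>\<xi>. \<phi> \<xi> - \<omega> \<xi>) \<xi>
    \<le> exp (support_fun K \<xi>) * (cmod (multi_deriv \<alpha> (\<lambda>\<xi>. \<phi> \<xi> - \<psi> \<xi>) \<xi>) + cmod (multi_deriv \<alpha> (\<lambda>\<xi>. \<psi> \<xi>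
        - \<omega> \<xi>) \<xi>))"
    unfolding multi_deriv_diff[OF s(1,2)] multi_deriv_diff[OF s(1,3)] multi_deriv_diff[OF s(2,3)]
    by (intro mult_left_mono norm_diff_triangle_ineq[THEN order_trans] norm_triangle_ineq[THEN
        order_trans[rotated]]) 
      (auto intro: order_trans[OF _ norm_triangle_ineq])
  also have "\<dots> \<le> Hb_seminorm K N (\<lambda>\<xi>. \<phi> \<xi> - \<psi> \<xi>) + Hb_seminorm K N (\<lambda>\<xi>. \<psi> \<xi> - \<omega> \<xi>)"
    using Hb_seminorm_upper[OF Hb_diff[OF assms(1,2)] \<alpha>,
        of \<xi>] Hb_seminorm_upper[OF Hb_diff[OF assms(2,3)] \<alpha>, of \<xi>]
    by (simp add: distrib_left)
  finally show "weighted K \<alpha> (\<lambda>\<xi>. \<phi> \<xi> - \<omega> \<xi>) \<xi>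
    \<le> Hb_seminorm K N (\<lambda>\<xi>. \<phi> \<xi> - \<psi> \<xi>) + Hb_seminorm K N (\<lambda>\<xi>. \<psi> \<xi> - \<omega> \<xi>)" .
qed

lemma Hb_seminorm_mono:
  assumes "\<phi> \<in> Hb K'" "compact K'" "K \<subseteq> K'" "K \<noteq> {}" "N \<le> N'"
  shows "Hb_seminorm K N \<phi> \<le> Hb_seminorm K' N' \<phi>"
proof (rule Hb_seminorm_least)
  fix \<xi> and \<alpha> :: "'a list" assume \<alpha>: "length \<alpha> \<le> N"
  have "weighted K \<alpha> \<phi> \<xi> \<le> weighted K' \<alpha> \<phi> \<xi>"
    using support_fun_mono[OF assms(2-4)] by (intro mult_right_mono) auto
  also have "\<dots> \<le> Hb_seminorm K' N' \<phi>"
    using \<alpha> assms by (intro Hb_seminorm_upper) auto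
  finally show "weighted K \<alpha> \<phi> \<xi> \<le> Hb_seminorm K' N' \<phi>" .
qed

text \<open>Induction on the generation of the open set. The seminorms increase with
  \<open>N\<close>, so an intersection is handled by the larger order; a subbasic ball around
  another centre contains a ball around \<open>\<phi>\<close> by the triangle inequality.\<close>

lemma Hb_topology_nhds:
  assumes "openin (Hb_topology K) T" "\<phi> \<in> T"
  shows "\<exists>N. \<exists>\<epsilon>>0. \<forall>\<psi>\<in>Hb K. Hb_seminorm K N (\<lambda>\<xi>. \<psi> \<xi> - \<phi> \<xi>) < \<epsilon> \<longrightarrow> \<psi> \<in> T"
proof -
  have "generate_topology_on (insert (Hb K) {{\<psi>\<in>Hb K. p (\<lambda>x. \<psi> x - \<phi> x)
      < \<epsilon>} | p \<phi> \<epsilon>. p \<in> range (Hb_seminorm K) \<and> \<phi> \<in> Hb K \<and> 0 < \<epsilon>}) T"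
    using assms(1) unfolding Hb_topology_def seminorm_topology_def
      by (simp add: openin_topology_generated_by_iff)
  then show ?thesis using assms(2)
  proof (induction T)
    case (Int a b)
    have ab: "\<phi> \<in> a" "\<phi> \<in> b" using Int.prems by auto
    obtain N \<epsilon> where *: "\<epsilon> > 0" "\<And>\<psi>. \<psi> \<in> Hb K \<Longrightarrow> Hb_seminorm K N (\<lambda>\<xi>. \<psi> \<xi> - \<phi> \<xi>) < \<epsilon> \<Longrightarrow> \<psi> \<in> a"
      using Int.IH(1)[OF ab(1)] by blast
    obtain N' \<epsilon>' where **: "\<epsilon>' > 0" "\<And>\<psi>. \<psi> \<in> Hb K \<Longrightarrow> Hb_seminorm K N' (\<lambda>\<xi>. \<psi> \<xi> - \<phi> \<xi>) < \<epsilon>' \<Longrightarrow> \<psi> \<in> b"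
      using Int.IH(2)[OF ab(2)] by blast
    have "a \<subseteq> Hb K"
      using Int.hyps(1) by (induction a) auto
    then have \<phi>: "\<phi> \<in> Hb K" using Int by auto
    have "Hb_seminorm K n (\<lambda>\<xi>. \<psi> \<xi> - \<phi> \<xi>) \<le> Hb_seminorm K (max N N') (\<lambda>\<xi>. \<psi> \<xi> - \<phi> \<xi>)"
      if "\<psi> \<in> Hb K" "n \<le> max N N'" for n \<psi>
      using that \<phi> by (intro Hb_seminorm_least Hb_seminorm_upper Hb_diff) auto
    note mono = this
    have "\<psi> \<in> a \<inter> b" if "\<psi> \<in> Hb K" "Hb_seminorm K (max N N') (\<lambda>\<xi>. \<psi> \<xi> - \<phi> \<xi>) < min \<epsilon> \<epsilon>'" for \<psi>
      using mono[OF that(1), of N] mono[OF that(1), of N'] that *(2)[OF that(1)] **(2)[OF that(1)] by auto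
    then show ?case using *(1) **(1) by (intro exI[of _ "max N N'"] exI[of _ "min \<epsilon> \<epsilon>'"]) auto
  next
    case (UN \<A>)
    then show ?case by (meson UnionE UnionI)
  next
    case (Basis S)
    then consider "S = Hb K" | N \<phi>0 \<epsilon> where "S = {\<psi>\<in>Hb K. Hb_seminorm K N (\<lambda>x. \<psi> x - \<phi>0 x)
        < \<epsilon>}" "\<phi>0 \<in> Hb K" "0 < \<epsilon>"
      by auto
    then show ?case
    proof cases
      case 1
      then show ?thesis by (intro exI[of _ 0] exI[of _ 1]) auto
    next
      case 2
      have "\<phi> \<in> Hb K" using Basis 2 by auto
      then have "Hb_seminorm K N (\<lambda>x. \<psi> x - \<phi>0 x) < \<epsilon>"
        if "\<psi> \<in> Hb K" "Hb_seminorm K N (\<lambda>\<xi>. \<psi> \<xi> - \<phi> \<xi>) < \<epsilon> - Hb_seminorm K N (\<lambda>x. \<phi> x - \<phi>0 x)" for \<psi>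
        using Hb_seminorm_triangle[of \<psi> K \<phi> \<phi>0 N] that 2 by auto
      moreover have "\<epsilon> - Hb_seminorm K N (\<lambda>x. \<phi> x - \<phi>0 x) > 0" using Basis 2 by auto
      ultimately show ?thesis using 2 by blast
    qed
  qed auto
qed

lemma topspace_Hb_topology: "topspace (Hb_topology K) = Hb K"
  unfolding Hb_topology_def seminorm_topology_def topology_generated_by_topspace by auto

lemma convex_compactsD:
  assumes "K \<in> convex_compacts \<O>" shows "compact K" "convex K" "K \<noteq> {}" "K \<subseteq> \<O>"
  using assms by (auto simp: convex_compacts_def)

text \<open>The singleton \<open>{0}\<close> guarantees that there is a convex compact at all; over
  an empty index set the generated topology would have an empty carrier.\<close>

lemma topspace_H_topology:
  assumes "0 \<in> \<O>"
  shows "topspace (H_topology \<O>) = H_space \<O>"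
proof -
  have "H_space \<O> \<subseteq> Hb K" if "K \<in> convex_compacts \<O>" for K
    using that by (auto simp: H_space_def)
  then have top: "topspace (subtopology (Hb_topology K) (H_space \<O>)) = H_space \<O>"
      if "K \<in> convex_compacts \<O>" for K
    using that by (auto simp: topspace_Hb_topology)
  have "{0} \<in> convex_compacts \<O>"
    using assms by (auto simp: convex_compacts_def)
  then have "openin (subtopology (Hb_topology {0}) (H_space \<O>)) (H_space \<O>)"
    using top openin_topspace by metis
  then show ?thesis
    using \<open>{0} \<in> _\<close> openin_subset[of "subtopology (Hb_topology _) (H_space \<O>)"]
    unfolding H_topology_def topology_generated_by_topspace by (fastforce simp: top)
qed

text \<open>Convexity of \<open>\<O>\<close> serves the intersections: the convex hull of two
  compacts stays inside \<open>\<O>\<close>, and its seminorms dominate those of both. Hence one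
  compact and one order suffice for each neighbourhood.\<close>

lemma H_topology_nhds:
  assumes "convex \<O>" "openin (H_topology \<O>) S" "\<phi> \<in> S"
  shows "\<exists>K\<in>convex_compacts \<O>. \<exists>N. \<exists>\<epsilon>>0. \<forall>\<psi>\<in>H_space \<O>. Hb_seminorm K N (\<lambda>\<xi>. \<psi> \<xi> - \<phi> \<xi>) < \<epsilon> \<longrightarrow> \<psi> \<in> S"
proof -
  let ?\<S> = "\<Union>K \<in> convex_compacts \<O>. {S. openin (subtopology (Hb_topology K) (H_space \<O>)) S}"
  have sub: "S \<subseteq> H_space \<O>" if "generate_topology_on ?\<S> S" for S
    using that by (induction S) (auto simp: openin_subtopology)
  have "generate_topology_on ?\<S> S"
    using assms(2) unfolding H_topology_def by (simp add: openin_topology_generated_by_iff)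
  then show ?thesis using assms(3)
  proof (induction S)
    case (Int a b)
    have ab: "\<phi> \<in> a" "\<phi> \<in> b" using Int.prems by auto
    obtain K N \<epsilon> where *: "\<epsilon> > 0" "K \<in> convex_compacts \<O>"
      "\<And>\<psi>. \<psi> \<in> H_space \<O> \<Longrightarrow> Hb_seminorm K N (\<lambda>\<xi>. \<psi> \<xi> - \<phi> \<xi>) < \<epsilon> \<Longrightarrow> \<psi> \<in> a"
      using Int.IH(1)[OF ab(1)] by blast
    obtain K' N' \<epsilon>' where **: "\<epsilon>' > 0" "K' \<in> convex_compacts \<O>"
      "\<And>\<psi>. \<psi> \<in> H_space \<O> \<Longrightarrow> Hb_seminorm K' N' (\<lambda>\<xi>. \<psi> \<xi> - \<phi> \<xi>) < \<epsilon>' \<Longrightarrow> \<psi> \<in> b"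
      using Int.IH(2)[OF ab(2)] by blast
    note K = convex_compactsD[OF *(2)] and K' = convex_compactsD[OF **(2)]
    define L where "L = convex hull (K \<union> K')"
    have sub_L: "K \<subseteq> L" "K' \<subseteq> L" using hull_subset[of "K \<union> K'" convex] by (auto simp: L_def)
    have "L \<subseteq> \<O>" unfolding L_def using K K' assms(1) by (intro hull_minimal) auto
    then have L: "L \<in> convex_compacts \<O>"
      using K K' sub_L by (auto simp: convex_compacts_def L_def intro!: compact_convex_hull compact_Un)
    have \<phi>: "\<phi> \<in> H_space \<O>" using Int sub by blast
    have "Hb_seminorm k n (\<lambda>\<xi>. \<psi> \<xi> - \<phi> \<xi>) \<le> Hb_seminorm L (max N N') (\<lambda>\<xi>. \<psi> \<xi> - \<phi> \<xi>)"
      if "\<psi> \<in> H_space \<O>" "n \<le> max N N'" "k \<subseteq> L" "k \<noteq> {}" for n k \<psi>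
      using that \<phi> L convex_compactsD[OF L] by (intro Hb_seminorm_mono Hb_diff) (auto simp: H_space_def)
    note mono = this
    have "\<psi> \<in> a \<inter> b" if "\<psi> \<in> H_space \<O>" "Hb_seminorm L (max N N') (\<lambda>\<xi>. \<psi> \<xi> - \<phi> \<xi>) < min \<epsilon> \<epsilon>'" for \<psi>
      using mono[OF that(1) _ sub_L(1) K(3), of N] mono[OF that(1) _ sub_L(2) K'(3), of N'] that
        *(3)[OF that(1)] **(3)[OF that(1)] by auto
    then show ?case using *(1) **(1)
      by (intro bexI[OF _ L] exI[of _ "max N N'"] exI[of _ "min \<epsilon> \<epsilon>'"]) auto
  next
    case (UN \<A>)
    then show ?case by (meson UnionE UnionI)
  next
    case (Basis S)
    then obtain K T where K: "K \<in> convex_compacts \<O>" and T: "openin (Hb_topology K) T" "S = T \<inter> H_space \<O>"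
      by (auto simp: openin_subtopology)
    then obtain N \<epsilon> where "\<epsilon> > 0" "\<forall>\<psi>\<in>Hb K. Hb_seminorm K N (\<lambda>\<xi>. \<psi> \<xi> - \<phi> \<xi>) < \<epsilon> \<longrightarrow> \<psi> \<in> T"
      using Hb_topology_nhds[OF T(1)] Basis by blast
    then show ?case using K T by (intro bexI[OF _ K] exI[of _ N] exI[of _ \<epsilon>]) (auto simp: H_space_def)
  qed auto
qed

section \<open>Linear operations in \<open>H_space\<close> and the seminorm bound of a
  functional\<close>

lemma zero_in_H_space: "(\<lambda>\<xi>. 0) \<in> H_space \<O>"
  by (auto simp: H_space_def Hb_def smooth_fun_const multi_deriv_const)

lemma H_dual_add: "V \<in> H_dual \<O> \<Longrightarrow> \<phi> \<in> H_space \<O> \<Longrightarrow> \<psi> \<in> H_space \<O> \<Longrightarrow> V (\<lambda>\<xi>. \<phi> \<xi> + \<psi> \<xi>) = V \<phi> + V \<psi>"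
  and H_dual_cmult: "V \<in> H_dual \<O> \<Longrightarrow> \<phi> \<in> H_space \<O> \<Longrightarrow> V (\<lambda>\<xi>. c * \<phi> \<xi>) = c * V \<phi>"
  by (auto simp: H_dual_def)

lemma H_dual_zero: "V \<in> H_dual \<O> \<Longrightarrow> V (\<lambda>\<xi>. 0) = 0"
  using H_dual_cmult[OF _ zero_in_H_space, of V \<O> 0] by simp

lemma H_space_add: "\<phi> \<in> H_space \<O> \<Longrightarrow> \<psi> \<in> H_space \<O> \<Longrightarrow> (\<lambda>\<xi>. \<phi> \<xi> + \<psi> \<xi>) \<in> H_space \<O>"
  and H_space_diff: "\<phi> \<in> H_space \<O> \<Longrightarrow> \<psi> \<in> H_space \<O> \<Longrightarrow> (\<lambda>\<xi>. \<phi> \<xi> - \<psi> \<xi>) \<in> H_space \<O>"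
  and H_space_cmult: "\<phi> \<in> H_space \<O> \<Longrightarrow> (\<lambda>\<xi>. c * \<phi> \<xi>) \<in> H_space \<O>"
  by (auto simp: H_space_def Hb_add Hb_diff Hb_cmult)

lemma H_dual_diff: "V \<in> H_dual \<O> \<Longrightarrow> \<phi> \<in> H_space \<O> \<Longrightarrow> \<psi> \<in> H_space \<O> \<Longrightarrow> V (\<lambda>\<xi>. \<phi> \<xi> - \<psi> \<xi>) = V \<phi> - V \<psi>"
  using H_dual_add[of V \<O> \<phi> "\<lambda>\<xi>. -1 * \<psi> \<xi>"] H_dual_cmult[of V \<O> \<psi> "-1"] H_space_cmult[of \<psi> \<O> "-1"] by simp

lemma H_dual_sum:
  assumes "V \<in> H_dual \<O>" "\<And>x. x \<in> I \<Longrightarrow> \<phi> x \<in> H_space \<O>"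
  shows "V (\<lambda>\<xi>. \<Sum>x\<in>I. \<phi> x \<xi>) = (\<Sum>x\<in>I. V (\<phi> x))" "(\<lambda>\<xi>. \<Sum>x\<in>I. \<phi> x \<xi>) \<in> H_space \<O>"
  using assms(2)
  by (induction I rule: infinite_finite_induct)
    (auto simp: H_dual_zero[OF assms(1)] zero_in_H_space H_dual_add[OF assms(1)] H_space_add)

text \<open>Continuity at \<open>0\<close> and scaling. The bound is phrased with an arbitrary
  majorant \<open>B\<close> of the weighted derivatives instead of \<open>Hb_seminorm\<close>, so
  that applications need pointwise estimates only and never evaluate a supremum.\<close>

lemma H_dual_bound:
  fixes V :: "(real^'n \<Rightarrow> complex) \<Rightarrow> complex"
  assumes V: "V \<in> H_dual \<O>" and \<O>: "convex \<O>" "0 \<in> \<O>"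
  shows "\<exists>K\<in>convex_compacts \<O>. \<exists>N. \<exists>M\<ge>0. \<forall>\<phi>\<in>H_space \<O>. \<forall>B.
    (\<forall>\<xi> \<alpha>. length \<alpha> \<le> N \<longrightarrow> weighted K \<alpha> \<phi> \<xi> \<le> B) \<longrightarrow> cmod (V \<phi>) \<le> M * B"
proof -
  have opn: "openin (H_topology \<O>) {\<phi> \<in> topspace (H_topology \<O>). V \<phi> \<in> ball 0 1}"
    using V by (intro openin_continuous_map_preimage[of _ euclidean]) (auto simp: H_dual_def)
  have mem: "(\<lambda>\<xi>. 0) \<in> {\<phi> \<in> topspace (H_topology \<O>). V \<phi> \<in> ball 0 1}"
    using H_dual_zero[OF V] by (simp add: topspace_H_topology \<O> zero_in_H_space)
  obtain K N \<epsilon> where K: "K \<in> convex_compacts \<O>" and "\<epsilon> > 0"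
    and *: "\<forall>\<psi>\<in>H_space \<O>. Hb_seminorm K N (\<lambda>\<xi>. \<psi> \<xi> - 0) < \<epsilon>
        \<longrightarrow> \<psi> \<in> {\<phi> \<in> topspace (H_topology \<O>). V \<phi> \<in> ball 0 1}"
    using H_topology_nhds[OF \<O>(1) opn mem] by blast
  show ?thesis
  proof (intro bexI[OF _ K] exI[of _ N] exI[of _ "2 / \<epsilon>"] conjI ballI allI impI)
    show "2 / \<epsilon> \<ge> 0" using \<open>\<epsilon> > 0\<close> by simp
    fix \<phi> B assume \<phi>: "\<phi> \<in> H_space \<O>"
      and "\<forall>\<xi> \<alpha>. length \<alpha> \<le> N \<longrightarrow> weighted K \<alpha> \<phi> \<xi> \<le> B"
    then have B: "weighted K \<alpha> \<phi> \<xi> \<le> B" if "length \<alpha> \<le> N" for \<xi> \<alpha>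
      using that by blast
    have "0 \<le> weighted K [] \<phi> 0" by simp
    also have "\<dots> \<le> B" by (rule B) simp
    finally have B0: "B \<ge> 0" .
    have s: "smooth_fun \<phi>" using \<phi> K by (auto simp: H_space_def Hb_def)
    show "cmod (V \<phi>) \<le> 2 / \<epsilon> * B"
    proof (rule field_le_epsilon)
      fix e :: real assume "e > 0"
      \<comment> \<open>\<open>B\<close> may be \<open>0\<close>, so the scaling uses a strictly
        larger \<open>B'\<close>; the increment is chosen so that the final bound exceeds the
        desired one by exactly \<open>e\<close>.\<close>
      define B' where "B' = B + e * \<epsilon> / 2"
      have B': "B' > 0" "B \<le> B'" using B0 \<open>e > 0\<close> \<open>\<epsilon> > 0\<close> by (auto simp: B'_def add_nonneg_pos)
      define c where "c = complex_of_real (\<epsilon> / (2 * B'))"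
      have c: "cmod c = \<epsilon> / (2 * B')"
        using B' \<open>\<epsilon> > 0\<close> unfolding c_def norm_of_real by simp
      have "Hb_seminorm K N (\<lambda>\<xi>. c * \<phi> \<xi>) \<le> \<epsilon> / 2"
      proof (rule Hb_seminorm_least)
        fix \<xi> and \<alpha> :: "'n list" assume \<alpha>: "length \<alpha> \<le> N"
        have "weighted K \<alpha> (\<lambda>\<xi>. c * \<phi> \<xi>) \<xi>
          = (\<epsilon> / (2 * B')) * (weighted K \<alpha> \<phi> \<xi>)"
          by (simp add: multi_deriv_cmult s norm_mult c)
        also have "\<dots> \<le> (\<epsilon> / (2 * B')) * B'"
          using B[OF \<alpha>, of \<xi>] B' \<open>\<epsilon> > 0\<close> by (intro mult_left_mono) auto
        finally show "weighted K \<alpha> (\<lambda>\<xi>. c * \<phi> \<xi>) \<xi> \<le> \<epsilon> / 2"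
          using B' by simp
      qed
      also have "\<dots> < \<epsilon>" using \<open>\<epsilon> > 0\<close> by simp
      finally have "V (\<lambda>\<xi>. c * \<phi> \<xi>) \<in> ball 0 1"
        using * H_space_cmult[OF \<phi>, of c] by simp
      then have "cmod c * cmod (V \<phi>) < 1"
        by (simp add: H_dual_cmult[OF V \<phi>] norm_mult)
      then have "cmod (V \<phi>) < 2 * B' / \<epsilon>"
        using B' \<open>\<epsilon> > 0\<close> by (simp add: c field_simps)
      also have "\<dots> = 2 / \<epsilon> * B + e" using \<open>\<epsilon> > 0\<close> by (simp add: B'_def field_simps)
      finally show "cmod (V \<phi>) \<le> 2 / \<epsilon> * B + e" by simp
    qed
  qed
qed

section \<open>Test functions and supports\<close>

lemma multi_deriv_zero_outside:
  assumes "\<xi> \<notin> closure {\<xi>. \<phi> \<xi> \<noteq> 0}"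
  shows "multi_deriv \<alpha> \<phi> \<xi> = 0"
proof -
  have "multi_deriv \<alpha> \<phi> \<xi> = multi_deriv \<alpha> (\<lambda>\<xi>. 0) \<xi>"
  proof (rule multi_deriv_cong_open[of "- closure {\<xi>. \<phi> \<xi> \<noteq> 0}"])
    show "\<phi> x = 0" if "x \<in> - closure {\<xi>. \<phi> \<xi> \<noteq> 0}" for x
      using that closure_subset[of "{\<xi>. \<phi> \<xi> \<noteq> 0}"] by auto
  qed (use assms in auto)
  then show ?thesis by (simp add: multi_deriv_const)
qed

lemma test_functionsI:
  assumes "smooth_fun \<phi>" "compact L" "L \<subseteq> W" "\<And>\<xi>. \<xi> \<notin> L \<Longrightarrow> \<phi> \<xi> = 0"
  shows "\<phi> \<in> test_functions W"
proof -
  have "closure {\<xi>. \<phi> \<xi> \<noteq> 0} \<subseteq> L"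
    using assms by (intro closure_minimal compact_imp_closed) auto
  moreover from this have "compact (closure {\<xi>. \<phi> \<xi> \<noteq> 0})"
    using compact_Int_closed[OF assms(2), of "closure {\<xi>. \<phi> \<xi> \<noteq> 0}"] by (simp add: Int_absorb1)
  ultimately show ?thesis using assms by (auto simp: test_functions_def)
qed

lemma test_functions_smooth: "\<phi> \<in> test_functions W \<Longrightarrow> smooth_fun \<phi>"
  by (simp add: test_functions_def)

lemma test_functions_mono: "W \<subseteq> W' \<Longrightarrow> \<phi> \<in> test_functions W \<Longrightarrow> \<phi> \<in> test_functions W'"
  by (auto simp: test_functions_def)

lemma test_functions_mult:
  assumes "\<phi> \<in> test_functions W" "smooth_fun \<psi>"
  shows "(\<lambda>\<xi>. \<phi> \<xi> * \<psi> \<xi>) \<in> test_functions W"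
  using assms closure_subset[of "{\<xi>. \<phi> \<xi> \<noteq> 0}"]
  by (intro test_functionsI[of _ "closure {\<xi>. \<phi> \<xi> \<noteq> 0}"] smooth_fun_mult) (auto simp: test_functions_def)

lemma test_function_bounded_support:
  assumes "\<phi> \<in> test_functions W"
  obtains r where "r > 0" "\<And>\<alpha> \<xi>. norm \<xi> > r \<Longrightarrow> multi_deriv \<alpha> \<phi> \<xi> = 0"
proof -
  have "bounded (closure {\<xi>. \<phi> \<xi> \<noteq> 0})"
    using assms compact_imp_bounded by (auto simp: test_functions_def)
  then obtain r where r: "r > 0" "\<forall>x\<in>closure {\<xi>. \<phi> \<xi> \<noteq> 0}. norm x \<le> r"
    using bounded_pos by blast
  show ?thesis
    using r by (intro that[of r] multi_deriv_zero_outside) force+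
qed

lemma test_function_multi_deriv_bounded:
  fixes \<phi> :: "real^'n \<Rightarrow> complex"
  assumes "\<phi> \<in> test_functions W"
  shows "\<exists>A\<ge>0. \<forall>\<alpha> \<xi>. length \<alpha> \<le> N \<longrightarrow> cmod (multi_deriv \<alpha> \<phi> \<xi>) \<le> A"
proof -
  obtain r where r: "r > 0" "\<And>\<alpha> \<xi>. norm \<xi> > r \<Longrightarrow> multi_deriv \<alpha> \<phi> \<xi> = 0"
    using test_function_bounded_support[OF assms] by metis
  have "\<exists>A\<ge>0. \<forall>\<xi>. cmod (multi_deriv \<alpha> \<phi> \<xi>) \<le> A" for \<alpha>
  proof -
    have "compact (multi_deriv \<alpha> \<phi> ` cball 0 r)"
      using assms by (intro compact_continuous_image smooth_fun_continuous smooth_fun_multi_deriv)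
        (auto simp: test_functions_def)
    then obtain A where "\<forall>x\<in>multi_deriv \<alpha> \<phi> ` cball 0 r. norm x \<le> A"
      using compact_imp_bounded bounded_iff by blast
    then have "cmod (multi_deriv \<alpha> \<phi> \<xi>) \<le> max A 0" for \<xi>
      by (cases "norm \<xi> > r") (auto simp: r(2) le_max_iff_disj)
    then show ?thesis by (intro exI[of _ "max A 0"]) auto
  qed
  then obtain A where A: "\<And>\<alpha>. A \<alpha> \<ge> 0" "\<And>\<alpha> \<xi>. cmod (multi_deriv \<alpha> \<phi> \<xi>) \<le> A \<alpha>" by metis
  have fin: "finite (A ` {\<alpha>::'n list. length \<alpha> \<le> N})" using finite_multi_indices by blast
  have le: "A \<alpha> \<le> Max (A ` {\<alpha>. length \<alpha> \<le> N})" if "length \<alpha> \<le> N" for \<alpha>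
    using that fin by (intro Max_ge) auto
  show ?thesis
  proof (intro exI[of _ "Max (A ` {\<alpha>. length \<alpha> \<le> N})"] conjI allI impI)
    show "0 \<le> Max (A ` {\<alpha>. length \<alpha> \<le> N})" using le[of "[]"] A(1)[of "[]"] by simp
    show "cmod (multi_deriv \<alpha> \<phi> \<xi>) \<le> Max (A ` {\<alpha>. length \<alpha> \<le> N})" if "length \<alpha> \<le> N" for \<alpha> \<xi>
      using order_trans[OF A(2) le[OF that]] .
  qed
qed

lemma compact_norm_bound:
  assumes "compact K"
  obtains R where "R > 0" "\<And>x. x \<in> K \<Longrightarrow> norm x \<le> R"
  using compact_imp_bounded[OF assms] bounded_pos by blast

lemma test_function_in_H_space:
  assumes "\<phi> \<in> test_functions W"
  shows "\<phi> \<in> H_space \<O>"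
  unfolding H_space_def
proof (intro INT_I HbI)
  show "smooth_fun \<phi>" using assms by (simp add: test_functions_def)
  fix K \<alpha> assume "K \<in> convex_compacts \<O>"
  note K = convex_compactsD[OF this]
  obtain R where R: "R > 0" "\<And>x. x \<in> K \<Longrightarrow> norm x \<le> R"
    using compact_norm_bound[OF K(1)] by metis
  obtain r where r: "r > 0" "\<And>\<alpha> \<xi>. norm \<xi> > r \<Longrightarrow> multi_deriv \<alpha> \<phi> \<xi> = 0"
    using test_function_bounded_support[OF assms] by metis
  obtain A where A: "A \<ge> 0" "\<And>\<xi>. cmod (multi_deriv \<alpha> \<phi> \<xi>) \<le> A"
    using test_function_multi_deriv_bounded[OF assms, of "length \<alpha>"] by auto
  have "weighted K \<alpha> \<phi> \<xi> \<le> exp (R * r) * A" for \<xi>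
  proof (cases "norm \<xi> > r")
    case False
    have "support_fun K \<xi> \<le> R * norm \<xi>" using K R by (intro support_fun_le) auto
    also have "\<dots> \<le> R * r" using False R by (intro mult_left_mono) auto
    finally show ?thesis using A by (intro mult_mono) auto
  qed (use r A in auto)
  then show "\<exists>B. \<forall>\<xi>. weighted K \<alpha> \<phi> \<xi> \<le> B" by blast
qed

text \<open>This is \<open>cutoff ((1 / r) *\<^sub>R (\<xi> - p))\<close>, written as an affine
  substitution in the form that \<open>multi_deriv_affine\<close> expects.\<close>

definition cutoff_at :: "real^'n \<Rightarrow> real \<Rightarrow> real^'n \<Rightarrow> complex" where
  "cutoff_at p r \<xi> = cutoff (- ((1 / r) *\<^sub>R p) + (1 / r) *\<^sub>R \<xi>)"

lemma cutoff_at_norm: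
  assumes "r > 0" shows "norm (- ((1 / r) *\<^sub>R p) + (1 / r) *\<^sub>R \<xi>) = dist p \<xi> / r"
proof -
  have "- ((1 / r) *\<^sub>R p) + (1 / r) *\<^sub>R \<xi> = (1 / r) *\<^sub>R (\<xi> - p)" by (simp add: algebra_simps)
  then show ?thesis using assms by (simp add: dist_norm norm_minus_commute)
qed

lemma cutoff_at_eq_1: "r > 0 \<Longrightarrow> dist p \<xi> \<le> r \<Longrightarrow> cutoff_at p r \<xi> = 1"
  and cutoff_at_eq_0: "r > 0 \<Longrightarrow> dist p \<xi> \<ge> 2 * r \<Longrightarrow> cutoff_at p r \<xi> = 0"
  unfolding cutoff_at_def
  by (rule cutoff_eq_1, subst cutoff_at_norm; simp add: field_simps)
    (rule cutoff_eq_0, subst cutoff_at_norm; simp add: field_simps)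

lemma smooth_fun_cutoff_at: "smooth_fun (cutoff_at p r)"
  unfolding cutoff_at_def[abs_def] by (intro multi_deriv_affine smooth_fun_cutoff)

lemma cutoff_at_test_function: "r > 0 \<Longrightarrow> cutoff_at p r \<in> test_functions (cball p (2 * r))"
  by (rule test_functionsI[of _ "cball p (2 * r)"]) (auto intro: smooth_fun_cutoff_at cutoff_at_eq_0)

text \<open>A partition of unity peeled off one ball at a time: \<open>\<phi>\<close> times the
  cutoff at \<open>p\<close> lives in the ball of twice the radius, and the rest vanishes on
  \<open>ball p (r p)\<close>, so that the remaining balls cover its support.\<close>

lemma vanish_on_cover:
  assumes V: "V \<in> H_dual \<O>" and "finite F"
    and r: "\<And>p. p \<in> F \<Longrightarrow> r p > 0"
    and van: "\<And>p \<psi>. p \<in> F \<Longrightarrow> \<psi> \<in> test_functions (cball p (2 * r p)) \<Longrightarrow> V \<psi> = 0"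
    and "\<phi> \<in> test_functions (\<Union>p\<in>F. ball p (r p))"
  shows "V \<phi> = 0"
  using assms(2-5)
proof (induction F arbitrary: \<phi> rule: finite_induct)
  case empty
  then have "\<phi> = (\<lambda>\<xi>. 0)" using closure_subset[of "{\<xi>. \<phi> \<xi> \<noteq> 0}"] by (auto simp: test_functions_def)
  then show ?case using H_dual_zero[OF V] by simp
next
  case (insert p F)
  let ?c = "cutoff_at p (r p)"
  have rp: "r p > 0" using insert by auto
  let ?L = "closure {\<xi>. \<phi> \<xi> \<noteq> 0}"
  have 1: "(\<lambda>\<xi>. \<phi> \<xi> * ?c \<xi>) \<in> test_functions (cball p (2 * r p))"
    using test_functions_mult[OF cutoff_at_test_function[OF rp] test_functions_smooth[OF
        insert.prems(3)], of p]
    by (simp add: mult.commute)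
  have 2: "(\<lambda>\<xi>. \<phi> \<xi> * (1 - ?c \<xi>)) \<in> test_functions (\<Union>p\<in>F. ball p (r p))"
  proof (rule test_functionsI[of _ "?L - ball p (r p)"])
    show "smooth_fun (\<lambda>\<xi>. \<phi> \<xi> * (1 - ?c \<xi>))"
      by (intro smooth_fun_mult smooth_fun_diff smooth_fun_const smooth_fun_cutoff_at
          test_functions_smooth[OF insert.prems(3)])
    show "compact (?L - ball p (r p))"
      using insert.prems(3) by (intro compact_diff) (auto simp: test_functions_def)
    show "?L - ball p (r p) \<subseteq> (\<Union>p\<in>F. ball p (r p))"
      using insert.prems(3) by (auto simp: test_functions_def)
    show "\<phi> \<xi> * (1 - ?c \<xi>) = 0" if "\<xi> \<notin> ?L - ball p (r p)" for \<xi>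
      using that closure_subset[of "{\<xi>. \<phi> \<xi> \<noteq> 0}"] cutoff_at_eq_1[OF rp, of p \<xi>] by auto
  qed
  have "\<phi> = (\<lambda>\<xi>. \<phi> \<xi> * ?c \<xi> + \<phi> \<xi> * (1 - ?c \<xi>))"
    by (simp add: algebra_simps)
  then have "V \<phi> = V (\<lambda>\<xi>. \<phi> \<xi> * ?c \<xi>) + V (\<lambda>\<xi>. \<phi> \<xi> * (1 - ?c \<xi>))"
    using H_dual_add[OF V test_function_in_H_space[OF 1] test_function_in_H_space[OF 2]] by metis
  also have "V (\<lambda>\<xi>. \<phi> \<xi> * (1 - ?c \<xi>)) = 0"
    by (rule insert.IH[OF insert.prems(1) insert.prems(2) 2]) simp_all
  also have "V (\<lambda>\<xi>. \<phi> \<xi> * ?c \<xi>) = 0"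
    using insert.prems(2)[OF _ 1] by simp
  finally show ?case by simp
qed

text \<open>The complement of the support is a union of open sets on each of which \<open>V\<close>
  vanishes. Passing to the union is the point here: compactness gives a finite subcover, and
  \<open>vanish_on_cover\<close> does the patching.\<close>

lemma vanish_off_dist_support:
  assumes V: "V \<in> H_dual \<O>" and \<phi>: "\<phi> \<in> test_functions (- dist_support V)"
  shows "V \<phi> = 0"
proof -
  let ?L = "closure {\<xi>. \<phi> \<xi> \<noteq> 0}"
  have "\<exists>r>0. \<forall>\<psi> \<in> test_functions (cball p (2 * r)). V \<psi> = 0" if p: "p \<in> ?L" for p
  proof -
    have "p \<in> - dist_support V" using p \<phi> by (auto simp: test_functions_def)
    then obtain W where W: "open W" "p \<in> W" "\<forall>\<phi>\<in>test_functions W. V \<phi> = 0"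
      by (auto simp: dist_support_def)
    obtain e where e: "e > 0" "cball p e \<subseteq> W" using W open_contains_cball by metis
    \<comment> \<open>The witness \<open>e / 2\<close> accounts for the cutoffs, whose supports have
      twice the nominal radius.\<close>
    show ?thesis
      using e W(3) test_functions_mono[of "cball p e" W] by (intro exI[of _ "e / 2"]) auto
  qed
  then obtain r where r: "\<And>p. p \<in> ?L \<Longrightarrow> r p > 0"
    and van: "\<And>p \<psi>. p \<in> ?L \<Longrightarrow> \<psi> \<in> test_functions (cball p (2 * r p)) \<Longrightarrow> V \<psi> = 0"
    by metis
  have "compact ?L" using \<phi> by (simp add: test_functions_def)
  moreover have "?L \<subseteq> (\<Union>p\<in>?L. ball p (r p))" using r by force
  ultimately obtain F where F: "F \<subseteq> ?L" "finite F" "?L \<subseteq> (\<Union>p\<in>F. ball p (r p))"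
    using compactE_image[of ?L ?L "\<lambda>p. ball p (r p)"] by auto
  have "\<phi> \<in> test_functions (\<Union>p\<in>F. ball p (r p))"
    using \<phi> F by (auto simp: test_functions_def)
  then show ?thesis
  proof (rule vanish_on_cover[OF V F(2), rotated 2])
    show "r p > 0" if "p \<in> F" for p using that F(1) r by auto
    show "V \<psi> = 0" if "p \<in> F" "\<psi> \<in> test_functions (cball p (2 * r p))" for p \<psi>
      using that F(1) van by auto
  qed
qed

section \<open>Density of the test functions in \<open>H_space\<close>\<close>

lemma support_fun_thicken:
  assumes "compact K" "\<epsilon> \<ge> 0" "K \<noteq> {}" "compact K'" "\<And>x y. x \<in> K \<Longrightarrow> norm y \<le> \<epsilon> \<Longrightarrow> x + y \<in> K'"
  shows "support_fun K \<xi> + \<epsilon> * norm \<xi> \<le> support_fun K' \<xi>"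
proof -
  have "support_fun K \<xi> \<le> support_fun K' \<xi> - \<epsilon> * norm \<xi>"
    unfolding support_fun_def[of K]
  proof (rule cSUP_least[OF assms(3)])
    fix x assume x: "x \<in> K"
    \<comment> \<open>A shift by \<open>\<epsilon>\<close> in the direction of \<open>\<xi>\<close>
      raises the inner product by exactly \<open>\<epsilon> * norm \<xi>\<close>.\<close>
    let ?y = "\<epsilon> *\<^sub>R sgn \<xi>"
    have "norm ?y \<le> \<epsilon>" using assms(2) by (simp add: norm_sgn)
    then have "\<xi> \<bullet> (x + ?y) \<le> support_fun K' \<xi>"
      using assms x by (intro support_fun_upper) auto
    moreover have "\<xi> \<bullet> sgn \<xi> = norm \<xi>"
      by (cases "\<xi> = 0") (simp_all add: sgn_div_norm power2_norm_eq_inner[symmetric] power2_eq_square)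
    ultimately show "\<xi> \<bullet> x \<le> support_fun K' \<xi> - \<epsilon> * norm \<xi>" by (simp add: inner_add_right)
  qed
  then show ?thesis by simp
qed

text \<open>The Minkowski sum with a small ball. The weight of \<open>K'\<close> beats that of
  \<open>K\<close> by the factor \<open>exp (\<epsilon> * norm \<xi>)\<close>, and this surplus
  makes tails negligible in \<open>H_dual_eq_zero\<close>.\<close>

lemma convex_compacts_thicken:
  fixes K :: "(real^'n) set"
  assumes K: "K \<in> convex_compacts \<O>" and "open \<O>"
  obtains K' \<epsilon> where "K' \<in> convex_compacts \<O>" "\<epsilon> > 0"
    "\<And>\<xi>. support_fun K \<xi> + \<epsilon> * norm \<xi> \<le> support_fun K' \<xi>"
proof -
  note K = convex_compactsD[OF K]
  obtain \<epsilon> where \<epsilon>: "\<epsilon> > 0" "(\<Union>x\<in>K. cball x \<epsilon>) \<subseteq> \<O>"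
    using compact_subset_open_imp_cball_epsilon_subset[OF K(1) \<open>open \<O>\<close> K(4)] by metis
  define K' where "K' = {x + y | x y. x \<in> K \<and> y \<in> cball 0 \<epsilon>}"
  have "compact K'" unfolding K'_def by (intro compact_sums K compact_cball)
  moreover have "K' = (\<Union>x\<in>K. \<Union>y\<in>cball 0 \<epsilon>. {x + y})" unfolding K'_def by blast
  then have "convex K'" using convex_sums[OF K(2) convex_cball, of 0 \<epsilon>] by simp
  moreover obtain x where "x \<in> K" using K(3) by blast
  then have "x + 0 \<in> K'"
    unfolding K'_def using \<epsilon>(1) by (intro CollectI exI conjI) auto
  then have "K' \<noteq> {}" by blast
  moreover have "K' \<subseteq> \<O>"
  proof
    fix z assume "z \<in> K'"
    then obtain x y where "z = x + y" "x \<in> K" "norm y \<le> \<epsilon>" by (auto simp: K'_def)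
    then have "z \<in> cball x \<epsilon>" by (simp add: dist_norm)
    then show "z \<in> \<O>" using \<epsilon>(2) \<open>x \<in> K\<close> by blast
  qed
  ultimately have "K' \<in> convex_compacts \<O>" by (simp add: convex_compacts_def)
  moreover have "x + y \<in> K'" if "x \<in> K" "norm y \<le> \<epsilon>" for x y
    using that unfolding K'_def mem_cball_0 by blast
  then have "support_fun K \<xi> + \<epsilon> * norm \<xi> \<le> support_fun K' \<xi>" for \<xi>
    using K \<epsilon> \<open>compact K'\<close> by (intro support_fun_thicken) auto
  ultimately show ?thesis using that \<epsilon>(1) by blast
qed

text \<open>\<open>V\<close> annihilates the truncation of \<open>\<phi>\<close> at radius
  \<open>r\<close>, so \<open>V \<phi>\<close> equals the value of \<open>V\<close> on the tail. In
  the seminorm that bounds \<open>V\<close> the tail has size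
  \<open>exp (- (\<epsilon> * r))\<close>, because \<open>\<phi>\<close> is also controlled by the
  heavier weight of \<open>K'\<close>.\<close>

lemma H_dual_eq_zero:
  fixes V :: "(real^'n \<Rightarrow> complex) \<Rightarrow> complex"
  assumes V: "V \<in> H_dual \<O>" and \<O>: "open \<O>" "convex \<O>" "0 \<in> \<O>"
    and van: "\<And>\<phi>. \<phi> \<in> test_functions UNIV \<Longrightarrow> V \<phi> = 0"
    and \<phi>: "\<phi> \<in> H_space \<O>"
  shows "V \<phi> = 0"
proof -
  obtain K N M where K: "K \<in> convex_compacts \<O>" and M: "M \<ge> (0::real)" and bound:
    "\<forall>\<phi>\<in>H_space \<O>. \<forall>B. (\<forall>\<xi> \<alpha>. length \<alpha> \<le> N \<longrightarrow> weighted K \<alpha> \<phi> \<xi> \<le> B)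
      \<longrightarrow> cmod (V \<phi>) \<le> M * B"
    using H_dual_bound[OF V \<O>(2,3)] by blast
  obtain K' \<epsilon> where K': "K' \<in> convex_compacts \<O>" and \<epsilon>: "\<epsilon> > 0"
    and supp: "\<And>\<xi>. support_fun K \<xi> + \<epsilon> * norm \<xi> \<le> support_fun K' \<xi>"
    using convex_compacts_thicken[OF K \<O>(1)] by blast
  have \<phi>K': "\<phi> \<in> Hb K'" using \<phi> K' by (auto simp: H_space_def)
  then have s: "smooth_fun \<phi>" by (simp add: Hb_def)
  have c: "(cutoff :: real^'n \<Rightarrow> complex) \<in> test_functions UNIV"
    using cutoff_at_test_function[of 1 0] test_functions_mono[of _ UNIV] by (simp add: cutoff_at_def[abs_def])
  obtain A where A: "A \<ge> 0" "\<And>\<alpha> \<xi>. length \<alpha> \<le> N \<Longrightarrow> cmod (multi_deriv \<alpha> (cutoff :: real^'n \<Rightarrow> complex) \<xi>) \<le> A"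
    using test_function_multi_deriv_bounded[OF c] by metis
  let ?C = "Hb_seminorm K' N \<phi>"
  have C: "?C \<ge> 0" using Hb_seminorm_upper[OF \<phi>K', of "[]" N 0] by (simp add: order_trans[rotated])
  define D where "D = M * (2 ^ N * (1 + A) * ?C)"
  have D: "D \<ge> 0" using M A C by (simp add: D_def)
  have le: "cmod (V \<phi>) \<le> D * exp (- (\<epsilon> * r))" if r: "r \<ge> 1" for r
  proof -
    define g where "g = (\<lambda>\<xi>. 1 - cutoff_at (0::real^'n) r \<xi>)"
    have sg: "smooth_fun g"
      unfolding g_def by (intro smooth_fun_diff smooth_fun_const smooth_fun_cutoff_at)
    \<comment> \<open>The bound must not depend on \<open>r\<close>: differentiating the rescaled
      cutoff produces powers of \<open>1 / r\<close>, which are at most \<open>1\<close> for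
      \<open>r \<ge> 1\<close>.\<close>
    have gb: "cmod (multi_deriv \<beta> g \<xi>) \<le> 1 + A" if "length \<beta> \<le> N" for \<beta> \<xi>
    proof -
      have "multi_deriv \<beta> (cutoff_at (0::real^'n) r)
          = (\<lambda>\<xi>. (1/r) ^ length \<beta> *\<^sub>R multi_deriv \<beta> cutoff (- ((1 / r) *\<^sub>R 0) + (1/r) *\<^sub>R \<xi>))"
        unfolding cutoff_at_def[abs_def] by (rule multi_deriv_affine[OF smooth_fun_cutoff])
      moreover have "(1/r) ^ length \<beta> \<le> 1" using r by (simp add: power_le_one)
      then have "(1/r) ^ length \<beta> * cmod (multi_deriv \<beta> cutoff (- ((1 / r) *\<^sub>R 0) + (1/r) *\<^sub>R \<xi>)) \<le> 1 * A"
        using r A that by (intro mult_mono) auto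
      ultimately have *: "cmod (multi_deriv \<beta> (cutoff_at (0::real^'n) r) \<xi>) \<le> A" using r by simp
      have "cmod (multi_deriv \<beta> g \<xi>) \<le> cmod (multi_deriv \<beta> (\<lambda>\<xi>. 1) \<xi>)
          + cmod (multi_deriv \<beta> (cutoff_at (0::real^'n) r) \<xi>)"
        unfolding g_def by (simp add: multi_deriv_diff[OF smooth_fun_const smooth_fun_cutoff_at]
            norm_triangle_ineq4)
      also have "\<dots> \<le> 1 + A" using * by (intro add_mono) (auto simp: multi_deriv_const)
      finally show ?thesis .
    qed
    have tf: "(\<lambda>\<xi>. \<phi> \<xi> * cutoff_at (0::real^'n) r \<xi>) \<in> test_functions UNIV"
      using test_functions_mult[OF cutoff_at_test_function[of r 0] s] r test_functions_mono[of _ UNIV]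
        by (simp add: mult.commute)
    have "(\<lambda>\<xi>. \<phi> \<xi> * g \<xi>) = (\<lambda>\<xi>. \<phi> \<xi> - \<phi> \<xi> * cutoff_at (0::real^'n) r \<xi>)"
      by (simp add: g_def algebra_simps)
    then have gH: "(\<lambda>\<xi>. \<phi> \<xi> * g \<xi>) \<in> H_space \<O>" and Vg: "V (\<lambda>\<xi>. \<phi> \<xi> * g \<xi>) = V \<phi>"
      using H_space_diff[OF \<phi> test_function_in_H_space[OF tf]] H_dual_diff[OF V \<phi>
          test_function_in_H_space[OF tf]] van[OF tf]
      by auto
    have "cmod (V (\<lambda>\<xi>. \<phi> \<xi> * g \<xi>)) \<le> M * (2 ^ N * (1 + A) * ?C * exp (- (\<epsilon> * r)))"
    proof (rule bound[rule_format, OF gH])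
      fix \<xi> and \<alpha> :: "'n list" assume \<alpha>: "length \<alpha> \<le> N"
      show "weighted K \<alpha> (\<lambda>\<xi>. \<phi> \<xi> * g \<xi>) \<xi> \<le> 2 ^ N * (1 + A) * ?C * exp (- (\<epsilon> * r))"
      \<comment> \<open>On the open ball the product is identically \<open>0\<close>, hence so are
        its derivatives; outside, the surplus weight is at least
        \<open>exp (\<epsilon> * r)\<close>.\<close>
      proof (cases "norm \<xi> < r")
        case True
        have "multi_deriv \<alpha> (\<lambda>\<xi>. \<phi> \<xi> * g \<xi>) \<xi> = multi_deriv \<alpha> (\<lambda>\<xi>. 0) \<xi>"
          using True r by (intro multi_deriv_cong_open[of "ball 0 r"]) (auto simp: g_def cutoff_at_eq_1)
        then show ?thesis using A C by (simp add: multi_deriv_const)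
      next
        case False
        have 1: "cmod (multi_deriv \<beta> \<phi> \<xi>) \<le> exp (- support_fun K' \<xi>) * ?C" if "length \<beta> \<le> N" for \<beta>
          using Hb_seminorm_upper[OF \<phi>K' that, of \<xi>] by (simp add: exp_minus field_simps)
        have "cmod (multi_deriv \<alpha> (\<lambda>\<xi>. \<phi> \<xi> * g \<xi>) \<xi>)
            \<le> 2 ^ length \<alpha> * (exp (- support_fun K' \<xi>) * ?C) * (1 + A)"
          using \<alpha> by (intro norm_multi_deriv_mult_le[OF s sg]) (auto intro!: 1 gb)
        also have "\<dots> \<le> 2 ^ N * (exp (- support_fun K' \<xi>) * ?C) * (1 + A)"
          using \<alpha> A C by (intro mult_right_mono power_increasing) auto
        finally have "weighted K \<alpha> (\<lambda>\<xi>. \<phi> \<xi> * g \<xi>) \<xi>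
          \<le> exp (support_fun K \<xi>) * (2 ^ N * (exp (- support_fun K' \<xi>) * ?C) * (1 + A))"
          by (intro mult_left_mono) auto
        also have "\<dots> = 2 ^ N * (1 + A) * ?C * exp (support_fun K \<xi> - support_fun K' \<xi>)"
          by (simp add: exp_diff exp_minus field_simps)
        also have "\<dots> \<le> 2 ^ N * (1 + A) * ?C * exp (- (\<epsilon> * r))"
        proof -
          have "\<epsilon> * r \<le> \<epsilon> * norm \<xi>" using False \<epsilon> by (intro mult_left_mono) auto
          then show ?thesis using supp[of \<xi>] A C by (intro mult_left_mono) auto
        qed
        finally show ?thesis .
      qed
    qed
    then show ?thesis by (simp add: Vg D_def mult_ac)
  qed
  have "((\<lambda>r. D * exp (- (\<epsilon> * r))) \<longlongrightarrow> 0) at_top"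
    using \<epsilon> by real_asymp
  moreover have "\<forall>\<^sub>F r in at_top. cmod (V \<phi>) \<le> D * exp (- (\<epsilon> * r))"
    using eventually_ge_at_top[of "1::real"] by eventually_elim (rule le)
  ultimately have "cmod (V \<phi>) \<le> 0"
    by (rule tendsto_lowerbound) simp
  then show ?thesis by simp
qed

section \<open>Integrals\<close>

text \<open>Differentiation under the integral sign, for a parameter in any normed space because
  real, complex and vector parameters all occur. Along sequences the remainder quotient is dominated
  by \<open>2 * B\<close>: one \<open>B\<close> comes from the mean value inequality on the ball,
  the other from the linear part.\<close>

lemma has_derivative_lebesgue_integral:
  fixes F :: "'a::real_normed_vector \<Rightarrow> 'b \<Rightarrow> 'c::{banach, second_countable_topology}"
  assumes e: "e > 0"
    and int: "\<And>p. p \<in> ball p0 e \<Longrightarrow> integrable M (F p)"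
    and der: "\<And>p \<eta>. p \<in> ball p0 e \<Longrightarrow> ((\<lambda>p. F p \<eta>) has_derivative F' p \<eta>) (at p)"
    and bd: "\<And>p \<eta> v. p \<in> ball p0 e \<Longrightarrow> norm (F' p \<eta> v) \<le> B \<eta> * norm v"
    and B: "integrable M B"
    and meas: "\<And>v. (\<lambda>\<eta>. F' p0 \<eta> v) \<in> borel_measurable M"
  shows "((\<lambda>p. \<integral>\<eta>. F p \<eta> \<partial>M) has_derivative (\<lambda>v. \<integral>\<eta>. F' p0 \<eta> v \<partial>M)) (at p0)"
proof -
  have p0: "p0 \<in> ball p0 e" using e by simp
  have lin: "bounded_linear (F' p0 \<eta>)" for \<eta>
    using der[OF p0] has_derivative_bounded_linear by blast
  have intF': "integrable M (\<lambda>\<eta>. F' p0 \<eta> v)" for v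
  proof (rule Bochner_Integration.integrable_bound[of _ "\<lambda>\<eta>. B \<eta> * norm v"])
    show "integrable M (\<lambda>\<eta>. B \<eta> * norm v)" using B by simp
    show "AE \<eta> in M. norm (F' p0 \<eta> v) \<le> norm (B \<eta> * norm v)"
    proof (rule AE_I2)
      show "norm (F' p0 \<eta> v) \<le> norm (B \<eta> * norm v)" for \<eta>
        using bd[OF p0, of \<eta> v] unfolding real_norm_def by linarith
    qed
  qed (rule meas)
  have "bounded_linear (\<lambda>v. \<integral>\<eta>. F' p0 \<eta> v \<partial>M)"
  proof (rule bounded_linear_intro[of _ "\<integral>\<eta>. B \<eta> \<partial>M"])
    show "(\<integral>\<eta>. F' p0 \<eta> (x + y) \<partial>M) = (\<integral>\<eta>. F' p0 \<eta> x \<partial>M) + (\<integral>\<eta>. F' p0 \<eta> y \<partial>M)" for x y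
      by (subst Bochner_Integration.integral_add[symmetric])
        (auto intro: intF' simp: linear_add[OF bounded_linear.linear[OF lin]])
    show "(\<integral>\<eta>. F' p0 \<eta> (r *\<^sub>R x) \<partial>M) = r *\<^sub>R (\<integral>\<eta>. F' p0 \<eta> x \<partial>M)" for r x
      by (simp add: linear_scale[OF bounded_linear.linear[OF lin]])
    show "norm (\<integral>\<eta>. F' p0 \<eta> x \<partial>M) \<le> norm x * (\<integral>\<eta>. B \<eta> \<partial>M)" for x
    proof -
      have "norm (\<integral>\<eta>. F' p0 \<eta> x \<partial>M) \<le> (\<integral>\<eta>. norm (F' p0 \<eta> x) \<partial>M)" by (rule integral_norm_bound)
      also have "\<dots> \<le> (\<integral>\<eta>. B \<eta> * norm x \<partial>M)"
        using B by (intro integral_mono integrable_norm intF' bd[OF p0]) auto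
      finally show ?thesis by (simp add: mult.commute)
    qed
  qed
  moreover have "((\<lambda>h. norm ((\<integral>\<eta>. F (p0 + h) \<eta> \<partial>M) - (\<integral>\<eta>. F p0 \<eta> \<partial>M)
      - (\<integral>\<eta>. F' p0 \<eta> h \<partial>M)) / norm h) \<longlongrightarrow> 0) (at 0)"
    unfolding tendsto_at_iff_sequentially comp_def
  proof (intro allI impI)
    fix X :: "nat \<Rightarrow> 'a" assume X: "\<forall>i. X i \<in> UNIV - {0}" "X \<longlonglongrightarrow> 0"
    \<comment> \<open>\<open>F p\<close> is known to be integrable only for \<open>p\<close> in the
      ball, so \<open>Q\<close> is set to \<open>0\<close> as long as \<open>X i\<close> is too
      large. This concerns finitely many indices.\<close>
    define Q where "Q i \<eta> = (if norm (X i) < e then (F (p0 + X i) \<eta> - F p0 \<eta>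
        - F' p0 \<eta> (X i)) /\<^sub>R norm (X i) else 0)" for i \<eta>
    have evX: "\<forall>\<^sub>F i in sequentially. norm (X i) < e"
      using X(2) e by (simp add: tendsto_iff)
    have inb: "p0 + X i \<in> ball p0 e" if "norm (X i) < e" for i
      using that by (simp add: dist_norm)
    have "(\<lambda>i. \<integral>\<eta>. Q i \<eta> \<partial>M) \<longlonglongrightarrow> (\<integral>\<eta>. 0 \<partial>M)"
    proof (rule integral_dominated_convergence[of _ _ _ "\<lambda>\<eta>. 2 * B \<eta>"])
      show "Q i \<in> borel_measurable M" for i
      proof (cases "norm (X i) < e")
        case True
        have [measurable]: "F (p0 + X i) \<in> borel_measurable M" "F p0 \<in> borel_measurable M"
          using int[OF inb[OF True]] int[OF p0] by auto
        note meas[measurable]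
        show ?thesis unfolding Q_def using True by simp
      next
        case False
        then show ?thesis unfolding Q_def by simp
      qed
      show "integrable M (\<lambda>\<eta>. 2 * B \<eta>)" using B by simp
      show "AE \<eta> in M. (\<lambda>i. Q i \<eta>) \<longlonglongrightarrow> 0"
      proof (rule AE_I2)
        fix \<eta>
        have "((\<lambda>h. norm (F (p0 + h) \<eta> - F p0 \<eta> - F' p0 \<eta> h) / norm h) \<longlongrightarrow> 0) (at 0)"
          using der[OF p0, of \<eta>] by (simp add: has_derivative_at)
        then have *: "(\<lambda>i. norm (F (p0 + X i) \<eta> - F p0 \<eta> - F' p0 \<eta> (X i)) / norm (X i)) \<longlonglongrightarrow> 0"
          using X unfolding tendsto_at_iff_sequentially comp_def by blast
        have "(\<lambda>i. norm (Q i \<eta>)) \<longlonglongrightarrow> 0"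
          by (rule Lim_transform_eventually[OF *])
            (use evX in eventually_elim, simp add: Q_def divide_inverse mult.commute)
        then show "(\<lambda>i. Q i \<eta>) \<longlonglongrightarrow> 0" by (rule tendsto_norm_zero_cancel)
      qed
      show "AE \<eta> in M. norm (Q i \<eta>) \<le> 2 * B \<eta>" for i
      proof (rule AE_I2)
        fix \<eta>
        \<comment> \<open>Nonnegativity of \<open>B\<close> follows from \<open>bd\<close> because
          \<open>X i\<close> is a nonzero direction.\<close>
        have B0: "B \<eta> \<ge> 0"
        proof -
          have "X i \<noteq> 0" using X(1) by blast
          moreover have "0 \<le> B \<eta> * norm (X i)" using order_trans[OF norm_ge_zero bd[OF p0]] .
          ultimately show ?thesis by (simp add: zero_le_mult_iff)
        qed
        show "norm (Q i \<eta>) \<le> 2 * B \<eta>"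
        proof (cases "norm (X i) < e")
          case True
          have nz: "norm (X i) > 0" using X(1) by simp
          have "norm (F (p0 + X i) \<eta> - F p0 \<eta>) \<le> B \<eta> * norm (p0 + X i - p0)"
          proof (rule differentiable_bound[of "ball p0 e" "\<lambda>p. F p \<eta>" "\<lambda>p. F' p \<eta>"])
            show "((\<lambda>p. F p \<eta>) has_derivative F' p \<eta>) (at p within ball p0 e)" if "p \<in> ball p0 e" for p
              using der[OF that] by (rule has_derivative_at_withinI)
            show "onorm (F' p \<eta>) \<le> B \<eta>" if "p \<in> ball p0 e" for p
              by (rule onorm_bound[OF B0]) (rule bd[OF that])
          qed (use inb[OF True] p0 in auto)
          moreover have "norm (F' p0 \<eta> (X i)) \<le> B \<eta> * norm (X i)" by (rule bd[OF p0])
          ultimately have "norm (F (p0 + X i) \<eta> - F p0 \<eta> - F' p0 \<eta> (X i)) \<le> 2 * B \<eta> * norm (X i)"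
            using norm_triangle_ineq4[of "F (p0 + X i) \<eta> - F p0 \<eta>" "F' p0 \<eta> (X i)"] by simp
          moreover have "norm (Q i \<eta>) = norm (F (p0 + X i) \<eta> - F p0 \<eta> - F' p0 \<eta> (X i)) / norm (X i)"
            using True by (simp add: Q_def divide_inverse mult.commute)
          ultimately show ?thesis by (simp add: pos_divide_le_eq[OF nz])
        next
          case False
          then show ?thesis using B0 by (simp add: Q_def)
        qed
      qed
    qed simp
    then have "(\<lambda>i. norm (\<integral>\<eta>. Q i \<eta> \<partial>M)) \<longlonglongrightarrow> 0"
      using tendsto_norm_zero by simp
    moreover have "\<forall>\<^sub>F i in sequentially. norm (\<integral>\<eta>. Q i \<eta> \<partial>M) =
      norm ((\<integral>\<eta>. F (p0 + X i) \<eta> \<partial>M) - (\<integral>\<eta>. F p0 \<eta> \<partial>M) - (\<integral>\<eta>. F' p0 \<eta> (X i) \<partial>M)) / norm (X i)"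
      using evX
    proof eventually_elim
      case (elim i)
      have "(\<integral>\<eta>. Q i \<eta> \<partial>M) = ((\<integral>\<eta>. F (p0 + X i) \<eta> \<partial>M) - (\<integral>\<eta>. F p0 \<eta> \<partial>M)
          - (\<integral>\<eta>. F' p0 \<eta> (X i) \<partial>M)) /\<^sub>R norm (X i)"
        using elim by (simp add: Q_def int[OF inb[OF elim]] int[OF p0] intF')
      then show ?case by (simp add: divide_inverse mult.commute)
    qed
    ultimately show "(\<lambda>i. norm ((\<integral>\<eta>. F (p0 + X i) \<eta> \<partial>M) - (\<integral>\<eta>. F p0 \<eta> \<partial>M)
        - (\<integral>\<eta>. F' p0 \<eta> (X i) \<partial>M)) / norm (X i)) \<longlonglongrightarrow> 0"
      by (rule Lim_transform_eventually)
  qed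
  ultimately show ?thesis by (simp add: has_derivative_at)
qed

section \<open>Integrals of products over the coordinates and affine substitution\<close>

lemma lborel_prod_Basis:
  fixes g :: "'a::euclidean_space \<Rightarrow> real \<Rightarrow> complex"
  assumes "\<And>b. b \<in> Basis \<Longrightarrow> integrable lborel (g b)"
  shows "integrable lborel (\<lambda>x. \<Prod>b\<in>Basis. g b (x \<bullet> b))"
    and "(\<integral>x. (\<Prod>b\<in>Basis. g b (x \<bullet> b)) \<partial>lborel) = (\<Prod>b\<in>Basis. \<integral>t. g b t \<partial>lborel)"
proof -
  interpret product_sigma_finite "\<lambda>_::'a. lborel :: real measure"
    by standard
  have m: "(\<lambda>f. \<Sum>b\<in>Basis. f b *\<^sub>R b) \<in> (\<Pi>\<^sub>M b\<in>Basis. (lborel :: real measure)) \<rightarrow>\<^sub>M (borel :: 'a measure)"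
    by measurable
  have [measurable]: "g b \<in> borel_measurable borel" if "b \<in> Basis" for b
    using assms[OF that] by auto
  have m2: "(\<lambda>x::'a. \<Prod>b\<in>Basis. g b (x \<bullet> b)) \<in> borel_measurable borel"
    by measurable
  have eq: "(\<Prod>b\<in>Basis. g b ((\<Sum>b\<in>Basis. f b *\<^sub>R b) \<bullet> b)) = (\<Prod>b\<in>Basis. g b (f b))" for f :: "'a \<Rightarrow> real"
    by (intro prod.cong) simp_all
  show "integrable lborel (\<lambda>x. \<Prod>b\<in>Basis. g b (x \<bullet> b))"
    unfolding lborel_eq[where 'a='a]
    by (subst integrable_distr_eq[OF m m2], unfold eq) (intro product_integrable_prod assms finite_Basis)
  show "(\<integral>x. (\<Prod>b\<in>Basis. g b (x \<bullet> b)) \<partial>lborel) = (\<Prod>b\<in>Basis. \<integral>t. g b t \<partial>lborel)"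
    unfolding lborel_eq[where 'a='a]
    by (subst integral_distr[OF m m2], unfold eq) (intro product_integral_prod assms finite_Basis)
qed

lemma lborel_prod_vec:
  fixes f :: "'n::finite \<Rightarrow> real \<Rightarrow> complex"
  assumes "\<And>i. integrable lborel (f i)"
  shows "integrable lborel (\<lambda>x::real^'n. \<Prod>i\<in>UNIV. f i (x $ i))"
    and "(\<integral>x. (\<Prod>i\<in>UNIV. f i (x $ i)) \<partial>lborel) = (\<Prod>i\<in>UNIV. \<integral>t. f i t \<partial>lborel)"
proof -
  let ?ax = "\<lambda>i::'n. axis i (1::real)"
  have inj: "inj ?ax" by (auto simp: inj_on_def axis_eq_axis)
  have Basis: "(Basis :: (real^'n) set) = range ?ax" by (auto simp: Basis_vec_def)
  define g where "g b = f (inv ?ax b)" for b :: "real^'n"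
  have g: "g (?ax i) = f i" for i by (simp add: g_def inv_f_f[OF inj])
  have int: "integrable lborel (g b)" if "b \<in> Basis" for b using assms by (simp add: g_def)
  have eq: "(\<Prod>b\<in>Basis. g b (x \<bullet> b)) = (\<Prod>i\<in>UNIV. f i (x $ i))" for x :: "real^'n"
    unfolding Basis by (subst prod.reindex[OF inj]) (simp add: g inner_axis)
  have eq2: "(\<Prod>b\<in>Basis. \<integral>t. g b t \<partial>lborel) = (\<Prod>i\<in>UNIV. \<integral>t. f i t \<partial>lborel)"
    unfolding Basis by (subst prod.reindex[OF inj]) (simp add: g)
  show "integrable lborel (\<lambda>x::real^'n. \<Prod>i\<in>UNIV. f i (x $ i))"
    using lborel_prod_Basis(1)[of g, OF int] unfolding eq .
  show "(\<integral>x. (\<Prod>i\<in>UNIV. f i (x $ i)) \<partial>lborel) = (\<Prod>i\<in>UNIV. \<integral>t. f i t \<partial>lborel)"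
    using lborel_prod_Basis(2)[of g, OF int] unfolding eq eq2 .
qed

lemma lborel_integral_affine:
  fixes f :: "'a::euclidean_space \<Rightarrow> 'b::{banach, second_countable_topology}"
  assumes c: "c \<noteq> 0" and f: "f \<in> borel_measurable borel"
  shows "(\<integral>x. f x \<partial>lborel) = \<bar>c\<bar> ^ DIM('a) *\<^sub>R (\<integral>x. f (t + c *\<^sub>R x) \<partial>lborel)"
    and "integrable lborel f \<longleftrightarrow> integrable lborel (\<lambda>x. f (t + c *\<^sub>R x))"
proof -
  have m: "(\<lambda>x::'a. t + c *\<^sub>R x) \<in> lborel \<rightarrow>\<^sub>M borel" by simp
  have k: "\<bar>c\<bar> ^ DIM('a) \<noteq> 0" using c by simp
  show "(\<integral>x. f x \<partial>lborel) = \<bar>c\<bar> ^ DIM('a) *\<^sub>R (\<integral>x. f (t + c *\<^sub>R x) \<partial>lborel)"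
    by (subst lborel_affine[OF c, of t]) (simp add: integral_density integral_distr f)
  show "integrable lborel f \<longleftrightarrow> integrable lborel (\<lambda>x. f (t + c *\<^sub>R x))"
  proof -
    have "integrable lborel f \<longleftrightarrow> integrable (distr lborel borel (\<lambda>x. t + c *\<^sub>R x)) (\<lambda>x. \<bar>c\<bar> ^ DIM('a) *\<^sub>R f x)"
      by (subst lborel_affine[OF c, of t]) (simp add: integrable_density f)
    also have "\<dots> \<longleftrightarrow> integrable (distr lborel borel (\<lambda>x. t + c *\<^sub>R x)) f"
      using integrable_scaleR_right[of "inverse (\<bar>c\<bar> ^ DIM('a))" _ "\<lambda>x. \<bar>c\<bar> ^ DIM('a) *\<^sub>R f x"] k
      by auto
    also have "\<dots> \<longleftrightarrow> integrable lborel (\<lambda>x. f (t + c *\<^sub>R x))"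
      by (rule integrable_distr_eq[OF m f])
    finally show ?thesis .
  qed
qed

section \<open>Exponential and Gaussian integrals\<close>

lemma integrable_exp_neg_abs:
  assumes a: "a > 0" shows "integrable lborel (\<lambda>t::real. exp (- (a * \<bar>t\<bar>)))"
proof -
  have "prob_space (density lborel (exponential_density a))"
    by (rule prob_space_exponential_density[OF a])
  then have "(\<integral>\<^sup>+x. exponential_density a x \<partial>lborel) = 1"
    using prob_space.emeasure_space_1 by (fastforce simp: emeasure_density)
  then have 1: "integrable lborel (exponential_density a)"
    using a by (intro integrableI_nn_integral_finite[of _ _ 1]) (auto simp: exponential_density_def)
  from lborel_integrable_real_affine[OF this, of "-1" 0]
  have 2: "integrable lborel (\<lambda>x. exponential_density a (- x))" by simp
  have "integrable lborel (\<lambda>t::real. inverse a * (exponential_density a t + exponential_density a (- t)))"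
    using 1 2 by (intro integrable_mult_right Bochner_Integration.integrable_add) auto
  then show ?thesis
    by (rule Bochner_Integration.integrable_bound)
      (use a in \<open>auto simp: exponential_density_def field_simps abs_if\<close>)
qed

text \<open>The sum of the absolute coordinates is at most \<open>CARD('n)\<close> times the norm,
  so giving each coordinate the rate \<open>a / CARD('n)\<close> yields an integrable product that
  dominates.\<close>

lemma integrable_exp_neg_norm:
  assumes a: "a > 0" shows "integrable lborel (\<lambda>x::real^'n. exp (- (a * norm x)))"
proof -
  let ?n = "real CARD('n)"
  have n: "?n > 0" by simp
  have "integrable lborel (\<lambda>x::real^'n. \<Prod>i\<in>UNIV. complex_of_real (exp (- (a / ?n * \<bar>x $ i\<bar>))))"
    using a n by (intro lborel_prod_vec(1) integrable_of_real integrable_exp_neg_abs) auto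
  then show ?thesis
  proof (rule Bochner_Integration.integrable_bound)
    show "AE x in lborel. norm (exp (- (a * norm (x :: real^'n))))
        \<le> norm (\<Prod>i\<in>UNIV. complex_of_real (exp (- (a / ?n * \<bar>x $ i\<bar>))))"
    proof (rule AE_I2)
      fix x :: "real^'n"
      have "(\<Sum>i\<in>UNIV. \<bar>x $ i\<bar>) \<le> (\<Sum>i\<in>(UNIV::'n set). norm x)"
        by (intro sum_mono component_le_norm_cart)
      then have "a / ?n * (\<Sum>i\<in>UNIV. \<bar>x $ i\<bar>) \<le> a / ?n * (?n * norm x)"
        using a n by (intro mult_left_mono) auto
      then have le: "(\<Sum>i\<in>UNIV. a / ?n * \<bar>x $ i\<bar>) \<le> a * norm x"
        using n by (simp add: sum_distrib_left)
      have "norm (\<Prod>i\<in>UNIV. complex_of_real (exp (- (a / ?n * \<bar>x $ i\<bar>))))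
          = exp (- (\<Sum>i\<in>UNIV. a / ?n * \<bar>x $ i\<bar>))"
        by (simp add: prod_norm[symmetric] exp_sum[symmetric] sum_negf)
      then show "norm (exp (- (a * norm x))) \<le> norm (\<Prod>i\<in>UNIV. complex_of_real (exp (- (a / ?n * \<bar>x $ i\<bar>))))"
        using le by simp
    qed
  qed simp
qed

lemma neg_square_le_linear:
  fixes l R x :: real
  assumes "l > 0" shows "- l * x\<^sup>2 + R * x \<le> R\<^sup>2 / (4 * l)"
proof -
  have "0 \<le> (2 * l * x - R)\<^sup>2 / (4 * l)" using assms by simp
  also have "\<dots> = R\<^sup>2 / (4 * l) - (- l * x\<^sup>2 + R * x)"
    using assms by (simp add: field_simps power2_eq_square)
  finally show ?thesis by simp
qed

lemma integrable_gaussian_exp_norm: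
  assumes "l > 0" shows "integrable lborel (\<lambda>x::real^'n. exp (- l * (norm x)\<^sup>2 + R * norm x))"
proof -
  \<comment> \<open>Completing the square with \<open>R + 1\<close> in place of \<open>R\<close>
    leaves one spare \<open>- norm x\<close> in the exponent, and that makes the bound
    integrable.\<close>
  have "integrable lborel (\<lambda>x::real^'n. exp ((R + 1)\<^sup>2 / (4 * l)) * exp (- (1 * norm x)))"
    by (intro integrable_mult_right integrable_exp_neg_norm) simp
  then show ?thesis
  proof (rule Bochner_Integration.integrable_bound)
    show "AE x in lborel. norm (exp (- l * (norm (x :: real^'n))\<^sup>2 + R * norm x))
        \<le> norm (exp ((R + 1)\<^sup>2 / (4 * l)) * exp (- (1 * norm x)))"
    proof (rule AE_I2)
      fix x :: "real^'n"
      have "- l * (norm x)\<^sup>2 + R * norm x \<le> (R + 1)\<^sup>2 / (4 * l) - norm x"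
        using neg_square_le_linear[OF assms, of "norm x" "R + 1"] by (simp add: algebra_simps)
      then show "norm (exp (- l * (norm x)\<^sup>2 + R * norm x))
          \<le> norm (exp ((R + 1)\<^sup>2 / (4 * l)) * exp (- (1 * norm x)))"
        unfolding mult_exp_exp real_norm_def abs_exp_cancel exp_le_cancel_iff by simp
    qed
  qed simp
qed

text \<open>Only the real part of \<open>w\<close> is removed by a substitution, which is a real
  one; the imaginary part is read off from the characteristic function of the standard normal
  distribution. No contour has to be moved.\<close>

lemma gaussian_integral_1:
  fixes w :: complex
  assumes l: "l > 0"
  shows "integrable lborel (\<lambda>x::real. exp (- of_real (l * x\<^sup>2) + w * of_real x))"
    and "(\<integral>x. exp (- of_real (l * x\<^sup>2) + w * of_real x) \<partial>lborel)
        = of_real (sqrt (pi / l)) * exp (w\<^sup>2 / of_real (4 * l))"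
proof -
  define u v where "u = Re w" and "v = Im w"
  \<comment> \<open>The scale turns \<open>l * (c * t)\<^sup>2\<close> into
    \<open>t\<^sup>2 / 2\<close>. The centre \<open>u / (2 * l)\<close> used below is the maximum of
    the real part of the exponent.\<close>
  define c where "c = 1 / sqrt (2 * l)"
  have c: "c > 0" "c\<^sup>2 = 1 / (2 * l)" using l by (simp_all add: c_def power_divide)
  let ?f = "\<lambda>x::real. exp (- of_real (l * x\<^sup>2) + w * of_real x)"
  have fm: "?f \<in> borel_measurable borel" by (intro borel_measurable_continuous_onI continuous_intros)
  have ex: "- of_real (l * (u / (2 * l) + c * t)\<^sup>2) + w * of_real (u / (2 * l) + c * t)
      = (of_real (u\<^sup>2) + 2 * \<i> * of_real (u * v)) / of_real (4 * l) + (of_real (- t\<^sup>2 / 2) + \<i>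
          * of_real (v * c * t))" for t
  proof -
    have w: "w = of_real u + \<i> * of_real v" unfolding u_def v_def by (simp add: complex_eq)
    have "l * (u / (2 * l) + c * t)\<^sup>2 = u\<^sup>2 / (4 * l) + u * c * t + t\<^sup>2 / 2"
      using l c(2) by (simp add: power2_sum power_mult_distrib power_divide field_simps) 
        (simp add: power2_eq_square field_simps)
    then show ?thesis unfolding w using l
      by (simp only: w) (simp add: field_simps power2_eq_square)
  qed
  let ?K = "exp ((of_real (u\<^sup>2) + 2 * \<i> * of_real (u * v)) / of_real (4 * l)) :: complex"
  have sn: "std_normal_density t = exp (- t\<^sup>2 / 2) / sqrt (2 * pi)" for t
    by (simp add: std_normal_density_def)
  have ft: "?f (u / (2 * l) + c * t) = (?K * of_real (sqrt (2 * pi))) * (of_real (std_normal_density t)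
      * iexp (v * c * t))" for t
    unfolding ex exp_add sn by (simp add: exp_of_real[symmetric])
  have I1: "integrable lborel (\<lambda>t. of_real (std_normal_density t) * iexp (v * c * t))"
    by (rule Bochner_Integration.integrable_bound[OF integrable_normal_density[of 1 0]]) (auto simp:
        norm_mult)
  have I2: "(\<integral>t. of_real (std_normal_density t) * iexp (v * c * t) \<partial>lborel) = of_real (exp (- (v * c)\<^sup>2 / 2))"
  proof -
    have "char std_normal_distribution (v * c) = (\<integral>t. std_normal_density t *\<^sub>R iexp (v * c * t) \<partial>lborel)"
      unfolding char_def by (subst integral_density) (auto simp: )
    then show ?thesis by (simp add: char_std_normal_distribution scaleR_conv_of_real)
  qed
  have int: "integrable lborel (\<lambda>t. ?f (u / (2 * l) + c * t))"
    unfolding ft by (intro integrable_mult_right I1)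
  then show "integrable lborel ?f"
    using lborel_integral_affine(2)[of c ?f "u / (2 * l)"] c fm by simp
  have "(\<integral>x. ?f x \<partial>lborel) = c *\<^sub>R (\<integral>t. ?f (u / (2 * l) + c * t) \<partial>lborel)"
    using lborel_integral_affine(1)[of c ?f "u / (2 * l)"] c fm by simp
  also have "\<dots> = c *\<^sub>R ((?K * of_real (sqrt (2 * pi))) * of_real (exp (- (v * c)\<^sup>2 / 2)))"
    unfolding ft by (subst integral_mult_right_zero) (simp only: I2)
  also have "\<dots> = of_real (c * sqrt (2 * pi)) * (?K * of_real (exp (- (v * c)\<^sup>2 / 2)))"
    by (simp add: scaleR_conv_of_real mult_ac)
  also have "c * sqrt (2 * pi) = sqrt (pi / l)"
    using l by (simp add: c_def real_sqrt_mult real_sqrt_divide)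
  also have "?K * of_real (exp (- (v * c)\<^sup>2 / 2)) = exp (w\<^sup>2 / of_real (4 * l))"
  proof -
    have w: "w = of_real u + \<i> * of_real v" unfolding u_def v_def by (simp add: complex_eq)
    have "of_real (exp (- (v * c)\<^sup>2 / 2)) = (exp (of_real (- (v\<^sup>2) / (4 * l))) :: complex)"
      by (simp only: exp_of_real[symmetric] power_mult_distrib c) (simp add: field_simps)
    then have "?K * of_real (exp (- (v * c)\<^sup>2 / 2))
        = exp ((of_real (u\<^sup>2) + 2 * \<i> * of_real (u * v)) / of_real (4 * l) + of_real (- (v\<^sup>2) / (4 * l)))"
      by (simp only: exp_add)
    also have "(of_real (u\<^sup>2) + 2 * \<i> * of_real (u * v)) / of_real (4 * l) + of_real (- (v\<^sup>2) / (4 * l))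
        = w\<^sup>2 / of_real (4 * l)"
      unfolding w using l by (simp add: field_simps power2_eq_square)
    finally show ?thesis .
  qed
  finally show "(\<integral>x. ?f x \<partial>lborel) = of_real (sqrt (pi / l)) * exp (w\<^sup>2 / of_real (4 * l))" .
qed

text \<open>Bilinear, without conjugation, so that functions built from it are holomorphic in either
  argument.\<close>

definition cdot :: "complex^'n \<Rightarrow> complex^'n \<Rightarrow> complex" where
  "cdot z w = (\<Sum>i\<in>UNIV. z $ i * w $ i)"

lemma gaussian_integral:
  fixes w :: "complex^'n"
  assumes l: "l > 0"
  shows "integrable lborel (\<lambda>x::real^'n. exp (- of_real (l * (norm x)\<^sup>2) + cdot w (cvec x)))"
    and "(\<integral>x. exp (- of_real (l * (norm x)\<^sup>2) + cdot w (cvec x)) \<partial>lborel)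
      = of_real (sqrt (pi / l)) ^ CARD('n) * exp (cdot w w / of_real (4 * l))"
proof -
  have eq: "exp (- of_real (l * (norm x)\<^sup>2) + cdot w (cvec x))
    = (\<Prod>i\<in>UNIV. exp (- of_real (l * (x $ i)\<^sup>2) + w $ i * of_real (x $ i)))" for x :: "real^'n"
  proof -
    have "(norm x)\<^sup>2 = (\<Sum>i\<in>UNIV. (x $ i)\<^sup>2)"
      unfolding power2_norm_eq_inner inner_vec_def by (simp add: power2_eq_square)
    then have "complex_of_real ((norm x)\<^sup>2) = (\<Sum>i\<in>UNIV. of_real ((x $ i)\<^sup>2))"
      by (simp only: of_real_sum)
    then have "- of_real (l * (norm x)\<^sup>2) + cdot w (cvec x)
        = (\<Sum>i\<in>UNIV. - of_real (l * (x $ i)\<^sup>2) + w $ i * of_real (x $ i))"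
      by (simp add: cdot_def cvec_def sum_subtractf sum_distrib_left del: of_real_power)
    then show ?thesis by (simp add: exp_sum)
  qed
  show "integrable lborel (\<lambda>x::real^'n. exp (- of_real (l * (norm x)\<^sup>2) + cdot w (cvec x)))"
    unfolding eq by (rule lborel_prod_vec(1)[OF gaussian_integral_1(1)[OF l]])
  show "(\<integral>x. exp (- of_real (l * (norm x)\<^sup>2) + cdot w (cvec x)) \<partial>lborel)
      = of_real (sqrt (pi / l)) ^ CARD('n) * exp (cdot w w / of_real (4 * l))"
    unfolding eq
    by (subst lborel_prod_vec(2)[OF gaussian_integral_1(1)[OF l]])
      (simp only: gaussian_integral_1(2)[OF l] prod.distrib prod_constant exp_sum[symmetric] finite,
       simp add: cdot_def sum_divide_distrib power2_eq_square)
qed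

section \<open>Convolution with test functions\<close>

lemma smooth_fun_has_derivative:
  fixes g :: "real^'n \<Rightarrow> complex"
  assumes "smooth_fun g"
  shows "(g has_derivative (\<lambda>v. \<Sum>i\<in>UNIV. v $ i *\<^sub>R partial_deriv i g x)) (at x)"
proof -
  obtain D where D: "(g has_derivative D) (at x)"
    using smooth_fun_differentiable[OF assms] unfolding differentiable_def by blast
  have lin: "linear D" using D by (rule has_derivative_linear)
  have "D v = (\<Sum>i\<in>UNIV. v $ i *\<^sub>R partial_deriv i g x)" for v
  proof -
    have "D v = D (\<Sum>i\<in>UNIV. v $ i *\<^sub>R axis i 1)"
      using basis_expansion[of v] by (simp add: scalar_mult_eq_scaleR)
    also have "\<dots> = (\<Sum>i\<in>UNIV. v $ i *\<^sub>R D (axis i 1))"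
      by (simp add: linear_sum[OF lin] linear_scale[OF lin])
    finally show ?thesis by (simp add: partial_deriv_eq[OF D])
  qed
  then show ?thesis using D by presburger
qed

lemma norm_sum_components_le:
  fixes v :: "real^'n" and p :: "'n \<Rightarrow> complex"
  assumes "\<And>i. cmod (p i) \<le> A"
  shows "cmod (\<Sum>i\<in>UNIV. v $ i *\<^sub>R p i) \<le> real CARD('n) * A * norm v"
proof -
  have "cmod (\<Sum>i\<in>UNIV. v $ i *\<^sub>R p i) \<le> (\<Sum>i\<in>(UNIV::'n set). norm v * A)"
    using component_le_norm_cart[of v] assms by (intro sum_norm_le) (auto intro!: mult_mono)
  then show ?thesis by (simp add: mult_ac)
qed

lemma test_functions_multi_deriv:
  assumes "\<rho> \<in> test_functions W" shows "multi_deriv \<alpha> \<rho> \<in> test_functions W"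
  using assms by (intro test_functionsI[of _ "closure {\<xi>. \<rho> \<xi> \<noteq> 0}"] smooth_fun_multi_deriv
      multi_deriv_zero_outside)
    (auto simp: test_functions_def)

lemma smooth_fun_lipschitz:
  fixes \<rho> :: "real^'n \<Rightarrow> complex"
  assumes "smooth_fun \<rho>" and A: "\<And>i x. cmod (partial_deriv i \<rho> x) \<le> A"
  shows "cmod (\<rho> x - \<rho> y) \<le> real CARD('n) * A * norm (x - y)"
proof (rule differentiable_bound[of UNIV _ "\<lambda>x v. \<Sum>i\<in>UNIV. v $ i *\<^sub>R partial_deriv i \<rho> x"])
  show "(\<rho> has_derivative (\<lambda>v. \<Sum>i\<in>UNIV. v $ i *\<^sub>R partial_deriv i \<rho> x)) (at x within UNIV)" for x
    using smooth_fun_has_derivative[OF assms(1)] by simp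
  have A0: "A \<ge> 0" using order_trans[OF norm_ge_zero A] .
  show "onorm (\<lambda>v. \<Sum>i\<in>UNIV. v $ i *\<^sub>R partial_deriv i \<rho> x) \<le> real CARD('n) * A" for x
    by (rule onorm_bound) (use A0 in \<open>auto intro: norm_sum_components_le A\<close>)
qed auto

text \<open>Read as a superposition of translates of \<open>g\<close> with weights
  \<open>\<phi>\<close>: derivatives in \<open>\<xi>\<close> fall on \<open>g\<close> alone, and a
  functional applied to it sees only translates of \<open>g\<close>.\<close>

definition conv :: "(real^'n \<Rightarrow> complex) \<Rightarrow> (real^'n \<Rightarrow> complex) \<Rightarrow> real^'n \<Rightarrow> complex" where
  "conv \<phi> g \<xi> = (\<integral>\<eta>. \<phi> \<eta> * g (\<xi> - \<eta>) \<partial>lborel)"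

lemma test_function_borel [measurable]:
  assumes "\<rho> \<in> test_functions W" shows "(\<lambda>\<eta>. \<rho> (\<xi> - \<eta>)) \<in> borel_measurable borel"
  by (intro borel_measurable_continuous_onI continuous_on_compose2[OF smooth_fun_continuous[OF
      test_functions_smooth[OF assms]]]
      continuous_intros) auto

lemma integrable_conv:
  assumes \<phi>: "integrable lborel \<phi>" and "\<rho> \<in> test_functions W"
  shows "integrable lborel (\<lambda>\<eta>. \<phi> \<eta> * \<rho> (\<xi> - \<eta>))"
proof -
  obtain A where A: "A \<ge> 0" "\<And>\<xi>. cmod (\<rho> \<xi>) \<le> A"
    using test_function_multi_deriv_bounded[OF assms(2), of 0] by auto
  note [measurable] = test_function_borel[OF assms(2)]
  have [measurable]: "\<phi> \<in> borel_measurable borel" using \<phi> by auto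
  show ?thesis
  proof (rule Bochner_Integration.integrable_bound[of _ "\<lambda>\<eta>. A * cmod (\<phi> \<eta>)"])
    show "AE \<eta> in lborel. norm (\<phi> \<eta> * \<rho> (\<xi> - \<eta>)) \<le> norm (A * cmod (\<phi> \<eta>))"
      using A by (intro AE_I2) (simp add: norm_mult abs_mult mult.commute[of A] mult_left_mono)
  qed (use \<phi> in auto)
qed

lemma conv_has_derivative:
  fixes \<rho> :: "real^'n \<Rightarrow> complex"
  assumes \<phi>: "integrable lborel \<phi>" and \<rho>: "\<rho> \<in> test_functions W"
  shows "(conv \<phi> \<rho> has_derivative (\<lambda>v. \<integral>\<eta>. \<phi> \<eta> * (\<Sum>i\<in>UNIV. v $ i *\<^sub>R partial_deriv i \<rho> (\<xi>
      - \<eta>)) \<partial>lborel)) (at \<xi>)"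
proof -
  have s: "smooth_fun \<rho>" using \<rho> by (rule test_functions_smooth)
  have p: "partial_deriv i \<rho> \<in> test_functions W" for i
    using test_functions_multi_deriv[OF \<rho>, of "[i]"] by simp
  obtain A where A: "A \<ge> 0" "\<And>\<alpha> \<xi>. length \<alpha> \<le> 1 \<Longrightarrow> cmod (multi_deriv \<alpha> \<rho> \<xi>) \<le> A"
    using test_function_multi_deriv_bounded[OF \<rho>, of 1] by auto
  have A1: "cmod (partial_deriv i \<rho> \<xi>) \<le> A" for i \<xi> using A(2)[of "[i]"] by simp
  note [measurable] = test_function_borel[OF p]
  have [measurable]: "\<phi> \<in> borel_measurable borel" using \<phi> by auto
  show ?thesis
    unfolding conv_def[abs_def]
  proof (rule has_derivative_lebesgue_integral[where e=1 and B="\<lambda>\<eta>. cmod (\<phi> \<eta>) * (real CARD('n) * A)"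
        and F'="\<lambda>\<xi> \<eta> v. \<phi> \<eta> * (\<Sum>i\<in>UNIV. v $ i *\<^sub>R partial_deriv i \<rho> (\<xi> - \<eta>))"])
    show "integrable lborel (\<lambda>\<eta>. \<phi> \<eta> * \<rho> (p - \<eta>))" for p
      by (rule integrable_conv[OF \<phi> \<rho>])
    show "((\<lambda>p. \<phi> \<eta> * \<rho> (p - \<eta>)) has_derivative (\<lambda>v. \<phi> \<eta> * (\<Sum>i\<in>UNIV. v $ i *\<^sub>R partial_deriv i \<rho> (p
        - \<eta>)))) (at p)" for p \<eta>
    proof -
      have "((\<lambda>p. p - \<eta>) has_derivative (\<lambda>v. v)) (at p)" by (auto intro!: derivative_eq_intros)
      from has_derivative_compose[OF this smooth_fun_has_derivative[OF s]]
      show ?thesis by (rule has_derivative_mult_right)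
    qed
    show "cmod (\<phi> \<eta> * (\<Sum>i\<in>UNIV. v $ i *\<^sub>R partial_deriv i \<rho> (p - \<eta>)))
        \<le> cmod (\<phi> \<eta>) * (real CARD('n) * A) * norm v" for p \<eta> v
      using mult_left_mono[OF norm_sum_components_le[of "\<lambda>i. partial_deriv i \<rho> (p - \<eta>)", OF A1],
          of "cmod (\<phi> \<eta>)"]
      by (simp add: norm_mult mult.assoc)
    show "integrable lborel (\<lambda>\<eta>. cmod (\<phi> \<eta>) * (real CARD('n) * A))"
      using \<phi> by (intro integrable_mult_left integrable_norm)
  qed simp_all
qed

lemma multi_deriv_conv:
  fixes \<rho> :: "real^'n \<Rightarrow> complex"
  assumes \<phi>: "integrable lborel \<phi>" and \<rho>: "\<rho> \<in> test_functions W"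
  shows "multi_deriv \<alpha> (conv \<phi> \<rho>) = conv \<phi> (multi_deriv \<alpha> \<rho>)" and "smooth_fun (conv \<phi> \<rho>)"
proof -
  have pd: "partial_deriv i (conv \<phi> g) = conv \<phi> (partial_deriv i g)" if "g \<in> test_functions W" for g i
  proof
    fix \<xi> :: "real^'n"
    have ax: "(\<Sum>j\<in>UNIV. axis i 1 $ j *\<^sub>R partial_deriv j g x) = partial_deriv i g x" for x
    proof -
      have "(\<Sum>j\<in>UNIV. axis i 1 $ j *\<^sub>R partial_deriv j g x) = (\<Sum>j\<in>UNIV. if j
          = i then partial_deriv j g x else 0)"
        by (intro sum.cong) (auto simp: axis_def)
      then show ?thesis by simp
    qed
    show "partial_deriv i (conv \<phi> g) \<xi> = conv \<phi> (partial_deriv i g) \<xi>"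
      unfolding partial_deriv_eq[OF conv_has_derivative[OF \<phi> that]] ax conv_def ..
  qed
  have *: "multi_deriv \<alpha> (conv \<phi> \<rho>) = conv \<phi> (multi_deriv \<alpha> \<rho>)" for \<alpha>
    by (induction \<alpha>) (simp_all add: pd[OF test_functions_multi_deriv[OF \<rho>]])
  then show "multi_deriv \<alpha> (conv \<phi> \<rho>) = conv \<phi> (multi_deriv \<alpha> \<rho>)" .
  show "smooth_fun (conv \<phi> \<rho>)"
    unfolding smooth_fun_def * differentiable_on_def differentiable_def
    using conv_has_derivative[OF \<phi> test_functions_multi_deriv[OF \<rho>]] has_derivative_at_withinI by blast
qed

text \<open>Where a derivative of the translate is nonzero, \<open>\<xi>\<close> lies within the
  support radius \<open>r\<close> of \<open>\<eta>\<close>, so the weight is at most exponential in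
  \<open>norm \<eta>\<close>. Combined with \<open>H_dual_bound\<close>, the first estimate gives
  the exponential growth of the correlation and the second its local Lipschitz continuity.\<close>

lemma translate_bounds:
  fixes \<rho> :: "real^'n \<Rightarrow> complex"
  assumes \<rho>: "\<rho> \<in> test_functions W" and "K \<in> convex_compacts \<O>"
  shows "\<exists>R>0. \<exists>B\<ge>0. \<exists>L\<ge>0.
    (\<forall>\<alpha> \<xi> \<eta>. length \<alpha> \<le> N \<longrightarrow> exp (support_fun K \<xi>) * cmod (multi_deriv \<alpha> \<rho> (\<xi> - \<eta>)) \<le> B * exp (R * norm \<eta>)) \<and>
    (\<forall>\<alpha> \<xi> \<eta> \<eta>' T. length \<alpha> \<le> N \<longrightarrow> norm \<eta> \<le> T \<longrightarrow> norm \<eta>' \<le> T \<longrightarrow>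
      exp (support_fun K \<xi>) * cmod (multi_deriv \<alpha> \<rho> (\<xi> - \<eta>) - multi_deriv \<alpha> \<rho> (\<xi> - \<eta>'))
          \<le> L * exp (R * T) * norm (\<eta> - \<eta>'))"
proof -
  note K = convex_compactsD[OF assms(2)]
  obtain R where R: "R > 0" "\<And>x. x \<in> K \<Longrightarrow> norm x \<le> R"
    using compact_norm_bound[OF K(1)] by metis
  have h: "support_fun K \<xi> \<le> R * norm \<xi>" for \<xi> using K R by (intro support_fun_le) auto
  obtain r where r: "r > 0" "\<And>\<alpha> \<xi>. norm \<xi> > r \<Longrightarrow> multi_deriv \<alpha> \<rho> \<xi> = 0"
    using test_function_bounded_support[OF \<rho>] by metis
  \<comment> \<open>One order more than \<open>N\<close>, since the Lipschitz constants of the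
    derivatives come from the next derivatives.\<close>
  obtain A where A: "A \<ge> 0" "\<And>\<alpha> \<xi>. length \<alpha> \<le> N + 1 \<Longrightarrow> cmod (multi_deriv \<alpha> \<rho> \<xi>) \<le> A"
    using test_function_multi_deriv_bounded[OF \<rho>, of "N + 1"] by auto
  let ?L = "real CARD('n) * A"
  have lip: "cmod (multi_deriv \<alpha> \<rho> x - multi_deriv \<alpha> \<rho> y) \<le> ?L * norm (x - y)" if "length \<alpha> \<le> N" for \<alpha> x y
  proof (rule smooth_fun_lipschitz)
    show "smooth_fun (multi_deriv \<alpha> \<rho>)"
      using test_functions_smooth[OF \<rho>] by (rule smooth_fun_multi_deriv)
    show "cmod (partial_deriv i (multi_deriv \<alpha> \<rho>) x) \<le> A" for i x
      using A(2)[of "i # \<alpha>"] that by simp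
  qed
  have hT: "exp (support_fun K \<xi>) \<le> exp (R * r) * exp (R * T)" if "norm \<xi> \<le> r + T" for \<xi> T
  proof -
    have "support_fun K \<xi> \<le> R * norm \<xi>" by (rule h)
    also have "\<dots> \<le> R * (r + T)" using that R by (intro mult_left_mono) auto
    finally show ?thesis by (simp add: exp_add[symmetric] distrib_left)
  qed
  show ?thesis
  proof (rule exI[of _ R], rule conjI[OF R(1)], rule exI[of _ "A * exp (R * r)"], rule conjI, goal_cases)
    case 1
    show ?case using A by simp
  next
    case 2
    show ?case
    proof (rule exI[of _ "?L * exp (R * r)"], intro conjI allI impI)
      show "0 \<le> ?L * exp (R * r)" using A by simp
    next
    fix \<alpha> :: "'n list" and \<xi> \<eta> :: "real^'n" assume \<alpha>: "length \<alpha> \<le> N"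
    show "exp (support_fun K \<xi>) * cmod (multi_deriv \<alpha> \<rho> (\<xi> - \<eta>)) \<le> A * exp (R * r) * exp (R * norm \<eta>)"
    proof (cases "norm (\<xi> - \<eta>) > r")
      case False
      then have "norm \<xi> \<le> r + norm \<eta>" using norm_triangle_sub[of \<xi> \<eta>] by simp
      then have "exp (support_fun K \<xi>) * cmod (multi_deriv \<alpha> \<rho> (\<xi> - \<eta>))
          \<le> (exp (R * r) * exp (R * norm \<eta>)) * A"
        using \<alpha> A by (intro mult_mono hT) auto
      then show ?thesis by (simp add: mult_ac)
    qed (use A in \<open>simp add: r\<close>)
  next
    fix \<alpha> :: "'n list" and \<xi> \<eta> \<eta>' :: "real^'n" and T :: real
    assume \<alpha>: "length \<alpha> \<le> N" and T: "norm \<eta> \<le> T" "norm \<eta>' \<le> T"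
    show "exp (support_fun K \<xi>) * cmod (multi_deriv \<alpha> \<rho> (\<xi> - \<eta>) - multi_deriv \<alpha> \<rho> (\<xi> - \<eta>'))
      \<le> ?L * exp (R * r) * exp (R * T) * norm (\<eta> - \<eta>')"
    proof (cases "norm \<xi> > r + T")
      case True
      then have "norm (\<xi> - \<eta>) > r" "norm (\<xi> - \<eta>') > r"
        using T norm_triangle_sub[of \<xi> \<eta>] norm_triangle_sub[of \<xi> \<eta>'] by auto
      then show ?thesis using A by (simp add: r)
    next
      case False
      have "cmod (multi_deriv \<alpha> \<rho> (\<xi> - \<eta>) - multi_deriv \<alpha> \<rho> (\<xi> - \<eta>')) \<le> ?L * norm (\<eta> - \<eta>')"
        using lip[OF \<alpha>, of "\<xi> - \<eta>" "\<xi> - \<eta>'"] by (simp add: norm_minus_commute)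
      then have "exp (support_fun K \<xi>) * cmod (multi_deriv \<alpha> \<rho> (\<xi> - \<eta>) - multi_deriv \<alpha> \<rho> (\<xi> - \<eta>'))
        \<le> (exp (R * r) * exp (R * T)) * (?L * norm (\<eta> - \<eta>'))"
        using False by (intro mult_mono hT) auto
      then show ?thesis by (simp add: mult_ac)
    qed
    qed
  qed
qed

section \<open>Riemann sums for integrals over the whole space\<close>

lemma riemann_sum_approx:
  fixes f :: "'a::euclidean_space \<Rightarrow> 'b::banach"
  assumes f: "continuous_on (cbox a b) f" and p: "p tagged_division_of cbox a b"
    and fine: "(\<lambda>x. ball x \<delta>) fine p" and \<kappa>: "\<kappa> \<ge> 0"
    and osc: "\<And>x y. x \<in> cbox a b \<Longrightarrow> y \<in> cbox a b \<Longrightarrow> dist x y < \<delta> \<Longrightarrow> norm (f x - f y) \<le> \<kappa>"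
  shows "norm (integral (cbox a b) f - (\<Sum>(x,k)\<in>p. measure lborel k *\<^sub>R f x)) \<le> \<kappa> * measure lborel (cbox a b)"
proof -
  have int: "f integrable_on cbox a b" by (rule integrable_continuous[OF f])
  have "integral (cbox a b) f = (\<Sum>(x,k)\<in>p. integral k f)"
    by (rule integral_combine_tagged_division_topdown[OF int p])
  then have "integral (cbox a b) f - (\<Sum>(x,k)\<in>p. measure lborel k *\<^sub>R f x)
      = (\<Sum>(x,k)\<in>p. integral k f - measure lborel k *\<^sub>R f x)"
    by (simp add: sum_subtractf case_prod_unfold)
  also have "norm \<dots> \<le> (\<Sum>(x,k)\<in>p. \<kappa> * measure lborel k)"
  proof (rule sum_norm_le)
    fix y assume "y \<in> p"
    then obtain x k where y: "y = (x, k)" "(x, k) \<in> p" by (cases y) auto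
    note t = tagged_division_ofD[OF p]
    obtain c d where k: "k = cbox c d" using t(4)[OF y(2)] by blast
    have sub: "k \<subseteq> cbox a b" "x \<in> k" using t(2,3)[OF y(2)] by auto
    have kb: "k \<subseteq> ball x \<delta>" using fine y(2) by (auto simp: fine_def)
    have intk: "f integrable_on k"
      unfolding k using sub k by (intro integrable_continuous continuous_on_subset[OF f]) auto
    have "((\<lambda>y. f y - f x) has_integral (integral k f - measure lborel k *\<^sub>R f x)) k"
      using has_integral_diff[OF integrable_integral[OF intk]] has_integral_const[of "f x" c d] k by blast
    then have "norm (integral k f - measure lborel k *\<^sub>R f x) \<le> \<kappa> * measure lborel k"
      unfolding k
    proof (rule has_integral_bound[OF \<kappa>])
      fix z assume "z \<in> cbox c d"
      then have "z \<in> cbox a b" "x \<in> cbox a b" "dist z x < \<delta>"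
        using sub k kb by (auto simp: dist_commute)
      then show "norm (f z - f x) \<le> \<kappa>" by (rule osc)
    qed
    then show "norm (case y of (x, k) \<Rightarrow> integral k f - measure lborel k *\<^sub>R f x)
        \<le> (case y of (x, k) \<Rightarrow> \<kappa> * measure lborel k)"
      by (simp add: y)
  qed
  also have "\<dots> = \<kappa> * (\<Sum>(x,k)\<in>p. measure lborel k)"
    by (simp add: sum_distrib_left case_prod_unfold)
  also have "(\<Sum>(x,k)\<in>p. measure lborel k) = measure lborel (cbox a b)"
    by (rule additive_content_tagged_division[OF p])
  finally show ?thesis .
qed

lemma integrable_tail_small:
  fixes w :: "real^'n \<Rightarrow> real"
  assumes w: "integrable lborel w" and "\<tau> > 0"
  shows "\<exists>a b. (\<integral>x. indicator (- cbox a b) x * w x \<partial>lborel) < \<tau>"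
proof -
  let ?Q = "\<lambda>i::nat. cbox (- (\<chi> j. real i)) (\<chi> j. real i) :: (real^'n) set"
  have [measurable]: "w \<in> borel_measurable borel" using w by auto
  have "(\<lambda>i. \<integral>x. indicator (- ?Q i) x * w x \<partial>lborel) \<longlonglongrightarrow> (\<integral>x. 0 \<partial>(lborel :: (real^'n) measure))"
  proof (rule integral_dominated_convergence[of _ _ _ "\<lambda>x. \<bar>w x\<bar>"])
    show "integrable lborel (\<lambda>x. \<bar>w x\<bar>)" using w by simp
    show "AE x in lborel. (\<lambda>i. indicator (- ?Q i) x * w x) \<longlonglongrightarrow> 0"
    proof (rule AE_I2)
      fix x :: "real^'n"
      obtain n :: nat where n: "norm x \<le> real n" using real_arch_simple by blast
      have "\<forall>\<^sub>F i in sequentially. indicator (- ?Q i) x * w x = 0"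
        using eventually_ge_at_top[of n]
      proof eventually_elim
        case (elim i)
        have "\<bar>x $ j\<bar> \<le> real i" for j
          using component_le_norm_cart[of x j] n elim by simp
        then have "x \<in> ?Q i" by (simp add: mem_box_cart abs_le_iff minus_le_iff)
        then show ?case by simp
      qed
      then show "(\<lambda>i. indicator (- ?Q i) x * w x) \<longlonglongrightarrow> 0" by (rule tendsto_eventually)
    qed
    show "AE x in lborel. norm (indicator (- ?Q i) x * w x) \<le> \<bar>w x\<bar>" for i
      by (intro AE_I2) (simp add: indicator_def)
  qed simp_all
  then have "\<forall>\<^sub>F i in sequentially. (\<integral>x. indicator (- ?Q i) x * w x \<partial>lborel) < \<tau>"
    using assms(2) by (simp add: order_tendsto_iff)
  then obtain i where "(\<integral>x. indicator (- ?Q i) x * w x \<partial>lborel) < \<tau>"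
    using eventually_happens'[OF sequentially_bot] by blast
  then show ?thesis by blast
qed

text \<open>The bound depends on \<open>f\<close> only through the majorant \<open>w\<close> and the
  oscillation \<open>\<kappa>\<close>. One tagged division therefore serves a whole family of
  integrands, as needed for an approximation that is uniform over all points and derivatives up to a
  given order.\<close>

lemma integral_riemann_tail:
  fixes f :: "real^'n \<Rightarrow> complex" and w :: "real^'n \<Rightarrow> real"
  assumes f: "continuous_on UNIV f" and w: "integrable lborel w" and fw: "\<And>x. cmod (f x) \<le> w x"
    and p: "p tagged_division_of cbox a b" and fine: "(\<lambda>x. ball x \<delta>) fine p" and \<kappa>: "\<kappa> \<ge> 0"
    and osc: "\<And>x y. x \<in> cbox a b \<Longrightarrow> y \<in> cbox a b \<Longrightarrow> dist x y < \<delta> \<Longrightarrow> norm (f x - f y) \<le> \<kappa>"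
  shows "cmod ((\<integral>x. f x \<partial>lborel) - (\<Sum>(x,k)\<in>p. measure lborel k *\<^sub>R f x))
    \<le> (\<integral>x. indicator (- cbox a b) x * w x \<partial>lborel) + \<kappa> * measure lborel (cbox a b)"
proof -
  have [measurable]: "f \<in> borel_measurable borel" by (rule borel_measurable_continuous_onI[OF f])
  have [measurable]: "w \<in> borel_measurable borel" using w by auto
  have w0: "w x \<ge> 0" for x using order_trans[OF norm_ge_zero fw] .
  have fi: "integrable lborel f"
    by (rule Bochner_Integration.integrable_bound[OF w]) (use fw w0 in auto)
  have i1: "integrable lborel (\<lambda>x. indicator (cbox a b) x *\<^sub>R f x)"
    and i2: "integrable lborel (\<lambda>x. indicator (- cbox a b) x *\<^sub>R f x)"
    using fi by (auto intro!: integrable_mult_indicator)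
  have i3: "integrable lborel (\<lambda>x. indicator (- cbox a b) x * w x)"
    using integrable_mult_indicator[of "- cbox a b" lborel w] w by simp
  have "(\<integral>x. f x \<partial>lborel) = (\<integral>x. indicator (cbox a b) x *\<^sub>R f x + indicator (- cbox a b) x *\<^sub>R f x \<partial>lborel)"
    by (intro Bochner_Integration.integral_cong) (auto simp: indicator_def)
  also have "\<dots> = (\<integral>x. indicator (cbox a b) x *\<^sub>R f x \<partial>lborel)
      + (\<integral>x. indicator (- cbox a b) x *\<^sub>R f x \<partial>lborel)"
    by (rule Bochner_Integration.integral_add[OF i1 i2])
  also have "(\<integral>x. indicator (cbox a b) x *\<^sub>R f x \<partial>lborel) = integral (cbox a b) f"
    using set_borel_integral_eq_integral(2)[of "cbox a b" f] i1
    by (simp add: set_lebesgue_integral_def set_integrable_def)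
  finally have eq: "(\<integral>x. f x \<partial>lborel) - (\<Sum>(x,k)\<in>p. measure lborel k *\<^sub>R f x)
    = (\<integral>x. indicator (- cbox a b) x *\<^sub>R f x \<partial>lborel) + (integral (cbox a b) f
        - (\<Sum>(x,k)\<in>p. measure lborel k *\<^sub>R f x))"
    by simp
  have "cmod (\<integral>x. indicator (- cbox a b) x *\<^sub>R f x \<partial>lborel)
      \<le> (\<integral>x. norm (indicator (- cbox a b) x *\<^sub>R f x) \<partial>lborel)"
    by (rule integral_norm_bound)
  also have "\<dots> \<le> (\<integral>x. indicator (- cbox a b) x * w x \<partial>lborel)"
    using fw by (intro integral_mono integrable_norm i2 i3) (auto simp: indicator_def)
  finally have 1: "cmod (\<integral>x. indicator (- cbox a b) x *\<^sub>R f x \<partial>lborel)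
      \<le> (\<integral>x. indicator (- cbox a b) x * w x \<partial>lborel)" .
  have 2: "cmod (integral (cbox a b) f - (\<Sum>(x,k)\<in>p. measure lborel k *\<^sub>R f x))
      \<le> \<kappa> * measure lborel (cbox a b)"
    by (rule riemann_sum_approx[OF continuous_on_subset[OF f] p fine \<kappa> osc]) auto
  show ?thesis unfolding eq by (rule order_trans[OF norm_triangle_ineq add_mono[OF 1 2]])
qed

section \<open>Correlations of a functional with a test function\<close>

lemma translate_test_function:
  assumes "\<rho> \<in> test_functions W" and r: "\<And>\<xi>. norm \<xi> > r \<Longrightarrow> \<rho> \<xi> = 0" and "cball \<eta> r \<subseteq> W'"
  shows "(\<lambda>\<xi>. \<rho> (\<xi> - \<eta>)) \<in> test_functions W'"
proof (rule test_functionsI[of _ "cball \<eta> r"])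
  show "smooth_fun (\<lambda>\<xi>. \<rho> (\<xi> - \<eta>))"
    by (rule multi_deriv_translate(2)[OF test_functions_smooth[OF assms(1)]])
  show "\<rho> (\<xi> - \<eta>) = 0" if "\<xi> \<notin> cball \<eta> r" for \<xi>
    using that by (intro r) (simp add: dist_norm norm_minus_commute)
qed (use assms in auto)

lemma translate_in_H_space:
  assumes "\<rho> \<in> test_functions W" shows "(\<lambda>\<xi>. \<rho> (\<xi> - \<eta>)) \<in> H_space \<O>"
proof -
  obtain r where r: "r > 0" "\<And>\<alpha> \<xi>. norm \<xi> > r \<Longrightarrow> multi_deriv \<alpha> \<rho> \<xi> = 0"
    using test_function_bounded_support[OF assms] by metis
  show ?thesis
    by (rule test_function_in_H_space, rule translate_test_function[OF assms,
        of r _ UNIV]) (use r(2)[of _ "[]"] in auto)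
qed

lemma correlation_vanishes:
  assumes V: "V \<in> H_dual \<O>" and "\<rho> \<in> test_functions W"
    and "\<And>\<xi>. norm \<xi> > r \<Longrightarrow> \<rho> \<xi> = 0" and "\<And>\<xi>. \<xi> \<in> dist_support V \<Longrightarrow> norm (\<xi> - \<eta>) > r"
  shows "V (\<lambda>\<xi>. \<rho> (\<xi> - \<eta>)) = 0"
  by (rule vanish_off_dist_support[OF V], rule translate_test_function[OF assms(2,3)])
    (use assms(4) in \<open>auto simp: dist_norm norm_minus_commute not_le[symmetric]\<close>)

text \<open>The exponential growth rate of a correlation depends on \<open>V\<close>, and the
  weights on \<open>K\<close>; integrability against every exponential covers all of them.\<close>

definition rapid :: "(real^'n \<Rightarrow> complex) \<Rightarrow> bool" where
  "rapid \<phi> \<longleftrightarrow> continuous_on UNIV \<phi> \<and> (\<forall>R. integrable lborel (\<lambda>\<eta>. exp (R * norm \<eta>) * cmod (\<phi> \<eta>)))"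

lemma rapid_integrable: "rapid \<phi> \<Longrightarrow> integrable lborel \<phi>"
proof -
  assume \<phi>: "rapid \<phi>"
  then have "integrable lborel (\<lambda>\<eta>. exp (0 * norm \<eta>) * cmod (\<phi> \<eta>))" unfolding rapid_def by blast
  moreover have "\<phi> \<in> borel_measurable borel"
    using \<phi> by (intro borel_measurable_continuous_onI) (simp add: rapid_def)
  ultimately show ?thesis by (simp add: integrable_norm_iff)
qed

text \<open>The scalar \<open>s\<close> stands for the weight
  \<open>exp (support_fun K \<xi>)\<close>, and \<open>B\<close> and \<open>R\<close> are those of
  \<open>translate_bounds\<close>.\<close>

lemma norm_conv_le:
  assumes \<phi>: "rapid \<phi>" and \<rho>: "\<rho> \<in> test_functions W" and s: "s \<ge> 0"
    and le: "\<And>\<eta>. s * cmod (\<rho> (\<xi> - \<eta>)) \<le> B * exp (R * norm \<eta>)"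
  shows "s * cmod (conv \<phi> \<rho> \<xi>) \<le> B * (\<integral>\<eta>. exp (R * norm \<eta>) * cmod (\<phi> \<eta>) \<partial>lborel)"
proof -
  have i: "integrable lborel (\<lambda>\<eta>. \<phi> \<eta> * \<rho> (\<xi> - \<eta>))"
    by (rule integrable_conv[OF rapid_integrable[OF \<phi>] \<rho>])
  have w: "integrable lborel (\<lambda>\<eta>. exp (R * norm \<eta>) * cmod (\<phi> \<eta>))"
    using \<phi> by (simp add: rapid_def)
  have "s * cmod (conv \<phi> \<rho> \<xi>) \<le> s * (\<integral>\<eta>. cmod (\<phi> \<eta> * \<rho> (\<xi> - \<eta>)) \<partial>lborel)"
    unfolding conv_def by (intro mult_left_mono s integral_norm_bound)
  also have "\<dots> = (\<integral>\<eta>. s * cmod (\<phi> \<eta> * \<rho> (\<xi> - \<eta>)) \<partial>lborel)" by simp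
  also have "\<dots> \<le> (\<integral>\<eta>. B * (exp (R * norm \<eta>) * cmod (\<phi> \<eta>)) \<partial>lborel)"
  proof (intro integral_mono integrable_mult_right integrable_norm i w)
    fix \<eta>
    show "s * cmod (\<phi> \<eta> * \<rho> (\<xi> - \<eta>)) \<le> B * (exp (R * norm \<eta>) * cmod (\<phi> \<eta>))"
      using mult_right_mono[OF le[of \<eta>], of "cmod (\<phi> \<eta>)"] by (simp add: norm_mult mult_ac)
  qed
  finally show ?thesis by simp
qed

lemma conv_in_H_space:
  fixes \<rho> :: "real^'n \<Rightarrow> complex"
  assumes \<phi>: "rapid \<phi>" and \<rho>: "\<rho> \<in> test_functions W"
  shows "conv \<phi> \<rho> \<in> H_space \<O>"
  unfolding H_space_def
proof (intro INT_I HbI)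
  note md = multi_deriv_conv[OF rapid_integrable[OF \<phi>] \<rho>]
  show "smooth_fun (conv \<phi> \<rho>)" by (rule md)
  fix K and \<alpha> :: "'n list" assume K: "K \<in> convex_compacts \<O>"
  obtain R B where B': "\<forall>\<beta> \<xi> \<eta>. length \<beta> \<le> length \<alpha> \<longrightarrow>
      exp (support_fun K \<xi>) * cmod (multi_deriv \<beta> \<rho> (\<xi> - \<eta>)) \<le> B * exp (R * norm \<eta>)"
    using translate_bounds[OF \<rho> K, of "length \<alpha>"] by (elim exE conjE)
  have B: "exp (support_fun K \<xi>) * cmod (multi_deriv \<alpha> \<rho> (\<xi> - \<eta>)) \<le> B * exp (R * norm \<eta>)" for \<xi> \<eta>
    using B' by blast
  have "weighted K \<alpha> (conv \<phi> \<rho>) \<xi>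
      \<le> B * (\<integral>\<eta>. exp (R * norm \<eta>) * cmod (\<phi> \<eta>) \<partial>lborel)" for \<xi>
    unfolding md(1) by (rule norm_conv_le[OF \<phi> test_functions_multi_deriv[OF \<rho>]]) (auto intro: B)
  then show "\<exists>B. \<forall>\<xi>. weighted K \<alpha> (conv \<phi> \<rho>) \<xi> \<le> B" by blast
qed

lemma scale_le_half:
  fixes \<kappa> x :: real
  assumes "\<kappa> > 0" "x \<ge> 0"
  shows "0 < \<kappa> / (2 * (x + 1))" "x * (\<kappa> / (2 * (x + 1))) \<le> \<kappa> / 2"
  using assms by (auto simp: field_simps)

text \<open>\<open>V\<close> passes under the integral because Riemann sums over a large box approximate the convolution in
  the seminorm that bounds \<open>V\<close>, the contribution from outside the box being uniformly small.\<close>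

lemma correlation_properties:
  fixes V :: "(real^'n \<Rightarrow> complex) \<Rightarrow> complex"
  assumes V: "V \<in> H_dual \<O>" and \<O>: "convex \<O>" "0 \<in> \<O>" and \<rho>: "\<rho> \<in> test_functions W"
  defines "b \<equiv> \<lambda>\<eta>. V (\<lambda>\<xi>. \<rho> (\<xi> - \<eta>))"
  shows "\<exists>R C. \<forall>\<eta>. cmod (b \<eta>) \<le> C * exp (R * norm \<eta>)"
    and "continuous_on UNIV b"
    and "rapid \<phi> \<Longrightarrow> V (conv \<phi> \<rho>) = (\<integral>\<eta>. \<phi> \<eta> * b \<eta> \<partial>lborel)"
proof -
  obtain K N M where K: "K \<in> convex_compacts \<O>" and M: "M \<ge> (0::real)" and bound:
    "\<forall>\<phi>\<in>H_space \<O>. \<forall>B. (\<forall>\<xi> \<alpha>. length \<alpha> \<le> N \<longrightarrow> weighted K \<alpha> \<phi> \<xi> \<le> B)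
      \<longrightarrow> cmod (V \<phi>) \<le> M * B"
    using H_dual_bound[OF V \<O>] by blast
  obtain R B L where R: "R > 0" and B: "B \<ge> 0" and L: "L \<ge> 0" and
    tb: "\<forall>\<alpha> \<xi> \<eta>. length \<alpha> \<le> N \<longrightarrow> exp (support_fun K \<xi>) * cmod (multi_deriv \<alpha> \<rho> (\<xi> - \<eta>))
        \<le> B * exp (R * norm \<eta>)" and
    tl: "\<forall>\<alpha> \<xi> \<eta> \<eta>' T. length \<alpha> \<le> N \<longrightarrow> norm \<eta> \<le> T \<longrightarrow> norm \<eta>' \<le> T \<longrightarrow>
      exp (support_fun K \<xi>) * cmod (multi_deriv \<alpha> \<rho> (\<xi> - \<eta>) - multi_deriv \<alpha> \<rho> (\<xi> - \<eta>'))
          \<le> L * exp (R * T) * norm (\<eta> - \<eta>')"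
    using translate_bounds[OF \<rho> K, of N] by (elim exE conjE)
  note s = test_functions_smooth[OF \<rho>]
  note md = multi_deriv_translate[OF s]
  note H = translate_in_H_space[OF \<rho>]
  have bb: "cmod (b \<eta>) \<le> M * B * exp (R * norm \<eta>)" for \<eta>
    unfolding b_def mult.assoc
    by (rule bound[rule_format, OF H]) (simp add: md tb)
  then show "\<exists>R C. \<forall>\<eta>. cmod (b \<eta>) \<le> C * exp (R * norm \<eta>)" by blast
  have bl: "cmod (b \<eta> - b \<eta>') \<le> M * (L * exp (R * T) * norm (\<eta> - \<eta>'))" if "norm \<eta> \<le> T" "norm \<eta>' \<le> T"
      for \<eta> \<eta>' T
  proof -
    have "b \<eta> - b \<eta>' = V (\<lambda>\<xi>. \<rho> (\<xi> - \<eta>) - \<rho> (\<xi> - \<eta>'))"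
      unfolding b_def by (rule H_dual_diff[OF V H H, symmetric])
    moreover have "cmod (V (\<lambda>\<xi>. \<rho> (\<xi> - \<eta>) - \<rho> (\<xi> - \<eta>'))) \<le> M * (L * exp (R * T) * norm (\<eta> - \<eta>'))"
      by (rule bound[rule_format, OF H_space_diff[OF H H]]) (simp add: multi_deriv_diff[OF md(2) md(2)]
          md(1) tl that)
    ultimately show ?thesis by simp
  qed
  show bc: "continuous_on UNIV b"
  proof (intro continuous_at_imp_continuous_on ballI)
    fix \<eta>0 :: "real^'n"
    let ?c = "M * (L * exp (R * (norm \<eta>0 + 1)))"
    have c0: "?c \<ge> 0" using M L by simp
    show "isCont b \<eta>0"
      unfolding continuous_at_eps_delta
    proof (intro allI impI)
      fix e :: real assume e: "e > 0"
      show "\<exists>d>0. \<forall>x'. dist x' \<eta>0 < d \<longrightarrow> dist (b x') (b \<eta>0) < e"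
      proof (intro exI[of _ "min 1 (e / (?c + 1))"] conjI allI impI)
        show "min 1 (e / (?c + 1)) > 0" using e c0 by simp
        fix \<eta> assume d: "dist \<eta> \<eta>0 < min 1 (e / (?c + 1))"
        have "norm \<eta> \<le> norm \<eta>0 + 1"
          using d norm_triangle_sub[of \<eta> \<eta>0] by (simp add: dist_norm)
        then have "dist (b \<eta>) (b \<eta>0) \<le> ?c * dist \<eta> \<eta>0"
          using bl[of \<eta> "norm \<eta>0 + 1" \<eta>0] by (simp add: dist_norm mult.assoc)
        also have "\<dots> \<le> ?c * (e / (?c + 1))"
          using d c0 by (intro mult_left_mono) auto
        also have "\<dots> < e" using e c0 by (simp add: field_simps)
        finally show "dist (b \<eta>) (b \<eta>0) < e" .
      qed
    qed
  qed
  assume \<phi>: "rapid \<phi>"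
  have \<phi>c: "continuous_on UNIV \<phi>" using \<phi> by (simp add: rapid_def)
  define w where "w = (\<lambda>\<eta>. exp (R * norm \<eta>) * cmod (\<phi> \<eta>))"
  have w: "integrable lborel w" unfolding w_def using \<phi> by (simp add: rapid_def)
  note mdc = multi_deriv_conv[OF rapid_integrable[OF \<phi>] \<rho>]
  \<comment> \<open>One Riemann sum \<open>\<sigma>\<close> of translates is compared with both
    sides: with \<open>conv \<phi> \<rho>\<close> in the seminorm that bounds \<open>V\<close>, and
    through \<open>V \<sigma>\<close>, a Riemann sum of the scalar integrand, with the integral.
    Each comparison costs a tail error and an oscillation error, whence the constant.\<close>
  have approx: "cmod (V (conv \<phi> \<rho>) - (\<integral>\<eta>. \<phi> \<eta> * b \<eta> \<partial>lborel)) \<le> (2 * M * B + (M + 1)) * \<tau>" if \<tau>: "\<tau> > 0" for \<tau>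
  proof -
    obtain a c where tail: "(\<integral>x. indicator (- cbox a c) x * w x \<partial>lborel) < \<tau>"
      using integrable_tail_small[OF w \<tau>] by blast
    define m where "m = measure lborel (cbox a c)"
    have m: "m \<ge> 0" by (simp add: m_def)
    \<comment> \<open>The oscillation error is multiplied by the volume \<open>m\<close> of the box;
      the added \<open>1\<close> allows for a box of volume \<open>0\<close>.\<close>
    define \<kappa> where "\<kappa> = \<tau> / (m + 1)"
    have \<kappa>: "\<kappa> > 0" "\<kappa> * m \<le> \<tau>" using \<tau> m by (auto simp: \<kappa>_def field_simps)
    obtain T where T: "T > 0" "\<And>x. x \<in> cbox a c \<Longrightarrow> norm x \<le> T"
      using compact_norm_bound[OF compact_cbox] by blast
    have "compact (\<phi> ` cbox a c)"
      by (intro compact_continuous_image continuous_on_subset[OF \<phi>c] compact_cbox) simp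
    then obtain P where P: "P > 0" "\<And>y. y \<in> \<phi> ` cbox a c \<Longrightarrow> norm y \<le> P"
      using compact_norm_bound by metis
    \<comment> \<open>\<open>\<kappa>1\<close> and, further down, \<open>d3\<close> each keep one of
      the two terms in the splitting of \<open>f x - f y\<close> below \<open>\<kappa> / 2\<close>.
      The added \<open>1\<close> keeps the denominators positive.\<close>
    define \<kappa>1 where "\<kappa>1 = \<kappa> / (2 * (B * exp (R * T) + 1))"
    have \<kappa>1: "\<kappa>1 > 0" "\<kappa>1 * (B * exp (R * T)) \<le> \<kappa> / 2"
    proof -
      have "B * exp (R * T) \<ge> 0" using B by simp
      from scale_le_half[OF \<kappa>(1) this]
      show "\<kappa>1 > 0" "\<kappa>1 * (B * exp (R * T)) \<le> \<kappa> / 2" by (auto simp: \<kappa>1_def mult.commute)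
    qed
    have "uniformly_continuous_on (cbox a c) \<phi>"
      by (intro compact_uniformly_continuous continuous_on_subset[OF \<phi>c] compact_cbox) simp
    then obtain d1 where d1: "d1 > 0" "\<And>x y. x \<in> cbox a c \<Longrightarrow> y \<in> cbox a c \<Longrightarrow> dist x y < d1
        \<Longrightarrow> dist (\<phi> x) (\<phi> y) < \<kappa>1"
      unfolding uniformly_continuous_on_def using \<kappa>1(1) by meson
    have "uniformly_continuous_on (cbox a c) (\<lambda>\<eta>. \<phi> \<eta> * b \<eta>)"
      by (intro compact_uniformly_continuous continuous_intros continuous_on_subset[OF \<phi>c]
          continuous_on_subset[OF bc] compact_cbox) simp_all
    then obtain d2 where d2: "d2 > 0" "\<And>x y. x \<in> cbox a c \<Longrightarrow> y \<in> cbox a c \<Longrightarrow> dist x y < d2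
        \<Longrightarrow> dist (\<phi> x * b x) (\<phi> y * b y) < \<kappa>"
      unfolding uniformly_continuous_on_def using \<kappa>(1) by meson
    define d3 where "d3 = \<kappa> / (2 * (P * (L * exp (R * T)) + 1))"
    have d3: "d3 > 0" "P * (L * exp (R * T)) * d3 \<le> \<kappa> / 2"
    proof -
      have "P * (L * exp (R * T)) \<ge> 0" using L P by simp
      from scale_le_half[OF \<kappa>(1) this]
      show "d3 > 0" "P * (L * exp (R * T)) * d3 \<le> \<kappa> / 2" by (auto simp: d3_def)
    qed
    define \<delta> where "\<delta> = min d1 (min d2 d3)"
    have \<delta>: "\<delta> > 0" using d1(1) d2(1) d3(1) by (simp add: \<delta>_def)
    have "gauge (\<lambda>x::real^'n. ball x \<delta>)" using \<delta> by (simp add: gauge_def)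
    then obtain p where p: "p tagged_division_of cbox a c" and fine: "(\<lambda>x. ball x \<delta>) fine p"
      using fine_division_exists by metis
    define \<sigma> where "\<sigma> = (\<lambda>\<xi>. \<Sum>q\<in>p. (of_real (measure lborel (snd q)) * \<phi> (fst q)) * \<rho> (\<xi> - fst q))"
    have \<sigma>H: "\<sigma> \<in> H_space \<O>" and V\<sigma>: "V \<sigma> = (\<Sum>(x,k)\<in>p. measure lborel k *\<^sub>R (\<phi> x * b x))"
    proof -
      have h: "(\<lambda>\<xi>. (of_real (measure lborel (snd q)) * \<phi> (fst q)) * \<rho> (\<xi> - fst q)) \<in> H_space \<O>" for q
        by (rule H_space_cmult[OF H])
      show "\<sigma> \<in> H_space \<O>" unfolding \<sigma>_def by (rule H_dual_sum(2)[OF V h])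
      have "V \<sigma> = (\<Sum>q\<in>p. V (\<lambda>\<xi>. (of_real (measure lborel (snd q)) * \<phi> (fst q)) * \<rho> (\<xi> - fst q)))"
        unfolding \<sigma>_def by (rule H_dual_sum(1)[OF V h])
      then show "V \<sigma> = (\<Sum>(x,k)\<in>p. measure lborel k *\<^sub>R (\<phi> x * b x))"
        unfolding H_dual_cmult[OF V H] b_def by (simp add: case_prod_unfold scaleR_conv_of_real mult.assoc)
    qed
    have convH: "conv \<phi> \<rho> \<in> H_space \<O>" by (rule conv_in_H_space[OF \<phi> \<rho>])
    have "cmod (V (\<lambda>\<xi>. conv \<phi> \<rho> \<xi> - \<sigma> \<xi>)) \<le> M * (B * \<tau> + \<kappa> * m)"
    proof (rule bound[rule_format, OF H_space_diff[OF convH \<sigma>H]])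
      fix \<xi> and \<alpha> :: "'n list" assume \<alpha>: "length \<alpha> \<le> N"
      define E where "E = exp (support_fun K \<xi>)"
      have E: "E > 0" by (simp add: E_def)
      define g where "g = multi_deriv \<alpha> \<rho>"
      have gc: "continuous_on UNIV (\<lambda>\<eta>. g (\<xi> - \<eta>))"
        unfolding g_def
        by (intro continuous_on_compose2[OF smooth_fun_continuous[OF smooth_fun_multi_deriv[OF s]]]
            continuous_intros) auto
      \<comment> \<open>The weight is moved into the integrand. The majorant \<open>B * w\<close>
        and the oscillation \<open>\<kappa>\<close> then depend neither on \<open>\<xi>\<close> nor
        on \<open>\<alpha>\<close>, so the division \<open>p\<close>, fixed beforehand, works for
        all of them.\<close>
      define f where "f = (\<lambda>\<eta>. of_real E * (\<phi> \<eta> * g (\<xi> - \<eta>)))"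
      have fc: "continuous_on UNIV f" unfolding f_def by (intro continuous_intros \<phi>c gc)
      have Eg: "E * cmod (g (\<xi> - \<eta>)) \<le> B * exp (R * norm \<eta>)" for \<eta>
        unfolding E_def g_def using tb \<alpha> by blast
      have fw: "cmod (f \<eta>) \<le> B * w \<eta>" for \<eta>
        using mult_right_mono[OF Eg[of \<eta>], of "cmod (\<phi> \<eta>)"] E by (simp add: f_def w_def norm_mult mult_ac)
      have osc: "cmod (f x - f y) \<le> \<kappa>" if xy: "x \<in> cbox a c" "y \<in> cbox a c" "dist x y < \<delta>" for x y
      proof -
        have n: "norm x \<le> T" "norm y \<le> T" using T xy by auto
        have "f x - f y = (\<phi> x - \<phi> y) * (of_real E * g (\<xi> - x)) + \<phi> y * (of_real E * (g (\<xi> - x) - g (\<xi> - y)))"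
          by (simp add: f_def algebra_simps)
        then have "cmod (f x - f y) \<le> cmod (\<phi> x - \<phi> y) * (E * cmod (g (\<xi> - x))) + cmod (\<phi> y) * (E
            * cmod (g (\<xi> - x) - g (\<xi> - y)))"
          using norm_triangle_ineq[of "(\<phi> x - \<phi> y) * (of_real E * g (\<xi> - x))" "\<phi> y * (of_real E * (g (\<xi>
              - x) - g (\<xi> - y)))"] E
          by (simp add: norm_mult)
        also have "\<dots> \<le> \<kappa>1 * (B * exp (R * T)) + P * (L * exp (R * T) * d3)"
        proof (rule add_mono[OF mult_mono mult_mono])
          show "cmod (\<phi> x - \<phi> y) \<le> \<kappa>1" using d1(2)[OF xy(1,2)] xy(3) by (simp add: \<delta>_def dist_norm)
          have "exp (R * norm x) \<le> exp (R * T)" using n R by simp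
          then show "E * cmod (g (\<xi> - x)) \<le> B * exp (R * T)"
            using Eg[of x] B by (meson mult_left_mono order_trans)
          show "cmod (\<phi> y) \<le> P" using P(2) xy by blast
          have "E * cmod (g (\<xi> - x) - g (\<xi> - y)) \<le> L * exp (R * T) * norm (x - y)"
            unfolding E_def g_def using tl \<alpha> n by blast
          also have "\<dots> \<le> L * exp (R * T) * d3"
            using L xy(3) by (intro mult_left_mono) (auto simp: \<delta>_def dist_norm)
          finally show "E * cmod (g (\<xi> - x) - g (\<xi> - y)) \<le> L * exp (R * T) * d3" .
        qed (use \<kappa>1 E P in auto)
        also have "\<dots> \<le> \<kappa> / 2 + \<kappa> / 2" using \<kappa>1(2) d3(2) by (intro add_mono) (auto simp: mult.assoc)
        finally show ?thesis by simp
      qed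
      have "cmod ((\<integral>x. f x \<partial>lborel) - (\<Sum>(x,k)\<in>p. measure lborel k *\<^sub>R f x))
        \<le> (\<integral>x. indicator (- cbox a c) x * (B * w x) \<partial>lborel) + \<kappa> * measure lborel (cbox a c)"
        using w by (intro integral_riemann_tail[OF fc _ fw p fine _ osc] integrable_mult_right) (use \<kappa>
            in auto)
      also have "(\<integral>x. indicator (- cbox a c) x * (B * w x) \<partial>lborel)
          = B * (\<integral>x. indicator (- cbox a c) x * w x \<partial>lborel)"
        by (subst integral_mult_right_zero[symmetric]) (simp add: mult.left_commute)
      also have "B * (\<integral>x. indicator (- cbox a c) x * w x \<partial>lborel) + \<kappa> * measure lborel (cbox a c)
          \<le> B * \<tau> + \<kappa> * m"
        using tail B \<kappa>(1) by (intro add_mono mult_left_mono) (auto simp: m_def)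
      finally have main: "cmod ((\<integral>x. f x \<partial>lborel) - (\<Sum>(x,k)\<in>p. measure lborel k *\<^sub>R f x)) \<le> B * \<tau> + \<kappa> * m" .
      have "(\<integral>x. f x \<partial>lborel) = of_real E * multi_deriv \<alpha> (conv \<phi> \<rho>) \<xi>"
        by (simp add: f_def mdc(1) conv_def g_def)
      moreover have "(\<Sum>(x,k)\<in>p. measure lborel k *\<^sub>R f x) = of_real E * multi_deriv \<alpha> \<sigma> \<xi>"
      proof -
        have "multi_deriv \<alpha> \<sigma> = (\<lambda>\<xi>. \<Sum>q\<in>p. (of_real (measure lborel (snd q)) * \<phi> (fst q))
            * multi_deriv \<alpha> \<rho> (\<xi> - fst q))"
          unfolding \<sigma>_def by (simp add: multi_deriv_sum smooth_fun_cmult md multi_deriv_cmult)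
        then show ?thesis
          by (simp add: f_def g_def case_prod_unfold sum_distrib_left scaleR_conv_of_real mult_ac)
      qed
      moreover have "smooth_fun \<sigma>" unfolding \<sigma>_def by (intro smooth_fun_sum smooth_fun_cmult md(2))
      ultimately have "cmod ((\<integral>x. f x \<partial>lborel) - (\<Sum>(x,k)\<in>p. measure lborel k *\<^sub>R f x))
          = E * cmod (multi_deriv \<alpha> (\<lambda>\<xi>. conv \<phi> \<rho> \<xi> - \<sigma> \<xi>) \<xi>)"
        using E by (simp add: multi_deriv_diff[OF mdc(2)] right_diff_distrib[symmetric] norm_mult)
      then show "weighted K \<alpha> (\<lambda>\<xi>. conv \<phi> \<rho> \<xi> - \<sigma> \<xi>) \<xi> \<le> B * \<tau> + \<kappa> * m"
        using main by (simp add: E_def)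
    qed
    then have 1: "cmod (V (conv \<phi> \<rho>) - V \<sigma>) \<le> M * (B * \<tau> + \<kappa> * m)"
      by (simp add: H_dual_diff[OF V convH \<sigma>H])
    have bw: "cmod (\<phi> \<eta> * b \<eta>) \<le> M * B * w \<eta>" for \<eta>
      using mult_left_mono[OF bb[of \<eta>], of "cmod (\<phi> \<eta>)"] by (simp add: w_def norm_mult mult_ac)
    have "cmod ((\<integral>x. \<phi> x * b x \<partial>lborel) - (\<Sum>(x,k)\<in>p. measure lborel k *\<^sub>R (\<phi> x * b x)))
        \<le> (\<integral>x. indicator (- cbox a c) x * (M * B * w x) \<partial>lborel) + \<kappa> * measure lborel (cbox a c)"
    proof (rule integral_riemann_tail[OF _ _ bw p fine])
      show "continuous_on UNIV (\<lambda>x. \<phi> x * b x)" by (intro continuous_intros \<phi>c bc)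
      show "integrable lborel (\<lambda>x. M * B * w x)" using w by simp
      show "norm (\<phi> x * b x - \<phi> y * b y) \<le> \<kappa>" if "x \<in> cbox a c" "y \<in> cbox a c" "dist x y < \<delta>" for x y
        using d2(2)[OF that(1,2)] that(3) by (simp add: \<delta>_def dist_norm)
    qed (use \<kappa> in simp)
    also have "(\<integral>x. indicator (- cbox a c) x * (M * B * w x) \<partial>lborel)
        = M * B * (\<integral>x. indicator (- cbox a c) x * w x \<partial>lborel)"
      by (subst integral_mult_right_zero[symmetric]) (simp add: mult.left_commute)
    also have "M * B * (\<integral>x. indicator (- cbox a c) x * w x \<partial>lborel) + \<kappa> * measure lborel (cbox a c)
        \<le> M * B * \<tau> + \<kappa> * m"
      using tail B M \<kappa>(1) by (intro add_mono mult_left_mono) (auto simp: m_def)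
    finally have 2: "cmod ((\<integral>x. \<phi> x * b x \<partial>lborel) - V \<sigma>) \<le> M * B * \<tau> + \<kappa> * m"
      by (simp add: V\<sigma>)
    have "cmod (V (conv \<phi> \<rho>) - (\<integral>\<eta>. \<phi> \<eta> * b \<eta> \<partial>lborel)) \<le> M * (B * \<tau> + \<kappa> * m) + (M * B * \<tau> + \<kappa> * m)"
      using norm_triangle_ineq4[of "V (conv \<phi> \<rho>) - V \<sigma>" "(\<integral>x. \<phi> x * b x \<partial>lborel) - V \<sigma>"] 1 2 by simp
    also have "\<dots> \<le> M * (B * \<tau> + \<tau>) + (M * B * \<tau> + \<tau>)"
      using \<kappa>(2) M B by (intro add_mono mult_left_mono) auto
    also have "\<dots> = (2 * M * B + (M + 1)) * \<tau>" by (simp add: algebra_simps)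
    finally show ?thesis .
  qed
  have "cmod (V (conv \<phi> \<rho>) - (\<integral>\<eta>. \<phi> \<eta> * b \<eta> \<partial>lborel)) \<le> 0"
  proof (rule field_le_epsilon)
    fix e :: real assume e: "e > 0"
    have c: "2 * M * B + (M + 1) > 0" using M B by (simp add: add_nonneg_pos)
    then have "e / (2 * M * B + (M + 1)) > 0" using e by simp
    from approx[OF this] c show "cmod (V (conv \<phi> \<rho>) - (\<integral>\<eta>. \<phi> \<eta> * b \<eta> \<partial>lborel)) \<le> 0 + e" by simp
  qed
  then show "V (conv \<phi> \<rho>) = (\<integral>\<eta>. \<phi> \<eta> * b \<eta> \<partial>lborel)" by simp
qed

section \<open>Gaussian test functions and carriers\<close>

definition re_vec :: "complex^'n \<Rightarrow> real^'n" where "re_vec z = (\<chi> i. Re (z $ i))"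
definition im_vec :: "complex^'n \<Rightarrow> real^'n" where "im_vec z = (\<chi> i. Im (z $ i))"

lemma tube_iff: "z \<in> tube A \<longleftrightarrow> im_vec z \<in> A"
  by (simp add: tube_def im_vec_def)

lemma re_im_vec_diff: "re_vec (z - w) = re_vec z - re_vec w" "im_vec (z - w) = im_vec z - im_vec w"
  by (simp_all add: re_vec_def im_vec_def vec_eq_iff)

lemma re_im_vec_cvec [simp]: "re_vec (cvec x) = x" "im_vec (cvec x) = 0"
  by (simp_all add: re_vec_def im_vec_def cvec_def vec_eq_iff)

lemma norm_re_im_vec:
  fixes z :: "complex^'n"
  shows "(norm z)\<^sup>2 = (norm (re_vec z))\<^sup>2 + (norm (im_vec z))\<^sup>2"
proof -
  have "(norm z)\<^sup>2 = (\<Sum>i\<in>UNIV. (cmod (z $ i))\<^sup>2)" for z :: "complex^'n"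
    by (simp add: norm_vec_def L2_set_def sum_nonneg)
  moreover have "(norm x)\<^sup>2 = (\<Sum>i\<in>UNIV. (x $ i)\<^sup>2)" for x :: "real^'n"
    by (simp add: norm_vec_def L2_set_def sum_nonneg)
  ultimately show ?thesis
    by (simp add: re_vec_def im_vec_def cmod_power2 sum.distrib)
qed

lemma norm_re_vec_le: "norm (re_vec z) \<le> norm z" and norm_im_vec_le: "norm (im_vec z) \<le> norm z"
  using norm_re_im_vec[of z] by (auto intro: power2_le_imp_le)

lemma norm_le_re_im: "norm z \<le> norm (re_vec z) + norm (im_vec z)"
proof (rule power2_le_imp_le)
  show "(norm z)\<^sup>2 \<le> (norm (re_vec z) + norm (im_vec z))\<^sup>2"
    by (simp add: norm_re_im_vec power2_sum)
qed simp

lemma cdot_add_right: "cdot z (v + w) = cdot z v + cdot z w"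
  and cdot_scale_right: "cdot z (c *s v) = c * cdot z v"
  and cdot_scaleR_right: "cdot z (r *\<^sub>R v) = r *\<^sub>R cdot z v"
  by (simp_all add: cdot_def sum.distrib distrib_left sum_distrib_left scaleR_sum_right mult.left_commute)

lemma norm_cdot_le: "cmod (cdot z v) \<le> real CARD('n) * norm z * norm v" for z v :: "complex^'n"
proof -
  have "cmod (cdot z v) \<le> (\<Sum>i\<in>(UNIV::'n set). norm z * norm v)"
    unfolding cdot_def by (intro sum_norm_le) (simp add: norm_mult mult_mono
        Finite_Cartesian_Product.norm_nth_le)
  then show ?thesis by simp
qed

lemma bounded_linear_cdot: "bounded_linear (cdot z)"
  by (rule bounded_linear_intro[of _ "real CARD('n) * norm z"])
    (use norm_cdot_le[of z] in \<open>auto simp: cdot_add_right cdot_scaleR_right mult_ac\<close>)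
  
lemma norm_cvec [simp]: "norm (cvec \<eta>) = norm \<eta>"
  using norm_re_im_vec[of "cvec \<eta>"] by simp

lemma Im_cdot_cvec: "Im (cdot (cvec \<eta>) z) = \<eta> \<bullet> im_vec z"
  by (simp add: cdot_def cvec_def im_vec_def inner_vec_def Im_sum)

lemma cdot_cvec_cvec: "cdot (cvec \<eta>) (cvec x) = of_real (\<eta> \<bullet> x)"
  by (simp add: cdot_def cvec_def inner_vec_def)

lemma continuous_on_cdot_cvec [continuous_intros]: "continuous_on S (\<lambda>\<eta>. cdot (cvec \<eta>) z)"
  unfolding cdot_def cvec_def by (auto intro!: continuous_intros)

lemma norm_exp_cdot_le: "cmod (exp (\<i> * cdot (cvec \<eta>) z)) \<le> exp (norm \<eta> * norm (im_vec z))"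
proof -
  have "\<bar>\<eta> \<bullet> im_vec z\<bar> \<le> norm \<eta> * norm (im_vec z)" by (rule Cauchy_Schwarz_ineq2)
  then show ?thesis by (simp add: Im_cdot_cvec)
qed

section \<open>The Fourier-Laplace transform of a test function\<close>

lemma integrable_test_function_mult:
  fixes u :: "real^'n \<Rightarrow> complex"
  assumes \<rho>: "\<rho> \<in> test_functions W" and u: "continuous_on UNIV u"
  shows "integrable lborel (\<lambda>\<eta>. \<rho> \<eta> * u \<eta>)"
proof -
  let ?L = "closure {\<xi>. \<rho> \<xi> \<noteq> 0}"
  have "continuous_on ?L (\<lambda>\<eta>. \<rho> \<eta> * u \<eta>)"
    by (intro continuous_intros smooth_fun_continuous test_functions_smooth[OF \<rho>]
        continuous_on_subset[OF u]) simp
  then have "integrable lborel (\<lambda>\<eta>. indicator ?L \<eta> *\<^sub>R (\<rho> \<eta> * u \<eta>))"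
    using \<rho> by (intro borel_integrable_compact) (auto simp: test_functions_def)
  moreover have "indicator ?L \<eta> *\<^sub>R (\<rho> \<eta> * u \<eta>) = \<rho> \<eta> * u \<eta>" for \<eta>
    using closure_subset[of "{\<xi>. \<rho> \<xi> \<noteq> 0}"] by (auto simp: indicator_def)
  ultimately show ?thesis by simp
qed

definition fourier_laplace :: "(real^'n \<Rightarrow> complex) \<Rightarrow> complex^'n \<Rightarrow> complex" where
  "fourier_laplace \<rho> z = (\<integral>\<eta>. \<rho> \<eta> * exp (\<i> * cdot (cvec \<eta>) z) \<partial>lborel)"

lemma has_derivative_cexp:
  fixes f :: "'a::real_normed_vector \<Rightarrow> complex"
  assumes "(f has_derivative f') (at x)"
  shows "((\<lambda>x. exp (f x)) has_derivative (\<lambda>v. exp (f x) * f' v)) (at x)"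
  using has_derivative_compose[OF assms DERIV_exp[unfolded has_field_derivative_def]] .

lemma fourier_laplace_has_derivative:
  fixes \<rho> :: "real^'n \<Rightarrow> complex"
  assumes \<rho>: "\<rho> \<in> test_functions W"
  shows "(fourier_laplace \<rho> has_derivative
    (\<lambda>v. \<integral>\<eta>. \<rho> \<eta> * (exp (\<i> * cdot (cvec \<eta>) z) * (\<i> * cdot (cvec \<eta>) v)) \<partial>lborel)) (at z)"
  unfolding fourier_laplace_def[abs_def]
proof (rule has_derivative_lebesgue_integral[where e=1 and
      F'="\<lambda>z \<eta> v. \<rho> \<eta> * (exp (\<i> * cdot (cvec \<eta>) z) * (\<i> * cdot (cvec \<eta>) v))" and
      B="\<lambda>\<eta>. cmod (\<rho> \<eta> * of_real (exp (norm \<eta> * (norm z + 1)) * (real CARD('n) * norm \<eta>)))"])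
  show "integrable lborel (\<lambda>\<eta>. \<rho> \<eta> * exp (\<i> * cdot (cvec \<eta>) p))" for p
    by (intro integrable_test_function_mult[OF \<rho>] continuous_intros)
  show "((\<lambda>z. \<rho> \<eta> * exp (\<i> * cdot (cvec \<eta>) z)) has_derivative
      (\<lambda>v. \<rho> \<eta> * (exp (\<i> * cdot (cvec \<eta>) p) * (\<i> * cdot (cvec \<eta>) v)))) (at p)" for p \<eta>
    by (intro has_derivative_mult_right has_derivative_cexp bounded_linear_imp_has_derivative
        bounded_linear_cdot)
  show "cmod (\<rho> \<eta> * (exp (\<i> * cdot (cvec \<eta>) p) * (\<i> * cdot (cvec \<eta>) v)))
    \<le> cmod (\<rho> \<eta> * of_real (exp (norm \<eta> * (norm z + 1)) * (real CARD('n) * norm \<eta>)))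
        * norm v" if "p \<in> ball z 1" for p \<eta> v
  proof -
    have "norm p \<le> norm z + 1" using that norm_triangle_sub[of p z]
      by (simp add: dist_norm norm_minus_commute)
    then have "norm (im_vec p) \<le> norm z + 1" using norm_im_vec_le[of p] by linarith
    then have "norm \<eta> * norm (im_vec p) \<le> norm \<eta> * (norm z + 1)" by (intro mult_left_mono) auto
    then have 1: "cmod (exp (\<i> * cdot (cvec \<eta>) p)) \<le> exp (norm \<eta> * (norm z + 1))"
      by (intro order_trans[OF norm_exp_cdot_le]) simp
    have 2: "cmod (\<i> * cdot (cvec \<eta>) v) \<le> real CARD('n) * norm \<eta> * norm v"
      using norm_cdot_le[of "cvec \<eta>" v] by (simp add: norm_mult)
    have "cmod (exp (\<i> * cdot (cvec \<eta>) p)) * cmod (\<i> * cdot (cvec \<eta>) v)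
        \<le> exp (norm \<eta> * (norm z + 1)) * (real CARD('n) * norm \<eta> * norm v)"
      by (rule mult_mono[OF 1 2]) auto
    then have "cmod (\<rho> \<eta>) * (cmod (exp (\<i> * cdot (cvec \<eta>) p)) * cmod (\<i> * cdot (cvec \<eta>) v))
        \<le> cmod (\<rho> \<eta>) * (exp (norm \<eta> * (norm z + 1)) * (real CARD('n) * norm \<eta> * norm v))"
      by (intro mult_left_mono) auto
    then show ?thesis
      unfolding norm_mult norm_of_real abs_mult abs_exp_cancel by (simp add: mult_ac del: norm_exp_eq_Re)
  qed
  show "integrable lborel (\<lambda>\<eta>. cmod (\<rho> \<eta> * of_real (exp (norm \<eta> * (norm z + 1)) * (real CARD('n) * norm \<eta>))))"
    by (intro integrable_norm integrable_test_function_mult[OF \<rho>] continuous_intros)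
  show "(\<lambda>\<eta>. \<rho> \<eta> * (exp (\<i> * cdot (cvec \<eta>) z) * (\<i> * cdot (cvec \<eta>) v))) \<in> borel_measurable lborel" for v
    by (rule borel_measurable_integrable) (intro integrable_test_function_mult[OF \<rho>] continuous_intros)
qed simp

lemma fourier_laplace_bound:
  fixes \<rho> :: "real^'n \<Rightarrow> complex"
  assumes \<rho>: "\<rho> \<in> test_functions W"
  shows "\<exists>B\<ge>0. \<forall>z. norm (im_vec z) \<le> T \<longrightarrow> cmod (fourier_laplace \<rho> z) \<le> B"
proof (intro exI conjI allI impI)
  let ?B = "\<integral>\<eta>. cmod (\<rho> \<eta> * of_real (exp (norm \<eta> * T))) \<partial>lborel"
  show "0 \<le> ?B" by simp
  fix z :: "complex^'n" assume z: "norm (im_vec z) \<le> T"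
  have "cmod (fourier_laplace \<rho> z) \<le> (\<integral>\<eta>. cmod (\<rho> \<eta> * exp (\<i> * cdot (cvec \<eta>) z)) \<partial>lborel)"
    unfolding fourier_laplace_def by (rule integral_norm_bound)
  also have "\<dots> \<le> ?B"
  proof (rule integral_mono)
    show "integrable lborel (\<lambda>\<eta>. cmod (\<rho> \<eta> * exp (\<i> * cdot (cvec \<eta>) z)))"
      by (intro integrable_norm integrable_test_function_mult[OF \<rho>] continuous_intros)
    show "integrable lborel (\<lambda>\<eta>. cmod (\<rho> \<eta> * of_real (exp (norm \<eta> * T))))"
      by (intro integrable_norm integrable_test_function_mult[OF \<rho>] continuous_intros)
    fix \<eta> :: "real^'n"
    have "norm \<eta> * norm (im_vec z) \<le> norm \<eta> * T" using z by (intro mult_left_mono) auto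
    then have "cmod (exp (\<i> * cdot (cvec \<eta>) z)) \<le> exp (norm \<eta> * T)"
      by (intro order_trans[OF norm_exp_cdot_le]) simp
    then show "cmod (\<rho> \<eta> * exp (\<i> * cdot (cvec \<eta>) z)) \<le> cmod (\<rho> \<eta> * of_real (exp (norm \<eta> * T)))"
      unfolding norm_mult norm_of_real abs_exp_cancel by (intro mult_left_mono) auto
  qed
  finally show "cmod (fourier_laplace \<rho> z) \<le> ?B" .
qed

text \<open>The constant cancels both the factor \<open>(2 \<pi>)^-n\<close> of the inverse Fourier
  transform and the factor \<open>sqrt (\<pi> / l)^n\<close> of the Gaussian integral, where
  \<open>n\<close> is the dimension, so that the inverse transform is exactly
  \<open>conv (gauss_exp l z) \<rho>\<close>.\<close>

definition wave_packet :: "real \<Rightarrow> complex^'n \<Rightarrow> (real^'n \<Rightarrow> complex) \<Rightarrow> complex^'n \<Rightarrow> complex" where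
  "wave_packet l z \<rho> t = of_real ((2 * pi / sqrt (pi / l)) ^ CARD('n)) *
     exp (- (of_real l * cdot (t - z) (t - z))) * fourier_laplace \<rho> t"

definition gauss_exp :: "real \<Rightarrow> complex^'n \<Rightarrow> real^'n \<Rightarrow> complex" where
  "gauss_exp l z \<eta> = exp (- of_real ((norm \<eta>)\<^sup>2 / (4 * l)) - \<i> * cdot (cvec \<eta>) z)"

lemma cdot_self_Re:
  fixes z :: "complex^'n"
  shows "Re (cdot z z) = (norm (re_vec z))\<^sup>2 - (norm (im_vec z))\<^sup>2"
proof -
  have "(norm x)\<^sup>2 = (\<Sum>i\<in>UNIV. (x $ i)\<^sup>2)" for x :: "real^'n"
    by (simp add: norm_vec_def L2_set_def sum_nonneg)
  then show ?thesis
    by (simp add: cdot_def re_vec_def im_vec_def sum_subtractf power2_eq_square Re_sum)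
qed

text \<open>The real part of the complex square is a difference of two squares. The packet hence
  shrinks as \<open>l\<close> grows where the real displacement from \<open>z\<close> exceeds the
  imaginary one, and may blow up elsewhere.\<close>

lemma wave_packet_norm:
  fixes z t :: "complex^'n"
  assumes "l > 0"
  shows "cmod (wave_packet l z \<rho> t) = (2 * sqrt (pi * l)) ^ CARD('n) *
    exp (- (l * ((norm (re_vec t - re_vec z))\<^sup>2 - (norm (im_vec t - im_vec z))\<^sup>2)))
        * cmod (fourier_laplace \<rho> t)"
proof -
  have "2 * pi / sqrt (pi / l) = 2 * sqrt (pi * l)"
    using assms by (simp add: real_sqrt_divide real_sqrt_mult real_div_sqrt field_simps)
  moreover have "2 * sqrt (pi * l) \<ge> 0" using assms by simp
  ultimately show ?thesis
    by (simp add: wave_packet_def norm_mult cdot_self_Re re_im_vec_diff norm_power)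
qed

lemma power_le_fact_exp: 
  fixes x :: real assumes "x \<ge> 0" shows "x ^ N \<le> fact N * exp x"
proof -
  have "(\<Sum>n\<in>{N}. x ^ n /\<^sub>R fact n) \<le> (\<Sum>n. x ^ n /\<^sub>R fact n)"
    by (rule sum_le_suminf[OF summable_exp_generic]) (use assms in auto)
  then have "x ^ N / fact N \<le> exp x" by (simp add: exp_def divide_inverse mult.commute)
  then show ?thesis by (simp add: field_simps)
qed

text \<open>The Gaussian exponent is split as \<open>l0 + (l - l0)\<close>: the fixed part
  \<open>l0\<close> absorbs the polynomial factor, and the remainder gives decay in \<open>l\<close>
  with a constant independent of \<open>l\<close>. Leaving \<open>q\<close> free allows either the
  exact difference of squares or a uniform lower bound of it.\<close>

lemma wave_packet_decay:
  fixes \<rho> :: "real^'n \<Rightarrow> complex" and z :: "complex^'n"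
  assumes \<rho>: "\<rho> \<in> test_functions W" and l0: "l0 > 0"
  shows "\<exists>D\<ge>0. \<forall>l t q. l \<ge> l0 \<longrightarrow> norm (im_vec t) \<le> T \<longrightarrow> q
      \<le> (norm (re_vec t - re_vec z))\<^sup>2 - (norm (im_vec t - im_vec z))\<^sup>2 \<longrightarrow>
    (1 + norm t) ^ N * cmod (wave_packet l z \<rho> t) \<le> D * (2 * sqrt (pi * l)) ^ CARD('n) * exp (- ((l
        - l0) * q))"
proof -
  obtain B where B: "B \<ge> 0" "\<forall>t. norm (im_vec t) \<le> T \<longrightarrow> cmod (fourier_laplace \<rho> t) \<le> B"
    using fourier_laplace_bound[OF \<rho>, of T] by (elim exE conjE)
  define A where "A = 1 + norm (re_vec z) + T"
  define Y where "Y = (T + norm (im_vec z))\<^sup>2"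
  \<comment> \<open>The factors come, in order, from bounding the polynomial by an exponential in
    \<open>s\<close>, from the maximum of \<open>s - l0 * s\<^sup>2\<close>, from the imaginary
    displacement, and from the Fourier-Laplace transform.\<close>
  define D where "D = fact N * exp (A + 1 / (4 * l0)) * exp (l0 * Y) * B"
  have "D \<ge> 0" using B by (simp add: D_def)
  moreover have "(1 + norm t) ^ N * cmod (wave_packet l z \<rho> t)
      \<le> D * (2 * sqrt (pi * l)) ^ CARD('n) * exp (- ((l - l0) * q))"
    if l: "l \<ge> l0" and t: "norm (im_vec t) \<le> T" and q: "q
        \<le> (norm (re_vec t - re_vec z))\<^sup>2 - (norm (im_vec t - im_vec z))\<^sup>2" for l t q
  proof -
    define s where "s = norm (re_vec t - re_vec z)"
    define y where "y = norm (im_vec t - im_vec z)"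
    have "norm t \<le> norm (re_vec t) + norm (im_vec t)" by (rule norm_le_re_im)
    also have "norm (re_vec t) \<le> norm (re_vec z) + s" unfolding s_def by (rule norm_triangle_sub)
    finally have "1 + norm t \<le> A + s" using t by (simp add: A_def)
    then have "(1 + norm t) ^ N \<le> (A + s) ^ N" by (intro power_mono) auto
    also have "\<dots> \<le> fact N * exp (A + s)"
      using order_trans[OF norm_ge_zero t] by (intro power_le_fact_exp) (simp add: A_def s_def)
    finally have 1: "(1 + norm t) ^ N \<le> fact N * exp (A + s)" .
    have "y \<le> T + norm (im_vec z)" unfolding y_def using norm_triangle_ineq4[of "im_vec t" "im_vec z"] t
      by linarith
    then have y: "y\<^sup>2 \<le> Y" unfolding Y_def by (intro power_mono) (auto simp: y_def)
    have e1: "(l - l0) * q \<le> (l - l0) * (s\<^sup>2 - y\<^sup>2)" using l q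
      by (intro mult_left_mono) (auto simp: s_def y_def)
    have e2: "l0 * y\<^sup>2 \<le> l0 * Y" using y l0 by (intro mult_left_mono) auto
    have e3: "- l0 * s\<^sup>2 + s \<le> 1 / (4 * l0)" using neg_square_le_linear[OF l0, of s 1] by simp
    have "exp (A + s) * exp (- (l * (s\<^sup>2 - y\<^sup>2))) \<le> exp (A + 1 / (4 * l0)) * exp (l0 * Y) * exp (- ((l
        - l0) * q))"
      unfolding mult_exp_exp exp_le_cancel_iff using e1 e2 e3 by (simp add: algebra_simps)
    then have 2: "fact N * (exp (A + s) * exp (- (l * (s\<^sup>2 - y\<^sup>2))))
        \<le> fact N * (exp (A + 1 / (4 * l0)) * exp (l0 * Y) * exp (- ((l - l0) * q)))"
      by (rule mult_left_mono) simp
    have p: "0 \<le> (2 * sqrt (pi * l)) ^ CARD('n)" using l l0 by simp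
    have "(1 + norm t) ^ N * cmod (wave_packet l z \<rho> t)
      = (1 + norm t) ^ N * ((2 * sqrt (pi * l)) ^ CARD('n) * exp (- (l * (s\<^sup>2 - y\<^sup>2)))
          * cmod (fourier_laplace \<rho> t))"
      using l l0 by (subst wave_packet_norm) (auto simp: s_def y_def)
    also have "\<dots> \<le> (fact N * exp (A + s)) * ((2 * sqrt (pi * l)) ^ CARD('n) * exp (- (l * (s\<^sup>2 - y\<^sup>2))) * B)"
      using 1 B t p by (intro mult_mono) auto
    also have "\<dots> = (fact N * (exp (A + s) * exp (- (l * (s\<^sup>2 - y\<^sup>2))))) * ((2 * sqrt (pi
        * l)) ^ CARD('n) * B)"
      by (simp only: mult_ac)
    also have "\<dots> \<le> (fact N * (exp (A + 1 / (4 * l0)) * exp (l0 * Y) * exp (- ((l - l0) * q)))) * ((2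
        * sqrt (pi * l)) ^ CARD('n) * B)"
      using p B by (intro mult_right_mono 2) auto
    also have "\<dots> = D * (2 * sqrt (pi * l)) ^ CARD('n) * exp (- ((l - l0) * q))"
      by (simp only: D_def mult_ac)
    finally show ?thesis .
  qed
  ultimately show ?thesis by blast
qed

lemma wave_packet_has_derivative:
  fixes \<rho> :: "real^'n \<Rightarrow> complex"
  assumes \<rho>: "\<rho> \<in> test_functions W"
  shows "\<exists>L. (wave_packet l z \<rho> has_derivative L) (at t) \<and> (\<forall>c v. L (c *s v) = c * L v)"
proof -
  define L1 where "L1 = (\<lambda>v. \<integral>\<eta>. \<rho> \<eta> * (exp (\<i> * cdot (cvec \<eta>) t) * (\<i> * cdot (cvec \<eta>) v)) \<partial>lborel)"
  have L1: "(fourier_laplace \<rho> has_derivative L1) (at t)"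
    unfolding L1_def by (rule fourier_laplace_has_derivative[OF \<rho>])
  have L1c: "L1 (c *s v) = c * L1 v" for c v
    unfolding L1_def by (subst integral_mult_right_zero[symmetric]) (simp add: cdot_scale_right mult_ac)
  have d: "((\<lambda>t. cdot (t - z) (t - z)) has_derivative (\<lambda>v. 2 * cdot (t - z) v)) (at t)"
  proof -
    have "((\<lambda>t. \<Sum>i\<in>UNIV. (t $ i - z $ i) * (t $ i - z $ i)) has_derivative (\<lambda>v. \<Sum>i\<in>UNIV. (t $ i - z $ i)
        * v $ i + v $ i * (t $ i - z $ i))) (at t)"
      by (intro has_derivative_sum has_derivative_mult)
        (auto intro!: derivative_eq_intros bounded_linear.has_derivative[OF bounded_linear_vec_nth])
    moreover have "(\<lambda>v. \<Sum>i\<in>UNIV. (t $ i - z $ i) * v $ i + v $ i * (t $ i - z $ i))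
        = (\<lambda>v. 2 * cdot (t - z) v)"
      by (simp add: cdot_def fun_eq_iff sum_distrib_left mult.commute)
    ultimately show ?thesis by (simp add: cdot_def)
  qed
  let ?c = "of_real ((2 * pi / sqrt (pi / l)) ^ CARD('n)) :: complex"
  let ?e = "exp (- (of_real l * cdot (t - z) (t - z)))"
  have "(wave_packet l z \<rho> has_derivative
     (\<lambda>v. ?c * ?e * L1 v + ?c * (?e * (- (of_real l * (2 * cdot (t - z) v)))) * fourier_laplace \<rho> t)) (at t)"
    unfolding wave_packet_def[abs_def]
    by (intro has_derivative_mult has_derivative_mult_right has_derivative_cexp has_derivative_minus d L1)
  then show ?thesis
    by (intro exI conjI) (assumption, simp add: L1c cdot_scale_right algebra_simps)
qed

lemma wave_packet_in_Hol_space: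
  fixes \<rho> :: "real^'n \<Rightarrow> complex"
  assumes \<rho>: "\<rho> \<in> test_functions W" and l: "l > 0"
  shows "wave_packet l z \<rho> \<in> Hol_space \<O>"
  unfolding Hol_space_def Holb_def
proof (intro INT_I CollectI conjI allI)
  fix K assume "K \<in> convex_compacts \<O>"
  note K = convex_compactsD[OF this]
  show "continuous_on (tube K) (wave_packet l z \<rho>)"
    using wave_packet_has_derivative[OF \<rho>] has_derivative_continuous continuous_at_imp_continuous_on by metis
  show "holomorphic_several (wave_packet l z \<rho>) (interior (tube K))"
    unfolding holomorphic_several_def using wave_packet_has_derivative[OF \<rho>] by blast
  fix N
  obtain T where T: "T > 0" "\<And>x. x \<in> K \<Longrightarrow> norm x \<le> T"
    using compact_norm_bound[OF K(1)] by metis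
  \<comment> \<open>Applied below with \<open>l' = l\<close>, where the last exponential is
    \<open>1\<close>.\<close>
  obtain D where D: "\<forall>l' t q. l' \<ge> l \<longrightarrow> norm (im_vec t) \<le> T \<longrightarrow> q
      \<le> (norm (re_vec t - re_vec z))\<^sup>2 - (norm (im_vec t - im_vec z))\<^sup>2 \<longrightarrow>
    (1 + norm t) ^ N * cmod (wave_packet l' z \<rho> t)
        \<le> D * (2 * sqrt (pi * l')) ^ CARD('n) * exp (- ((l' - l) * q))"
    using wave_packet_decay[OF \<rho> l, of T z N] by (elim exE conjE)
  have "(1 + norm t) ^ N * cmod (wave_packet l z \<rho> t) \<le> D * (2 * sqrt (pi * l)) ^ CARD('n)"
      if "t \<in> tube K" for t
    using D[rule_format, OF order_refl T(2) order_refl, of t] that by (simp add: tube_iff)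
  then show "bdd_above ((\<lambda>z'. (1 + norm z') ^ N * cmod (wave_packet l z \<rho> z')) ` tube K)"
    by (rule bdd_aboveI2)
qed

lemma rapid_gauss_exp:
  fixes z :: "complex^'n"
  assumes l: "l > 0"
  shows "rapid (gauss_exp l z)"
  unfolding rapid_def
proof (intro conjI allI)
  show c: "continuous_on UNIV (gauss_exp l z)"
    unfolding gauss_exp_def[abs_def] using l by (intro continuous_intros) auto
  fix R
  have "integrable lborel (\<lambda>x::real^'n. exp (- (1 / (4 * l)) * (norm x)\<^sup>2 + (R + norm (im_vec z)) * norm x))"
    using l by (intro integrable_gaussian_exp_norm) simp
  then show "integrable lborel (\<lambda>\<eta>. exp (R * norm \<eta>) * cmod (gauss_exp l z \<eta>))"
  proof (rule Bochner_Integration.integrable_bound)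
    show "(\<lambda>\<eta>. exp (R * norm \<eta>) * cmod (gauss_exp l z \<eta>)) \<in> borel_measurable lborel"
      using borel_measurable_continuous_onI[OF c] by simp
    show "AE \<eta> in lborel. norm (exp (R * norm \<eta>) * cmod (gauss_exp l z \<eta>))
      \<le> norm (exp (- (1 / (4 * l)) * (norm \<eta>)\<^sup>2 + (R + norm (im_vec z)) * norm \<eta>))"
    proof (rule AE_I2)
      fix \<eta> :: "real^'n"
      have "\<eta> \<bullet> im_vec z \<le> norm \<eta> * norm (im_vec z)" by (rule norm_cauchy_schwarz)
      then show "norm (exp (R * norm \<eta>) * cmod (gauss_exp l z \<eta>))
        \<le> norm (exp (- (1 / (4 * l)) * (norm \<eta>)\<^sup>2 + (R + norm (im_vec z)) * norm \<eta>))"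
        by (simp add: gauss_exp_def Im_cdot_cvec mult_exp_exp algebra_simps)
    qed
  qed
qed

section \<open>Fourier transforms of Gaussians and of wave packets\<close>

lemma cdot_diff_left: "cdot (v - w) z = cdot v z - cdot w z"
  and cdot_diff_right: "cdot z (v - w) = cdot z v - cdot z w"
  and cdot_scale_left: "cdot (c *s v) z = c * cdot v z"
  and cdot_commute: "cdot z v = cdot v z"
  by (simp_all add: cdot_def sum_subtractf left_diff_distrib right_diff_distrib sum_distrib_left mult_ac)

text \<open>Completing the square. The first identity brings the exponent into the shape of
  \<open>gaussian_integral\<close> with linear coefficient \<open>w\<close>; in the second the terms
  quadratic in \<open>z\<close> cancel, and what remains is the exponent of
  \<open>gauss_exp\<close>.\<close>

lemma gauss_exponent:
  fixes z :: "complex^'n"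
  assumes l: "l > 0"
  defines "w \<equiv> \<lambda>\<zeta>. of_real (2 * l) *s z - \<i> *s cvec \<zeta>"
  shows "- (of_real l * cdot (cvec x - z) (cvec x - z)) - \<i> * of_real (\<zeta> \<bullet> x)
      = - (of_real l * cdot z z) + (- of_real (l * (norm x)\<^sup>2) + cdot (w \<zeta>) (cvec x))"
    and "- (of_real l * cdot z z) + cdot (w \<zeta>) (w \<zeta>) / of_real (4 * l)
      = - of_real ((norm \<zeta>)\<^sup>2 / (4 * l)) - \<i> * cdot (cvec \<zeta>) z"
proof -
  have n: "cdot (cvec x) (cvec x) = of_real ((norm x)\<^sup>2)" for x :: "real^'n"
    by (simp add: cdot_cvec_cvec power2_norm_eq_inner)
  show "- (of_real l * cdot (cvec x - z) (cvec x - z)) - \<i> * of_real (\<zeta> \<bullet> x)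
      = - (of_real l * cdot z z) + (- of_real (l * (norm x)\<^sup>2) + cdot (w \<zeta>) (cvec x))"
    unfolding w_def cdot_diff_left cdot_diff_right cdot_scale_left cdot_scale_right n cdot_cvec_cvec
        cdot_commute[of z "cvec x"]
    by (simp add: algebra_simps)
  have alg: "2 * k * (2 * k * u - \<i> * v) - \<i> * (2 * k * v - \<i> * r) = 4 * k * (k * u - \<i> * v) - r"
      for k u v r :: complex
    by (simp add: algebra_simps)
  have "cdot (w \<zeta>) (w \<zeta>) = of_real (4 * l) * (of_real l * cdot z z - \<i> * cdot (cvec \<zeta>) z)
      - of_real ((norm \<zeta>)\<^sup>2)"
    unfolding w_def cdot_diff_left cdot_diff_right cdot_scale_left cdot_scale_right n cdot_commute[of z
        "cvec \<zeta>"]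
    using alg[of "of_real l"] by simp
  then show "- (of_real l * cdot z z) + cdot (w \<zeta>) (w \<zeta>) / of_real (4 * l)
      = - of_real ((norm \<zeta>)\<^sup>2 / (4 * l)) - \<i> * cdot (cvec \<zeta>) z"
    using l by (simp add: diff_divide_distrib)
qed

lemma gauss_fourier:
  fixes z :: "complex^'n"
  assumes l: "l > 0"
  shows "integrable lborel (\<lambda>x. exp (- (of_real l * cdot (cvec x - z) (cvec x - z)) - \<i> * of_real (\<zeta> \<bullet> x)))"
    and "(\<integral>x. exp (- (of_real l * cdot (cvec x - z) (cvec x - z)) - \<i> * of_real (\<zeta> \<bullet> x)) \<partial>lborel)
      = of_real (sqrt (pi / l)) ^ CARD('n) * gauss_exp l z \<zeta>"
proof -
  show "integrable lborel (\<lambda>x. exp (- (of_real l * cdot (cvec x - z) (cvec x - z)) - \<i> * of_real (\<zeta> \<bullet> x)))"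
    unfolding gauss_exponent(1)[OF l] exp_add[of "- (of_real l * cdot z z)"]
    by (intro integrable_mult_right gaussian_integral(1)[OF l])
  define w where "w = of_real (2 * l) *s z - \<i> *s cvec \<zeta>"
  have "(\<integral>x. exp (- (of_real l * cdot (cvec x - z) (cvec x - z)) - \<i> * of_real (\<zeta> \<bullet> x)) \<partial>lborel)
      = exp (- (of_real l * cdot z z)) * (of_real (sqrt (pi / l)) ^ CARD('n)
          * exp (cdot w w / of_real (4 * l)))"
    unfolding gauss_exponent(1)[OF l] exp_add[of "- (of_real l * cdot z z)"] integral_mult_right_zero
      gaussian_integral(2)[OF l] w_def ..
  also have "\<dots> = of_real (sqrt (pi / l)) ^ CARD('n) * exp (- (of_real l * cdot z z)
      + cdot w w / of_real (4 * l))"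
    by (simp only: exp_add mult_ac)
  also have "\<dots> = of_real (sqrt (pi / l)) ^ CARD('n) * gauss_exp l z \<zeta>"
    unfolding gauss_exp_def w_def gauss_exponent(2)[OF l] ..
  finally show "(\<integral>x. exp (- (of_real l * cdot (cvec x - z) (cvec x - z)) - \<i> * of_real (\<zeta> \<bullet> x)) \<partial>lborel)
      = of_real (sqrt (pi / l)) ^ CARD('n) * gauss_exp l z \<zeta>" .
qed

text \<open>After Fubini, the exponential inside \<open>fourier_laplace\<close> merely shifts the
  frequency \<open>\<xi>\<close> to \<open>\<xi> - \<eta>\<close> in the Fourier integral of the
  Gaussian. The convolution appears with its arguments exchanged, which a reflection of the variable
  repairs.\<close>

lemma inv_fourier_wave_packet:
  fixes z :: "complex^'n" and \<rho> :: "real^'n \<Rightarrow> complex"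
  assumes \<rho>: "\<rho> \<in> test_functions W" and l: "l > 0"
  shows "inv_fourier (wave_packet l z \<rho>) = conv (gauss_exp l z) \<rho>"
proof
  fix \<xi> :: "real^'n"
  define c where "c = (of_real ((2 * pi / sqrt (pi / l)) ^ CARD('n)) :: complex)"
  define a where "a \<zeta> x = exp (- (of_real l * cdot (cvec x - z) (cvec x - z)) - \<i> * of_real (\<zeta> \<bullet> x))" for \<zeta> x
  define f where "f x \<eta> = \<rho> \<eta> * a (\<xi> - \<eta>) x" for x \<eta>
  have fa: "f x \<eta> = a \<xi> x * (\<rho> \<eta> * exp (\<i> * cdot (cvec \<eta>) (cvec x)))" for x \<eta>
  proof -
    have "a (\<xi> - \<eta>) x = a \<xi> x * exp (\<i> * cdot (cvec \<eta>) (cvec x))"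
      unfolding a_def mult_exp_exp by (simp add: cdot_cvec_cvec inner_diff_left algebra_simps)
    then show ?thesis by (simp add: f_def mult_ac)
  qed
  have ai: "integrable lborel (a \<zeta>)" for \<zeta>
    unfolding a_def[abs_def] by (rule gauss_fourier(1)[OF l])
  have \<rho>i: "integrable lborel (\<lambda>\<eta>. \<rho> \<eta> * exp (\<i> * cdot (cvec \<eta>) (cvec x)))" for x
    by (intro integrable_test_function_mult[OF \<rho>] continuous_intros)
  have "integrable (lborel \<Otimes>\<^sub>M lborel) (\<lambda>(x, \<eta>). f x \<eta>)"
  proof (rule lborel_pair.Fubini_integrable)
    have "continuous_on UNIV (\<lambda>(x, \<eta>). f x \<eta>)"
    proof -
      have "continuous_on UNIV (\<lambda>p :: (real^'n) \<times> (real^'n). \<rho> (snd p))"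
        by (rule continuous_on_compose2[OF smooth_fun_continuous[OF test_functions_smooth[OF \<rho>], of UNIV]])
          (auto intro: continuous_intros)
      then show ?thesis
        unfolding f_def a_def case_prod_unfold cdot_def cvec_def
        by (auto intro!: continuous_intros)
    qed
    then show "(\<lambda>(x, \<eta>). f x \<eta>) \<in> borel_measurable (lborel \<Otimes>\<^sub>M lborel)"
      unfolding lborel_prod by (simp add: borel_measurable_continuous_onI)
    have "norm (f x \<eta>) = cmod (a \<xi> x) * cmod (\<rho> \<eta>)" for x \<eta>
      by (simp add: fa norm_mult cdot_cvec_cvec)
    then show "integrable lborel (\<lambda>x. \<integral>\<eta>. norm (case (x, \<eta>) of (x, \<eta>) \<Rightarrow> f x \<eta>) \<partial>lborel)"
      using ai[of \<xi>] by simp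
    show "AE x in lborel. integrable lborel (\<lambda>\<eta>. case (x, \<eta>) of (x, \<eta>) \<Rightarrow> f x \<eta>)"
      unfolding fa prod.case by (intro AE_I2 integrable_mult_right \<rho>i)
  qed
  from lborel_pair.Fubini_integral[OF this]
  have fub: "(\<integral>x. \<integral>\<eta>. f x \<eta> \<partial>lborel \<partial>lborel) = (\<integral>\<eta>. \<integral>x. f x \<eta> \<partial>lborel \<partial>lborel)" by simp
  have 1: "wave_packet l z \<rho> (cvec x) * exp (- (\<i> * of_real (\<xi> \<bullet> x))) = c * (\<integral>\<eta>. f x \<eta> \<partial>lborel)" for x
  proof -
    have e: "a \<xi> x = exp (- (of_real l * cdot (cvec x - z) (cvec x - z))) * exp (- (\<i> * of_real (\<xi> \<bullet> x)))"
      by (simp add: a_def mult_exp_exp)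
    show ?thesis
      unfolding wave_packet_def fa integral_mult_right_zero fourier_laplace_def c_def e
        by (simp only: mult_ac)
  qed
  have 2: "(\<integral>x. f x \<eta> \<partial>lborel) = of_real (sqrt (pi / l)) ^ CARD('n) * (\<rho> \<eta> * gauss_exp l z (\<xi> - \<eta>))" for \<eta>
    unfolding f_def integral_mult_right_zero a_def gauss_fourier(2)[OF l] by (simp only: mult_ac)
  \<comment> \<open>The normalisation of \<open>wave_packet\<close> is fixed by this
    identity.\<close>
  have k: "1 / (2 * of_real pi) ^ CARD('n) * (c * of_real (sqrt (pi / l)) ^ CARD('n)) = 1"
    using l by (simp add: c_def power_divide)
  have "inv_fourier (wave_packet l z \<rho>) \<xi> = 1 / (2 * of_real pi) ^ CARD('n) * (c
      * (\<integral>x. \<integral>\<eta>. f x \<eta> \<partial>lborel \<partial>lborel))"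
    unfolding inv_fourier_def 1 integral_mult_right_zero ..
  also have "\<dots> = 1 / (2 * of_real pi) ^ CARD('n) * (c * of_real (sqrt (pi / l)) ^ CARD('n)) * (\<integral>\<eta>. \<rho> \<eta>
      * gauss_exp l z (\<xi> - \<eta>) \<partial>lborel)"
    unfolding fub 2 integral_mult_right_zero by (simp only: mult.assoc)
  also have "\<dots> = (\<integral>\<eta>. \<rho> \<eta> * gauss_exp l z (\<xi> - \<eta>) \<partial>lborel)" unfolding k by simp
  also have "\<dots> = (\<integral>\<eta>. \<rho> (\<xi> + (- 1) *\<^sub>R \<eta>) * gauss_exp l z (\<xi> - (\<xi> + (- 1) *\<^sub>R \<eta>)) \<partial>lborel)"
  proof -
    have "(\<lambda>\<eta>. \<rho> \<eta> * gauss_exp l z (\<xi> - \<eta>)) \<in> borel_measurable borel"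
    proof (intro borel_measurable_times borel_measurable_continuous_onI)
      show "continuous_on UNIV \<rho>" by (rule smooth_fun_continuous[OF test_functions_smooth[OF \<rho>]])
      have "continuous_on UNIV (gauss_exp l z)" using rapid_gauss_exp[OF l, of z] by (simp add: rapid_def)
      then show "continuous_on UNIV (\<lambda>\<eta>. gauss_exp l z (\<xi> - \<eta>))"
        by (rule continuous_on_compose2) (auto intro!: continuous_intros)
    qed
    from lborel_integral_affine(1)[OF _ this, of "- 1" \<xi>] show ?thesis by simp
  qed
  also have "\<dots> = conv (gauss_exp l z) \<rho> \<xi>"
    by (simp add: conv_def mult.commute)
  finally show "inv_fourier (wave_packet l z \<rho>) \<xi> = conv (gauss_exp l z) \<rho> \<xi>" .
qed

text \<open>Points of \<open>C\<close> are real, so the distance of \<open>t\<close> to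
  \<open>C\<close> controls the imaginary part of \<open>t\<close> and the distance of its real part
  to \<open>C\<close> simultaneously. Nonemptiness of \<open>C\<close>, built into
  \<open>carrier_nbhd\<close>, turns bounds for all points of \<open>C\<close> into a bound on
  \<open>infdist\<close>.\<close>

lemma carrier_nbhd_bounds:
  fixes t :: "complex^'n"
  assumes t: "t \<in> carrier_nbhd C m" and x: "\<And>c. c \<in> C \<Longrightarrow> d \<le> norm (x - c)"
  shows "norm (im_vec t) \<le> 1 / real m" and "d - 1 / real m \<le> norm (re_vec t - x)"
proof -
  have C: "C \<noteq> {}" and inf: "infdist t (cvec ` C) \<le> 1 / real m"
    using t by (auto simp: carrier_nbhd_def)
  have le: "y \<le> 1 / real m" if "\<And>c. c \<in> C \<Longrightarrow> y \<le> dist t (cvec c)" for y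
  proof -
    have "y \<le> infdist t (cvec ` C)"
      unfolding infdist_def using C that by (auto intro!: cINF_greatest)
    then show ?thesis using inf by simp
  qed
  show "norm (im_vec t) \<le> 1 / real m"
  proof (rule le)
    show "norm (im_vec t) \<le> dist t (cvec c)" for c
      using norm_im_vec_le[of "t - cvec c"] by (simp add: re_im_vec_diff dist_norm)
  qed
  have "d - norm (re_vec t - x) \<le> 1 / real m"
  proof (rule le)
    fix c assume "c \<in> C"
    have "d \<le> norm (x - c)" by (rule x) fact
    also have "\<dots> \<le> norm (re_vec t - x) + norm (re_vec t - c)"
      using norm_triangle_ineq4[of "re_vec t - c" "re_vec t - x"] by simp
    also have "norm (re_vec t - c) \<le> dist t (cvec c)"
      using norm_re_vec_le[of "t - cvec c"] by (simp add: re_im_vec_diff dist_norm)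
    finally show "d - norm (re_vec t - x) \<le> dist t (cvec c)" by simp
  qed
  then show "d - 1 / real m \<le> norm (re_vec t - x)" by simp
qed

lemma gauss_factor_tendsto_0:
  assumes \<kappa>: "\<kappa> > 0"
  shows "((\<lambda>l. (2 * sqrt (pi * l)) ^ n * exp (- ((l - 1) * \<kappa>))) \<longlongrightarrow> 0) at_top"
proof -
  have "filterlim (\<lambda>l. \<kappa> * l) at_top at_top"
    using \<kappa> by (intro filterlim_tendsto_pos_mult_at_top[OF tendsto_const _ filterlim_ident])
  then have "((\<lambda>l. (\<kappa> * l) ^ n / exp (\<kappa> * l)) \<longlongrightarrow> 0) at_top"
    by (rule filterlim_compose[OF tendsto_power_div_exp_0])
  then have "((\<lambda>l. ((2 * sqrt pi / \<kappa>) ^ n * exp \<kappa>) * ((\<kappa> * l) ^ n / exp (\<kappa> * l))) \<longlongrightarrow> ((2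
      * sqrt pi / \<kappa>) ^ n * exp \<kappa>) * 0) at_top"
    by (intro tendsto_intros)
  then have lim: "((\<lambda>l. ((2 * sqrt pi / \<kappa>) ^ n * exp \<kappa>) * ((\<kappa> * l) ^ n / exp (\<kappa> * l))) \<longlongrightarrow> 0) at_top" by simp
  show ?thesis
  proof (rule tendsto_sandwich[OF _ _ tendsto_const lim])
    show "\<forall>\<^sub>F l in at_top. 0 \<le> (2 * sqrt (pi * l)) ^ n * exp (- ((l - 1) * \<kappa>))"
      using eventually_ge_at_top[of "1::real"] by eventually_elim simp
    show "\<forall>\<^sub>F l in at_top. (2 * sqrt (pi * l)) ^ n * exp (- ((l - 1) * \<kappa>))
        \<le> ((2 * sqrt pi / \<kappa>) ^ n * exp \<kappa>) * ((\<kappa> * l) ^ n / exp (\<kappa> * l))"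
      using eventually_ge_at_top[of "1::real"]
    proof eventually_elim
      case (elim l)
      have "sqrt l \<le> l" using elim by (intro real_le_lsqrt) (auto simp: power2_eq_square)
      then have "2 * sqrt (pi * l) \<le> (2 * sqrt pi / \<kappa>) * (\<kappa> * l)"
        using \<kappa> by (simp add: real_sqrt_mult)
      then have le: "(2 * sqrt (pi * l)) ^ n \<le> (2 * sqrt pi / \<kappa>) ^ n * (\<kappa> * l) ^ n"
        using elim by (subst power_mult_distrib[symmetric]) (intro power_mono, auto)
      have E: "exp (- ((l - 1) * \<kappa>)) = exp \<kappa> * inverse (exp (\<kappa> * l))"
        by (simp add: exp_minus[symmetric] mult_exp_exp algebra_simps)
      have "(2 * sqrt (pi * l)) ^ n * (exp \<kappa> * inverse (exp (\<kappa> * l)))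
          \<le> ((2 * sqrt pi / \<kappa>) ^ n * (\<kappa> * l) ^ n) * (exp \<kappa> * inverse (exp (\<kappa> * l)))"
        by (rule mult_right_mono[OF le]) simp
      then show ?case unfolding E by (simp only: divide_inverse mult_ac)
    qed
  qed
qed

text \<open>The carrier estimate is tested on \<open>wave_packet l z \<rho>\<close>. On the
  neighbourhood of \<open>C\<close> the packet is exponentially small in \<open>l\<close>, which
  beats the power of \<open>l\<close> in its normalisation.\<close>

lemma carrier_gauss_limit:
  fixes V :: "(real^'n \<Rightarrow> complex) \<Rightarrow> complex" and z :: "complex^'n"
  assumes V: "V \<in> H_dual \<O>" and \<O>: "convex \<O>" "0 \<in> \<O>" and \<rho>: "\<rho> \<in> test_functions W"
    and carr: "carried_by \<O>' (inv_fourier_dual V) C"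
    and m: "m \<ge> 1" "carrier_nbhd C m \<subseteq> tube \<O>'"
    and x: "\<And>c. c \<in> C \<Longrightarrow> d \<le> norm (re_vec z - c)" and d: "norm (im_vec z) + 2 / real m < d"
  shows "((\<lambda>l. \<integral>\<eta>. gauss_exp l z \<eta> * V (\<lambda>\<xi>. \<rho> (\<xi> - \<eta>)) \<partial>lborel) \<longlongrightarrow> 0) at_top"
proof -
  obtain N M where M: "M > 0" and le: "\<forall>\<psi>\<in>Hol_space \<O>'. ennreal (cmod (inv_fourier_dual V \<psi>)) \<le>
      ennreal M * (SUP z\<in>carrier_nbhd C m. ennreal ((1 + norm z) ^ N * cmod (\<psi> z)))"
    using carr m unfolding carried_by_def by blast
  obtain D where D: "D \<ge> 0" "\<forall>l t q. l \<ge> 1 \<longrightarrow> norm (im_vec t) \<le> 1 / real m \<longrightarrow> q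
      \<le> (norm (re_vec t - re_vec z))\<^sup>2 - (norm (im_vec t - im_vec z))\<^sup>2 \<longrightarrow>
    (1 + norm t) ^ N * cmod (wave_packet l z \<rho> t) \<le> D * (2 * sqrt (pi * l)) ^ CARD('n) * exp (- ((l - 1)
        * q))"
    using wave_packet_decay[OF \<rho> zero_less_one, of "1 / real m" z N] by (elim exE conjE)
  \<comment> \<open>Passing from \<open>C\<close> to its neighbourhood shortens the real
    displacement by \<open>1 / m\<close> and lengthens the imaginary one by \<open>1 / m\<close>;
    the margin \<open>2 / m\<close> keeps the difference of squares positive.\<close>
  define q where "q = (d - 1 / real m)\<^sup>2 - (norm (im_vec z) + 1 / real m)\<^sup>2"
  have q: "q > 0"
    unfolding q_def using d by (simp add: power_strict_mono)
  have bd: "cmod (\<integral>\<eta>. gauss_exp l z \<eta> * V (\<lambda>\<xi>. \<rho> (\<xi> - \<eta>)) \<partial>lborel)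
      \<le> (M * D) * ((2 * sqrt (pi * l)) ^ CARD('n) * exp (- ((l - 1) * q)))" if l: "l \<ge> 1" for l
  proof -
    have l0: "l > 0" using l by simp
    define b where "b = D * (2 * sqrt (pi * l)) ^ CARD('n) * exp (- ((l - 1) * q))"
    have b: "b \<ge> 0" using D(1) l by (simp add: b_def)
    have "(SUP t\<in>carrier_nbhd C m. ennreal ((1 + norm t) ^ N * cmod (wave_packet l z \<rho> t))) \<le> ennreal b"
    proof (rule SUP_least)
      fix t assume t: "t \<in> carrier_nbhd C m"
      have im: "norm (im_vec t) \<le> 1 / real m" and re: "d - 1 / real m \<le> norm (re_vec t - re_vec z)"
        using carrier_nbhd_bounds[OF t x] by auto
      have "norm (im_vec t - im_vec z) \<le> norm (im_vec z) + 1 / real m"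
        using norm_triangle_ineq4[of "im_vec t" "im_vec z"] im by simp
      then have "(norm (im_vec t - im_vec z))\<^sup>2 \<le> (norm (im_vec z) + 1 / real m)\<^sup>2"
        by (rule power_mono) simp
      moreover have "d - 1 / real m \<ge> 0"
      proof -
        have "1 / real m \<le> 2 / real m" by (simp add: divide_right_mono)
        then show ?thesis using d norm_ge_zero[of "im_vec z"] by linarith
      qed
      then have "(d - 1 / real m)\<^sup>2 \<le> (norm (re_vec t - re_vec z))\<^sup>2" using re by (rule power_mono[rotated])
      ultimately have "q \<le> (norm (re_vec t - re_vec z))\<^sup>2 - (norm (im_vec t - im_vec z))\<^sup>2"
        unfolding q_def by linarith
      then have "(1 + norm t) ^ N * cmod (wave_packet l z \<rho> t) \<le> b"
        unfolding b_def using D(2) l im by blast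
      then show "ennreal ((1 + norm t) ^ N * cmod (wave_packet l z \<rho> t)) \<le> ennreal b" by (rule ennreal_leI)
    qed
    then have "ennreal M * (SUP t\<in>carrier_nbhd C m. ennreal ((1 + norm t) ^ N
        * cmod (wave_packet l z \<rho> t))) \<le> ennreal M * ennreal b"
      by (rule mult_left_mono) simp
    then have "ennreal (cmod (inv_fourier_dual V (wave_packet l z \<rho>))) \<le> ennreal M * ennreal b"
      using le wave_packet_in_Hol_space[OF \<rho> l0, of z \<O>'] order_trans by blast
    also have "\<dots> = ennreal (M * b)" using M b by (simp add: ennreal_mult)
    finally have "cmod (inv_fourier_dual V (wave_packet l z \<rho>)) \<le> M * b"
      using M b by (subst (asm) ennreal_le_iff) auto
    moreover have "inv_fourier_dual V (wave_packet l z \<rho>) = (\<integral>\<eta>. gauss_exp l z \<eta> * V (\<lambda>\<xi>. \<rho> (\<xi> - \<eta>)) \<partial>lborel)"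
      unfolding inv_fourier_dual_def inv_fourier_wave_packet[OF \<rho> l0]
      by (rule correlation_properties(3)[OF V \<O> \<rho> rapid_gauss_exp[OF l0]])
    ultimately show ?thesis by (simp add: b_def mult.assoc)
  qed
  have "((\<lambda>l. (M * D) * ((2 * sqrt (pi * l)) ^ CARD('n) * exp (- ((l - 1) * q)))) \<longlongrightarrow> (M * D) * 0) at_top"
    by (intro tendsto_intros gauss_factor_tendsto_0 q)
  then have lim: "((\<lambda>l. (M * D) * ((2 * sqrt (pi * l)) ^ CARD('n) * exp (- ((l - 1) * q)))) \<longlongrightarrow> 0) at_top"
    by simp
  show ?thesis
  proof (rule Lim_null_comparison[OF _ lim])
    show "\<forall>\<^sub>F l in at_top. norm (\<integral>\<eta>. gauss_exp l z \<eta> * V (\<lambda>\<xi>. \<rho> (\<xi> - \<eta>)) \<partial>lborel)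
        \<le> (M * D) * ((2 * sqrt (pi * l)) ^ CARD('n) * exp (- ((l - 1) * q)))"
      using eventually_ge_at_top[of "1::real"] by eventually_elim (rule bd)
  qed
qed

section \<open>Cones\<close>

lemma origin_cone_scale: "origin_cone C \<Longrightarrow> x \<in> C \<Longrightarrow> c > 0 \<Longrightarrow> c *\<^sub>R x \<in> C"
  unfolding origin_cone_def by blast

lemma origin_cone_zero:
  fixes C :: "(real^'n) set"
  assumes "closed C" "origin_cone C" "x \<in> C" shows "0 \<in> C"
proof (rule closed_sequentially[OF assms(1)])
  show "(1 / real (Suc k)) *\<^sub>R x \<in> C" for k using origin_cone_scale[OF assms(2,3)] by simp
  have "(\<lambda>k. (1 / real (Suc k)) *\<^sub>R x) \<longlonglongrightarrow> 0 *\<^sub>R x"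
    by (intro tendsto_intros LIMSEQ_Suc[OF lim_1_over_n])
  then show "(\<lambda>k. (1 / real (Suc k)) *\<^sub>R x) \<longlonglongrightarrow> 0" by simp
qed

text \<open>Pointedness makes \<open>C - {0}\<close> convex: a segment through \<open>0\<close>
  between two of its points would spread to a whole line in \<open>C\<close>. Hence \<open>0\<close>
  lies outside the convex hull of the compact section \<open>S\<close> and is strictly separated
  from it. Homogeneity extends the inequality to \<open>C\<close>, and division by
  \<open>\<beta>\<close> normalises its constant to \<open>1\<close>.\<close>

lemma pointed_cone_functional:
  fixes C :: "(real^'n) set"
  assumes "closed C" "convex C" "origin_cone C" "\<not> contains_line C"
  shows "\<exists>e. \<forall>\<xi>\<in>C. norm \<xi> \<le> \<xi> \<bullet> e"
proof -
  have conv: "convex (C - {0})"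
    unfolding convex_alt
  proof (intro ballI allI impI)
    fix x y and u :: real assume x: "x \<in> C - {0}" and y: "y \<in> C - {0}" and u: "0 \<le> u \<and> u \<le> 1"
    have "(1 - u) *\<^sub>R x + u *\<^sub>R y \<noteq> 0"
    proof
      assume 0: "(1 - u) *\<^sub>R x + u *\<^sub>R y = 0"
      then have u': "0 < u" "u < 1" using x y u by (auto simp: order_le_less)
      have "y = - ((1 - u) / u) *\<^sub>R x"
      proof -
        have "u *\<^sub>R y = - ((1 - u) *\<^sub>R x)" using 0 by (simp add: eq_neg_iff_add_eq_0 add.commute)
        then have "(1 / u) *\<^sub>R u *\<^sub>R y = (1 / u) *\<^sub>R (- ((1 - u) *\<^sub>R x))" by simp
        then show ?thesis using u' by simp
      qed
      then have neg: "- (((1 - u) / u) *\<^sub>R x) \<in> C" using y by simp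
      have "t *\<^sub>R x \<in> C" for t :: real
      proof -
        consider "t > 0" | "t = 0" | "t < 0" by linarith
        then show ?thesis
        proof cases
          case 1 then show ?thesis using origin_cone_scale[OF assms(3)] x by blast
        next
          case 2 then show ?thesis using origin_cone_zero[OF assms(1,3)] x by auto
        next
          case 3
          have k: "- t * u / (1 - u) > 0" using 3 u' by (intro divide_pos_pos mult_pos_pos) auto
          have "(- t * u / (1 - u)) *\<^sub>R (- (((1 - u) / u) *\<^sub>R x)) \<in> C"
            by (rule origin_cone_scale[OF assms(3) neg k])
          then show ?thesis using u' by simp
        qed
      qed
      then have "contains_line C" unfolding contains_line_def using x
        by (intro exI[of _ 0] exI[of _ x]) simp
      then show False using assms(4) by blast
    qed
    moreover have "(1 - u) *\<^sub>R x + u *\<^sub>R y \<in> C" using assms(2) x y u unfolding convex_alt by blast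
    ultimately show "(1 - u) *\<^sub>R x + u *\<^sub>R y \<in> C - {0}" by blast
  qed
  define S where "S = C \<inter> sphere 0 1"
  have "compact S" unfolding S_def using assms(1) by (intro closed_Int_compact) auto
  have "convex hull S \<subseteq> C - {0}"
    by (rule hull_minimal) (use conv in \<open>auto simp: S_def\<close>)
  then have "0 \<notin> convex hull S" by blast
  moreover have "closed (convex hull S)"
    by (intro compact_imp_closed compact_convex_hull) fact
  ultimately obtain a \<beta> where a: "\<beta> > 0" "\<forall>x\<in>convex hull S. \<beta> < a \<bullet> x"
    using separating_hyperplane_closed_0[OF convex_convex_hull] by blast
  show ?thesis
  proof (intro exI[of _ "(1 / \<beta>) *\<^sub>R a"] ballI)
    fix \<xi> assume \<xi>: "\<xi> \<in> C"
    show "norm \<xi> \<le> \<xi> \<bullet> ((1 / \<beta>) *\<^sub>R a)"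
    proof (cases "\<xi> = 0")
      case False
      have "(1 / norm \<xi>) *\<^sub>R \<xi> \<in> C" using origin_cone_scale[OF assms(3) \<xi>] False by simp
      then have "(1 / norm \<xi>) *\<^sub>R \<xi> \<in> S" using False by (simp add: S_def)
      then have "(1 / norm \<xi>) *\<^sub>R \<xi> \<in> convex hull S" by (rule hull_inc)
      with a(2) have "\<beta> < a \<bullet> ((1 / norm \<xi>) *\<^sub>R \<xi>)" by (rule bspec)
      then have "\<beta> < (a \<bullet> \<xi>) / norm \<xi>" by simp
      then have "\<beta> * norm \<xi> < a \<bullet> \<xi>" using False by (simp add: pos_less_divide_eq)
      then have "norm \<xi> < (a \<bullet> \<xi>) / \<beta>" using a(1) by (simp add: pos_less_divide_eq mult.commute)
      then show ?thesis by (simp add: inner_commute)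
    qed simp
  qed
qed

lemma cone_far_point:
  fixes C :: "(real^'n) set"
  assumes "closed C" "origin_cone C" "C \<noteq> UNIV" "Y > 0"
  shows "\<exists>x. \<forall>c\<in>C. Y \<le> norm (x - c)"
proof -
  obtain x0 where x0: "x0 \<in> - C" using assms(3) by blast
  have "open (- C)" using assms(1) by (simp add: open_Compl)
  then obtain \<epsilon> where \<epsilon>: "\<epsilon> > 0" "ball x0 \<epsilon> \<subseteq> - C" using x0 openE by blast
  show ?thesis
  \<comment> \<open>Dilation by \<open>Y / \<epsilon>\<close> preserves the cone and turns the
    distance \<open>\<epsilon>\<close> into \<open>Y\<close>.\<close>
  proof (intro exI[of _ "(Y / \<epsilon>) *\<^sub>R x0"] ballI)
    fix c assume "c \<in> C"
    then have "(\<epsilon> / Y) *\<^sub>R c \<in> C" using origin_cone_scale[OF assms(2)] \<epsilon>(1) assms(4) by simp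
    then have "(\<epsilon> / Y) *\<^sub>R c \<notin> ball x0 \<epsilon>" using \<epsilon>(2) by blast
    then have "\<epsilon> \<le> norm (x0 - (\<epsilon> / Y) *\<^sub>R c)" by (simp add: dist_norm)
    then have "(Y / \<epsilon>) * \<epsilon> \<le> (Y / \<epsilon>) * norm (x0 - (\<epsilon> / Y) *\<^sub>R c)"
      using \<epsilon>(1) assms(4) by (intro mult_left_mono) auto
    also have "\<dots> = norm ((Y / \<epsilon>) *\<^sub>R (x0 - (\<epsilon> / Y) *\<^sub>R c))" using \<epsilon>(1) assms(4) by simp
    also have "(Y / \<epsilon>) *\<^sub>R (x0 - (\<epsilon> / Y) *\<^sub>R c) = (Y / \<epsilon>) *\<^sub>R x0 - c"
      using \<epsilon>(1) assms(4) by (simp add: scaleR_diff_right)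
    finally show "Y \<le> norm ((Y / \<epsilon>) *\<^sub>R x0 - c)" using \<epsilon>(1) by simp
  qed
qed

section \<open>Fourier transforms of exponentially decaying functions\<close>

abbreviation plane_wave :: "real^'n \<Rightarrow> real^'n \<Rightarrow> complex" where
  "plane_wave \<eta> x \<equiv> exp (- (\<i> * of_real (\<eta> \<bullet> x)))"

text \<open>The rate \<open>2\<close> leaves \<open>exp (- norm \<eta>)\<close> after multiplication
  by a factor of growth \<open>exp (norm \<eta>)\<close>. This room is what complex frequencies, and
  derivatives with respect to them, consume.\<close>

lemma exp_decay_integrable:
  fixes \<beta> :: "real^'n \<Rightarrow> complex"
  assumes c: "continuous_on UNIV \<beta>" and B: "\<And>\<eta>. cmod (\<beta> \<eta>) \<le> B * exp (- (2 * norm \<eta>))"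
    and u: "continuous_on UNIV u" "\<And>\<eta>. cmod (u \<eta>) \<le> A * exp (norm \<eta>)" and A: "A \<ge> 0"
  shows "integrable lborel (\<lambda>\<eta>. \<beta> \<eta> * u \<eta>)"
proof (rule Bochner_Integration.integrable_bound)
  show "integrable lborel (\<lambda>\<eta>::real^'n. (B * A) * exp (- (1 * norm \<eta>)))"
    by (intro integrable_mult_right integrable_exp_neg_norm) simp
  show "(\<lambda>\<eta>. \<beta> \<eta> * u \<eta>) \<in> borel_measurable lborel"
    using c u(1) by (simp add: borel_measurable_continuous_onI continuous_on_mult)
  show "AE \<eta> in lborel. norm (\<beta> \<eta> * u \<eta>) \<le> norm ((B * A) * exp (- (1 * norm \<eta>)))"
  proof (rule AE_I2)
    fix \<eta> :: "real^'n"
    have "cmod (\<beta> \<eta>) * cmod (u \<eta>) \<le> (B * exp (- (2 * norm \<eta>))) * (A * exp (norm \<eta>))"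
      by (rule mult_mono[OF B u(2) order_trans[OF norm_ge_zero B]]) simp
    also have "\<dots> = (B * A) * (exp (- (2 * norm \<eta>)) * exp (norm \<eta>))" by (simp only: mult_ac)
    also have "\<dots> = (B * A) * exp (- (1 * norm \<eta>))" unfolding mult_exp_exp by simp
    finally show "norm (\<beta> \<eta> * u \<eta>) \<le> norm ((B * A) * exp (- (1 * norm \<eta>)))"
      by (simp add: norm_mult)
  qed
qed

text \<open>Reduction to one complex variable: along \<open>x1 + w *\<^sub>R v\<close> with complex
  \<open>w\<close> the transform is holomorphic in a strip around the real axis that contains
  \<open>0\<close>, which is the point \<open>x1\<close>, and \<open>1\<close>, which is the point
  \<open>x\<close>.\<close>

lemma fourier_transform_continuation:
  fixes \<beta> :: "real^'n \<Rightarrow> complex"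
  assumes c: "continuous_on UNIV \<beta>" and B: "\<And>\<eta>. cmod (\<beta> \<eta>) \<le> B * exp (- (2 * norm \<eta>))"
    and van: "\<And>x. norm (x - x1) < 1 \<Longrightarrow> (\<integral>\<eta>. \<beta> \<eta> * plane_wave \<eta> x \<partial>lborel) = 0"
  shows "(\<integral>\<eta>. \<beta> \<eta> * plane_wave \<eta> x \<partial>lborel) = 0"
proof -
  define v where "v = x - x1"
  let ?E = "\<lambda>w \<eta>. exp (- (\<i> * of_real (\<eta> \<bullet> x1)) - w * (\<i> * of_real (\<eta> \<bullet> v)))"
  \<comment> \<open>The width of the strip bounds the integrand's growth by
    \<open>exp (norm \<eta> / 2)\<close>; the added \<open>1\<close> includes the case
    \<open>x = x1\<close>, where \<open>v = 0\<close>.\<close>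
  define \<delta> where "\<delta> = 1 / (2 * (norm v + 1))"
  have \<delta>: "\<delta> > 0" "\<delta> * norm v \<le> 1 / 2"
  proof -
    have "norm v + 1 > 0" by (simp add: add_nonneg_pos)
    then show "\<delta> > 0" "\<delta> * norm v \<le> 1 / 2" by (auto simp: \<delta>_def field_simps)
  qed
  define S where "S = {w. Im w < \<delta>} \<inter> {w. Im w > - \<delta>}"
  have S: "open S" "convex S"
    unfolding S_def by (intro open_Int open_halfspace_Im_lt open_halfspace_Im_gt)
      (intro convex_Int convex_halfspace_Im_lt convex_halfspace_Im_gt)
  define h where "h w = (\<integral>\<eta>. \<beta> \<eta> * ?E w \<eta> \<partial>lborel)" for w
  have ub: "cmod (?E w \<eta>) \<le> exp (norm \<eta> / 2)" if "w \<in> S" for w \<eta>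
  proof -
    have "Im w * (\<eta> \<bullet> v) \<le> \<bar>Im w\<bar> * \<bar>\<eta> \<bullet> v\<bar>" by (metis abs_ge_self abs_mult)
    also have "\<dots> \<le> \<delta> * (norm \<eta> * norm v)"
      using that \<delta>(1) by (intro mult_mono Cauchy_Schwarz_ineq2) (auto simp: S_def)
    also have "\<dots> = norm \<eta> * (\<delta> * norm v)" by (simp only: mult_ac)
    also have "\<dots> \<le> norm \<eta> * (1 / 2)" by (intro mult_left_mono \<delta>(2)) simp
    finally show ?thesis by simp
  qed
  have ub': "cmod (?E w \<eta>) \<le> 1 * exp (norm \<eta>)" if "w \<in> S" for w \<eta>
    by (rule order_trans[OF ub[OF that]]) simp
  have hol: "h holomorphic_on S"
    unfolding holomorphic_on_def
  proof
    fix w0 assume w0: "w0 \<in> S"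
    obtain e where e: "e > 0" "ball w0 e \<subseteq> S" using S(1) w0 openE by blast
    have "(h has_derivative (\<lambda>k. \<integral>\<eta>. \<beta> \<eta> * (?E w0 \<eta> * (- (k * (\<i> * of_real (\<eta> \<bullet> v))))) \<partial>lborel)) (at w0)"
      unfolding h_def[abs_def]
    proof (rule has_derivative_lebesgue_integral[OF e(1), where
          F'="\<lambda>w \<eta> k. \<beta> \<eta> * (?E w \<eta> * (- (k * (\<i> * of_real (\<eta> \<bullet> v)))))" and
          B="\<lambda>\<eta>. cmod (\<beta> \<eta> * of_real (exp (norm \<eta> / 2) * (norm \<eta> * norm v)))"])
      show "integrable lborel (\<lambda>\<eta>. \<beta> \<eta> * ?E p \<eta>)" if "p \<in> ball w0 e" for p
        using that e(2) by (intro exp_decay_integrable[OF c B _ ub'] continuous_intros) auto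
      show "((\<lambda>p. \<beta> \<eta> * ?E p \<eta>) has_derivative
          (\<lambda>k. \<beta> \<eta> * (?E p \<eta> * (- (k * (\<i> * of_real (\<eta> \<bullet> v))))))) (at p)" for p \<eta>
        by (intro has_derivative_mult_right has_derivative_cexp) (auto intro!: derivative_eq_intros)
      show "cmod (\<beta> \<eta> * (?E p \<eta> * (- (k * (\<i> * of_real (\<eta> \<bullet> v))))))
          \<le> cmod (\<beta> \<eta> * of_real (exp (norm \<eta> / 2) * (norm \<eta> * norm v))) * norm k" if "p \<in> ball w0 e" for p \<eta> k
      proof -
        have "cmod (?E p \<eta>) * \<bar>\<eta> \<bullet> v\<bar> \<le> exp (norm \<eta> / 2) * (norm \<eta> * norm v)"
          using that e(2) by (intro mult_mono ub Cauchy_Schwarz_ineq2) auto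
        then have "(cmod (\<beta> \<eta>) * cmod k) * (cmod (?E p \<eta>) * \<bar>\<eta> \<bullet> v\<bar>)
            \<le> (cmod (\<beta> \<eta>) * cmod k) * (exp (norm \<eta> / 2) * (norm \<eta> * norm v))"
          by (rule mult_left_mono) simp
        then show ?thesis
          unfolding norm_mult norm_minus_cancel norm_of_real abs_mult abs_exp_cancel abs_norm_cancel
              norm_ii mult_1 by (simp only: mult_ac)
      qed
      have "norm \<eta> * exp (norm \<eta> / 2) \<le> 2 * exp (norm \<eta>)" for \<eta> :: "real^'n"
      proof -
        have "norm \<eta> \<le> 2 * exp (norm \<eta> / 2)" using exp_ge_add_one_self[of "norm \<eta> / 2"] by linarith
        then have "norm \<eta> * exp (norm \<eta> / 2) \<le> 2 * exp (norm \<eta> / 2) * exp (norm \<eta> / 2)"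
          by (rule mult_right_mono) simp
        then show ?thesis by (simp add: mult.assoc mult_exp_exp)
      qed
      then have "(norm \<eta> * exp (norm \<eta> / 2)) * norm v \<le> (2 * exp (norm \<eta>)) * norm v" for \<eta> :: "real^'n"
        by (rule mult_right_mono) simp
      then have "cmod (of_real (exp (norm \<eta> / 2) * (norm \<eta> * norm v))) \<le> (2 * norm v) * exp (norm \<eta>)"
          for \<eta> :: "real^'n"
        unfolding norm_of_real abs_mult abs_exp_cancel abs_norm_cancel by (simp only: mult_ac)
      then show "integrable lborel (\<lambda>\<eta>. cmod (\<beta> \<eta> * of_real (exp (norm \<eta> / 2) * (norm \<eta> * norm v))))"
        by (intro integrable_norm exp_decay_integrable[OF c B] continuous_intros) auto
      show "(\<lambda>\<eta>. \<beta> \<eta> * (?E w0 \<eta> * (- (k * (\<i> * of_real (\<eta> \<bullet> v))))))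
          \<in> borel_measurable lborel" for k
      proof -
        have "continuous_on UNIV (\<lambda>\<eta>. \<beta> \<eta> * (?E w0 \<eta> * (- (k * (\<i> * of_real (\<eta> \<bullet> v))))))"
          by (intro continuous_intros c)
        from borel_measurable_continuous_onI[OF this] show ?thesis unfolding measurable_lborel2 .
      qed
    qed
    moreover have "(\<lambda>k. \<integral>\<eta>. \<beta> \<eta> * (?E w0 \<eta> * (- (k * (\<i> * of_real (\<eta> \<bullet> v))))) \<partial>lborel)
      = (*) (\<integral>\<eta>. \<beta> \<eta> * (?E w0 \<eta> * (- (\<i> * of_real (\<eta> \<bullet> v)))) \<partial>lborel)"
    proof
      fix k
      have "(\<integral>\<eta>. \<beta> \<eta> * (?E w0 \<eta> * (- (k * (\<i> * of_real (\<eta> \<bullet> v))))) \<partial>lborel)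
        = (\<integral>\<eta>. (\<beta> \<eta> * (?E w0 \<eta> * (- (\<i> * of_real (\<eta> \<bullet> v))))) * k \<partial>lborel)"
        by (intro Bochner_Integration.integral_cong) (simp_all add: mult_ac)
      then show "(\<integral>\<eta>. \<beta> \<eta> * (?E w0 \<eta> * (- (k * (\<i> * of_real (\<eta> \<bullet> v))))) \<partial>lborel)
        = (\<integral>\<eta>. \<beta> \<eta> * (?E w0 \<eta> * (- (\<i> * of_real (\<eta> \<bullet> v)))) \<partial>lborel) * k"
        by (simp only: integral_mult_left_zero)
    qed
    ultimately have "h field_differentiable (at w0)"
      unfolding field_differentiable_def has_field_derivative_def by (intro exI) simp
    then show "h field_differentiable (at w0 within S)" by (rule field_differentiable_at_within)
  qed
  have hx: "h (of_real t) = (\<integral>\<eta>. \<beta> \<eta> * plane_wave \<eta> (x1 + t *\<^sub>R v) \<partial>lborel)" for t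
    by (simp add: h_def inner_add_right algebra_simps)
  \<comment> \<open>The real parameters for which the point lies in the unit ball around
    \<open>x1\<close>. They accumulate at \<open>0\<close>, as the identity theorem
    requires.\<close>
  define U where "U = complex_of_real ` {t. \<bar>t\<bar> * norm v < 1}"
  have "h 1 = 0"
  proof (rule analytic_continuation[OF hol S(1) convex_connected[OF S(2)], of U 0])
    show "U \<subseteq> S" using \<delta>(1) by (auto simp: U_def S_def)
    show "0 \<in> S" "1 \<in> S" using \<delta>(1) by (auto simp: S_def)
    show "0 islimpt U"
      unfolding islimpt_approachable
    proof (intro allI impI)
      fix e :: real assume e: "e > 0"
      define t where "t = min (e / 2) \<delta>"
      have t: "t > 0" "t < e" "t \<le> \<delta>" using e \<delta>(1) by (auto simp: t_def)
      have "t * norm v \<le> \<delta> * norm v" using t by (intro mult_right_mono) auto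
      then have "t * norm v < 1" using \<delta>(2) by linarith
      then have "complex_of_real t \<in> U" unfolding U_def using t(1) by (intro imageI) simp
      then show "\<exists>x'\<in>U. x' \<noteq> 0 \<and> dist x' 0 < e"
        using t by (intro bexI[of _ "complex_of_real t"]) auto
    qed
    show "h w = 0" if w: "w \<in> U" for w
    proof -
      obtain t where t: "w = of_real t" "\<bar>t\<bar> * norm v < 1" using w by (auto simp: U_def)
      show ?thesis unfolding t(1) hx by (rule van) (use t(2) in simp)
    qed
  qed
  then show ?thesis using hx[of 1] by (simp add: v_def)
qed

text \<open>Integrating the vanishing transform against modulated Gaussians shows that all Gaussian
  averages of \<open>\<beta>\<close> around \<open>a\<close> vanish. Narrowing the Gaussians, here
  by letting \<open>l\<close> tend to \<open>0\<close>, recovers \<open>\<beta> a\<close> by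
  continuity.\<close>

lemma fourier_transform_injective:
  fixes \<beta> :: "real^'n \<Rightarrow> complex"
  assumes c: "continuous_on UNIV \<beta>" and B: "\<And>\<eta>. cmod (\<beta> \<eta>) \<le> B * exp (- (2 * norm \<eta>))"
    and van: "\<And>x. (\<integral>\<eta>. \<beta> \<eta> * plane_wave \<eta> x \<partial>lborel) = 0"
  shows "\<beta> a = 0"
proof -
  have B0: "B \<ge> 0" using order_trans[OF norm_ge_zero B[of 0]] by simp
  have gz: "gauss_exp l 0 \<zeta> = of_real (exp (- ((norm \<zeta>)\<^sup>2 / (4 * l))))" for l and \<zeta> :: "real^'n"
    by (simp add: gauss_exp_def cdot_def exp_of_real[symmetric])
  have \<beta>i: "integrable lborel (\<lambda>\<eta>. \<beta> \<eta> * plane_wave \<eta> x)" for x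
    by (rule exp_decay_integrable[OF c B, where A=1]) (auto intro!: continuous_intros)
  \<comment> \<open>\<open>G\<close> carries the phase \<open>exp (\<i> * (a \<bullet> x))\<close>,
    so exchanging the integrals produces a Gaussian centred at \<open>a\<close>.\<close>
  have g0: "(\<integral>\<eta>. \<beta> \<eta> * gauss_exp l 0 (\<eta> - a) \<partial>lborel) = 0" if l: "l > 0" for l
  proof -
    define G where "G x = exp (- (of_real l * cdot (cvec x - 0) (cvec x - 0)) - \<i>
        * of_real ((- a) \<bullet> x))" for x :: "real^'n"
    define f where "f x \<eta> = G x * (\<beta> \<eta> * plane_wave \<eta> x)" for x \<eta>
    have G: "integrable lborel G" unfolding G_def[abs_def] by (rule gauss_fourier(1)[OF l])
    have "integrable (lborel \<Otimes>\<^sub>M lborel) (\<lambda>(x, \<eta>). f x \<eta>)"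
    proof (rule lborel_pair.Fubini_integrable)
      have "continuous_on UNIV (\<lambda>p :: (real^'n) \<times> (real^'n). \<beta> (snd p))"
        by (rule continuous_on_compose2[OF c]) (auto intro: continuous_intros)
      then have "continuous_on UNIV (\<lambda>(x, \<eta>). f x \<eta>)"
        unfolding f_def G_def case_prod_unfold cdot_def cvec_def by (auto intro!: continuous_intros)
      then show "(\<lambda>(x, \<eta>). f x \<eta>) \<in> borel_measurable (lborel \<Otimes>\<^sub>M lborel)"
        unfolding lborel_prod by (simp add: borel_measurable_continuous_onI)
      have "norm (f x \<eta>) = cmod (G x) * cmod (\<beta> \<eta>)" for x \<eta>
        by (simp add: f_def norm_mult)
      then show "integrable lborel (\<lambda>x. \<integral>\<eta>. norm (case (x, \<eta>) of (x, \<eta>) \<Rightarrow> f x \<eta>) \<partial>lborel)"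
        using G by simp
      show "AE x in lborel. integrable lborel (\<lambda>\<eta>. case (x, \<eta>) of (x, \<eta>) \<Rightarrow> f x \<eta>)"
        unfolding f_def prod.case by (intro AE_I2 integrable_mult_right \<beta>i)
    qed
    from lborel_pair.Fubini_integral[OF this]
    have fub: "(\<integral>x. \<integral>\<eta>. f x \<eta> \<partial>lborel \<partial>lborel) = (\<integral>\<eta>. \<integral>x. f x \<eta> \<partial>lborel \<partial>lborel)" by simp
    have 1: "(\<integral>\<eta>. f x \<eta> \<partial>lborel) = 0" for x
      unfolding f_def integral_mult_right_zero van by simp
    have 2: "(\<integral>x. f x \<eta> \<partial>lborel) = \<beta> \<eta> * (of_real (sqrt (pi / l)) ^ CARD('n) * gauss_exp l 0 (\<eta> - a))" for \<eta>
    proof -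
      have "f x \<eta> = \<beta> \<eta> * exp (- (of_real l * cdot (cvec x - 0) (cvec x - 0)) - \<i> * of_real ((\<eta>
          - a) \<bullet> x))" for x
      proof -
        have "G x * plane_wave \<eta> x = exp (- (of_real l * cdot (cvec x - 0) (cvec x - 0)) - \<i>
            * of_real ((\<eta> - a) \<bullet> x))"
          unfolding G_def mult_exp_exp by (simp add: inner_diff_left algebra_simps)
        then show ?thesis by (simp add: f_def mult_ac)
      qed
      then show ?thesis using gauss_fourier(2)[OF l, of 0 "\<eta> - a"] by simp
    qed
    have "of_real (sqrt (pi / l)) ^ CARD('n) * (\<integral>\<eta>. \<beta> \<eta> * gauss_exp l 0 (\<eta> - a) \<partial>lborel)
        = (\<integral>\<eta>. \<integral>x. f x \<eta> \<partial>lborel \<partial>lborel)"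
      unfolding 2 integral_mult_right_zero[symmetric] by (simp only: mult_ac)
    also have "\<dots> = 0" unfolding fub[symmetric] 1 by simp
    finally show ?thesis using l by simp
  qed
  have int0: "(\<integral>u. \<beta> (a + (1 / real (Suc k)) *\<^sub>R u) * of_real (exp (- (norm u)\<^sup>2)) \<partial>lborel) = 0" for k
  proof -
    define s where "s = 1 / real (Suc k)"
    have s: "s > 0" by (simp add: s_def)
    \<comment> \<open>With \<open>l = s\<^sup>2 / 4\<close> the substitution
      \<open>\<eta> = a + s *\<^sub>R u\<close> turns the Gaussian into
      \<open>exp (- (norm u)\<^sup>2)\<close>, independent of \<open>s\<close>, so that only
      \<open>\<beta>\<close> varies in the limit.\<close>
    define F where "F \<eta> = \<beta> \<eta> * gauss_exp (s\<^sup>2 / 4) 0 (\<eta> - a)" for \<eta>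
    have Fm: "F \<in> borel_measurable borel"
    proof (rule borel_measurable_continuous_onI)
      show "continuous_on UNIV F" unfolding F_def gz using s by (auto intro!: continuous_intros c)
    qed
    have "(\<integral>\<eta>. F \<eta> \<partial>lborel) = \<bar>s\<bar> ^ DIM(real^'n) *\<^sub>R (\<integral>u. F (a + s *\<^sub>R u) \<partial>lborel)"
      using s by (intro lborel_integral_affine(1) Fm) simp
    moreover have "(\<integral>\<eta>. F \<eta> \<partial>lborel) = 0" unfolding F_def using s by (intro g0) simp
    ultimately have "(\<integral>u. F (a + s *\<^sub>R u) \<partial>lborel) = 0" using s by simp
    moreover have "F (a + s *\<^sub>R u) = \<beta> (a + s *\<^sub>R u) * of_real (exp (- (norm u)\<^sup>2))" for u
      using s by (simp add: F_def gz power_mult_distrib)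
    ultimately show ?thesis by (simp add: s_def)
  qed
  have ei: "integrable lborel (\<lambda>u::real^'n. exp (- (norm u)\<^sup>2))"
    using integrable_gaussian_exp_norm[of 1 0, where 'n='n] by simp
  have "(\<lambda>k. \<integral>u. \<beta> (a + (1 / real (Suc k)) *\<^sub>R u) * of_real (exp (- (norm u)\<^sup>2)) \<partial>lborel)
      \<longlonglongrightarrow> (\<integral>u. \<beta> a * of_real (exp (- (norm u)\<^sup>2)) \<partial>(lborel :: (real^'n) measure))"
  proof (rule integral_dominated_convergence[where w="\<lambda>u. B * exp (- (norm u)\<^sup>2)"])
    have "continuous_on UNIV (\<lambda>u. \<beta> (a + (1 / real (Suc k)) *\<^sub>R u) * of_real (exp (- (norm u)\<^sup>2)))" for k
      by (intro continuous_intros continuous_on_compose2[OF c]) auto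
    then show "(\<lambda>u. \<beta> (a + (1 / real (Suc k)) *\<^sub>R u) * of_real (exp (- (norm u)\<^sup>2))) \<in> borel_measurable
        lborel" for k
      by (simp add: borel_measurable_continuous_onI)
    have "continuous_on UNIV (\<lambda>u::real^'n. \<beta> a * of_real (exp (- (norm u)\<^sup>2)))" by (intro continuous_intros)
    then show "(\<lambda>u::real^'n. \<beta> a * of_real (exp (- (norm u)\<^sup>2))) \<in> borel_measurable lborel"
      by (simp add: borel_measurable_continuous_onI)
    show "integrable lborel (\<lambda>u::real^'n. B * exp (- (norm u)\<^sup>2))" using ei by simp
    show "AE u in lborel. (\<lambda>k. \<beta> (a + (1 / real (Suc k)) *\<^sub>R u) * of_real (exp (- (norm u)\<^sup>2))) \<longlonglongrightarrow> \<beta> a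
        * of_real (exp (- (norm u)\<^sup>2))"
    proof (rule AE_I2)
      fix u :: "real^'n"
      have "(\<lambda>k. a + (1 / real (Suc k)) *\<^sub>R u) \<longlonglongrightarrow> a + 0 *\<^sub>R u"
        by (intro tendsto_intros LIMSEQ_Suc[OF lim_1_over_n])
      then have "(\<lambda>k. a + (1 / real (Suc k)) *\<^sub>R u) \<longlonglongrightarrow> a" by simp
      then have "(\<lambda>k. \<beta> (a + (1 / real (Suc k)) *\<^sub>R u)) \<longlonglongrightarrow> \<beta> a"
        by (rule continuous_on_tendsto_compose[OF c]) auto
      then show "(\<lambda>k. \<beta> (a + (1 / real (Suc k)) *\<^sub>R u) * of_real (exp (- (norm u)\<^sup>2))) \<longlonglongrightarrow> \<beta> a
          * of_real (exp (- (norm u)\<^sup>2))"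
        by (intro tendsto_intros)
    qed
    have B1: "cmod (\<beta> \<eta>) \<le> B" for \<eta>
    proof -
      have "B * exp (- (2 * norm \<eta>)) \<le> B * 1" using B0 by (intro mult_left_mono) auto
      then show ?thesis using B[of \<eta>] by simp
    qed
    show "AE u in lborel. norm (\<beta> (a + (1 / real (Suc k)) *\<^sub>R u) * of_real (exp (- (norm u)\<^sup>2)))
        \<le> B * exp (- (norm u)\<^sup>2)" for k
      unfolding norm_mult norm_of_real abs_exp_cancel by (intro AE_I2 mult_right_mono B1) simp
  qed
  then have "(\<lambda>k::nat. 0) \<longlonglongrightarrow> (\<integral>u. \<beta> a * of_real (exp (- (norm u)\<^sup>2)) \<partial>(lborel :: (real^'n) measure))"
    unfolding int0 .
  then have "\<beta> a * (\<integral>u. complex_of_real (exp (- (norm u)\<^sup>2)) \<partial>(lborel :: (real^'n) measure)) = 0"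
    by (simp only: integral_mult_right_zero LIMSEQ_const_iff)
  moreover have "(\<integral>u. complex_of_real (exp (- (norm u)\<^sup>2)) \<partial>(lborel :: (real^'n) measure))
      = of_real (sqrt pi) ^ CARD('n)"
    using gaussian_integral(2)[of 1 "0 :: complex^'n"] by (simp add: cdot_def exp_of_real[symmetric])
  ultimately show ?thesis by (metis mult_eq_0_iff of_real_eq_0_iff pi_neq_zero power_eq_0_iff
      real_sqrt_eq_zero_cancel_iff)
qed

section \<open>Vanishing on test functions\<close>

lemma test_functions_annihilated:
  fixes \<O> Cstar C :: "(real^'n) set"
    and V :: "(real^'n \<Rightarrow> complex) \<Rightarrow> complex"
  assumes \<O>: "open \<O>" "convex \<O>" "0 \<in> \<O>"
    and V: "V \<in> H_dual \<O>"
    and cone: "closed Cstar" "convex Cstar" "origin_cone Cstar" "\<not> contains_line Cstar"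
    and supp: "dist_support V \<subseteq> Cstar"
    and C: "closed C" "origin_cone C" "C \<noteq> UNIV"
    and carr: "carried_by (uminus ` \<O>) (inv_fourier_dual V) C"
    and \<rho>: "\<rho> \<in> test_functions UNIV"
  shows "V \<rho> = 0"
proof -
  obtain \<epsilon> where \<epsilon>: "\<epsilon> > 0" "cball 0 \<epsilon> \<subseteq> \<O>" using \<O> open_contains_cball by blast
  \<comment> \<open>The carrier estimate is available only for neighbourhoods inside the tube. Their
    points have imaginary part of norm at most \<open>1 / m\<close>, so a small ball around
    \<open>0\<close> in \<open>\<O>\<close> suffices.\<close>
  obtain m :: nat where m: "m > 0" "1 / real m < \<epsilon>"
    using ex_inverse_of_nat_less[OF \<epsilon>(1)] by (auto simp: inverse_eq_divide)
  have nbhd: "carrier_nbhd C m \<subseteq> tube (uminus ` \<O>)"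
  proof
    fix t assume "t \<in> carrier_nbhd C m"
    then have "norm (im_vec t) \<le> 1 / real m" by (rule carrier_nbhd_bounds(1)[where d=0 and x=0]) simp
    then have "- im_vec t \<in> \<O>" using \<epsilon>(2) m(2) by auto
    then have "- (- im_vec t) \<in> uminus ` \<O>" by (rule imageI)
    then show "t \<in> tube (uminus ` \<O>)" by (simp add: tube_iff)
  qed
  define b where "b = (\<lambda>\<eta>. V (\<lambda>\<xi>. \<rho> (\<xi> - \<eta>)))"
  have bc: "continuous_on UNIV b" unfolding b_def by (rule correlation_properties(2)[OF V \<O>(2,3) \<rho>])
  obtain R A where bb: "\<forall>\<eta>. cmod (b \<eta>) \<le> A * exp (R * norm \<eta>)"
    unfolding b_def using correlation_properties(1)[OF V \<O>(2,3) \<rho>] by (elim exE)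
  have A: "A \<ge> 0" using order_trans[OF norm_ge_zero bb[rule_format, of 0]] by simp
  obtain r where r: "r > 0" "\<And>\<alpha> \<xi>. norm \<xi> > r \<Longrightarrow> multi_deriv \<alpha> \<rho> \<xi> = 0"
    using test_function_bounded_support[OF \<rho>] by metis
  obtain e where e: "\<forall>\<xi>\<in>Cstar. norm \<xi> \<le> \<xi> \<bullet> e" using pointed_cone_functional[OF cone] by (elim exE)
  \<comment> \<open>\<open>T\<close> exceeds the growth rate of \<open>b\<close> by
    \<open>2\<close>, the decay rate that the Fourier lemmas demand. \<open>y\<close> points against
    \<open>e\<close> because \<open>exp (\<eta> \<bullet> y)\<close> has to decay along the
    cone.\<close>
  define T where "T = \<bar>R\<bar> + 2"
  define y where "y = - (T *\<^sub>R e)"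
  define B where "B = A * exp (T * (r + r * norm e))"
  define \<beta> where "\<beta> = (\<lambda>\<eta>. b \<eta> * of_real (exp (\<eta> \<bullet> y)))"
  have \<beta>c: "continuous_on UNIV \<beta>" unfolding \<beta>_def by (intro continuous_intros bc)
  have \<beta>B: "cmod (\<beta> \<eta>) \<le> B * exp (- (2 * norm \<eta>))" for \<eta>
  \<comment> \<open>Farther than \<open>r\<close> from the cone the translate of
    \<open>\<rho>\<close> misses the support of \<open>V\<close>. Within that distance the
    inequality \<open>norm \<xi> \<le> \<xi> \<bullet> e\<close> passes to \<open>\<eta>\<close>
    with a loss of \<open>r + r * norm e\<close>, for which the exponential in \<open>B\<close>
    pays.\<close>
  proof (cases "\<exists>\<xi>\<in>Cstar. norm (\<xi> - \<eta>) \<le> r")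
    case False
    then have "norm (\<xi> - \<eta>) > r" if "\<xi> \<in> dist_support V" for \<xi> using that supp by force
    then have "b \<eta> = 0"
      unfolding b_def using r(2)[of _ "[]"] by (intro correlation_vanishes[OF V \<rho>, of r]) auto
    then show ?thesis using A by (simp add: \<beta>_def B_def)
  next
    case True
    then obtain \<xi> where \<xi>: "\<xi> \<in> Cstar" "norm (\<xi> - \<eta>) \<le> r" by blast
    have "(\<xi> - \<eta>) \<bullet> e \<le> norm (\<xi> - \<eta>) * norm e" by (rule norm_cauchy_schwarz)
    also have "\<dots> \<le> r * norm e" using \<xi>(2) by (intro mult_right_mono) auto
    finally have "\<eta> \<bullet> e \<ge> norm \<xi> - r * norm e" using e \<xi>(1) by (force simp: inner_diff_left)
    moreover have "norm \<eta> \<le> norm \<xi> + r" using norm_triangle_sub[of \<eta> \<xi>] \<xi>(2) by (simp add: norm_minus_commute)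
    ultimately have "norm \<eta> - (r + r * norm e) \<le> \<eta> \<bullet> e" by linarith
    then have "T * (norm \<eta> - (r + r * norm e)) \<le> T * (\<eta> \<bullet> e)" by (intro mult_left_mono) (auto simp: T_def)
    then have 1: "\<eta> \<bullet> y \<le> T * (r + r * norm e) - T * norm \<eta>" by (simp add: y_def algebra_simps)
    have 2: "R * norm \<eta> - T * norm \<eta> \<le> - (2 * norm \<eta>)"
    proof -
      have "R * norm \<eta> \<le> \<bar>R\<bar> * norm \<eta>" by (intro mult_right_mono) auto
      then show ?thesis by (simp add: T_def algebra_simps)
    qed
    have "cmod (\<beta> \<eta>) = cmod (b \<eta>) * exp (\<eta> \<bullet> y)" by (simp add: \<beta>_def norm_mult)
    also have "\<dots> \<le> (A * exp (R * norm \<eta>)) * exp (\<eta> \<bullet> y)" using bb by (intro mult_right_mono) auto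
    also have "\<dots> = A * exp (R * norm \<eta> + \<eta> \<bullet> y)" by (simp add: exp_add)
    also have "\<dots> \<le> A * exp (T * (r + r * norm e) + - (2 * norm \<eta>))"
      using 1 2 A by (intro mult_left_mono) auto
    also have "\<dots> = B * exp (- (2 * norm \<eta>))" by (simp only: B_def exp_add mult.assoc)
    finally show ?thesis .
  qed
  \<comment> \<open>The final \<open>1\<close> makes the margin condition of
    \<open>carrier_gauss_limit\<close> strict. The point \<open>x1\<close> is taken at distance
    \<open>d + 1\<close>, so that the whole unit ball around it keeps distance \<open>d\<close> from
    \<open>C\<close>.\<close>
  define d where "d = norm y + 2 / real m + 1"
  have d: "d > 0" by (simp add: d_def add_nonneg_pos)
  obtain x1 where x1: "\<forall>c\<in>C. d + 1 \<le> norm (x1 - c)"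
    using cone_far_point[OF C, of "d + 1"] d by auto
  have near: "(\<integral>\<eta>. \<beta> \<eta> * plane_wave \<eta> x \<partial>lborel) = 0" if x: "norm (x - x1) < 1" for x
  proof -
    define z where "z = (\<chi> i. Complex (x $ i) (y $ i))"
    have z: "re_vec z = x" "im_vec z = y" by (simp_all add: z_def re_vec_def im_vec_def vec_eq_iff)
    have cz: "cdot (cvec \<eta>) z = of_real (\<eta> \<bullet> x) + \<i> * of_real (\<eta> \<bullet> y)" for \<eta>
      by (simp add: cdot_def cvec_def z_def inner_vec_def complex_eq_iff)
    \<comment> \<open>All dependence on \<open>l\<close> is in the damping factor, which is at most
      \<open>1\<close> for positive \<open>l\<close> and tends to \<open>1\<close>; the decay of
      \<open>\<beta>\<close> then justifies dominated convergence.\<close>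
    have g: "gauss_exp l z \<eta> * b \<eta> = of_real (exp (- ((norm \<eta>)\<^sup>2 / (4 * l)))) * (\<beta> \<eta> * plane_wave \<eta> x)"
        for l \<eta>
    proof -
      have "- complex_of_real ((norm \<eta>)\<^sup>2 / (4 * l)) - \<i> * cdot (cvec \<eta>) z
        = of_real (- ((norm \<eta>)\<^sup>2 / (4 * l))) + (of_real (\<eta> \<bullet> y) + - (\<i> * of_real (\<eta> \<bullet> x)))"
        by (simp add: cz algebra_simps)
      then have "gauss_exp l z \<eta> = of_real (exp (- ((norm \<eta>)\<^sup>2 / (4 * l)))) * (of_real (exp (\<eta> \<bullet> y))
          * plane_wave \<eta> x)"
        unfolding gauss_exp_def exp_of_real[symmetric] mult_exp_exp by (simp only:)
      then show ?thesis by (simp only: \<beta>_def mult_ac)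
    qed
    have "((\<lambda>l. \<integral>\<eta>. gauss_exp l z \<eta> * b \<eta> \<partial>lborel) \<longlongrightarrow> 0) at_top"
      unfolding b_def
    proof (rule carrier_gauss_limit[OF V \<O>(2,3) \<rho> carr _ nbhd, where d=d])
      show "1 \<le> m" using m by simp
      fix c assume "c \<in> C"
      then have "d + 1 \<le> norm (x1 - c)" using x1 by blast
      moreover have "norm (x1 - c) \<le> norm (x1 - x) + norm (x - c)"
        using norm_triangle_ineq[of "x1 - x" "x - c"] by simp
      ultimately show "d \<le> norm (re_vec z - c)" using x by (simp add: z norm_minus_commute)
    next
      show "norm (im_vec z) + 2 / real m < d" by (simp add: z d_def)
    qed
    moreover have "((\<lambda>l. \<integral>\<eta>. gauss_exp l z \<eta> * b \<eta> \<partial>lborel) \<longlongrightarrow> (\<integral>\<eta>. \<beta> \<eta> * plane_wave \<eta> x \<partial>lborel)) at_top"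
      unfolding g
    proof (rule integral_dominated_convergence_at_top[where w="\<lambda>\<eta>. cmod (\<beta> \<eta> * plane_wave \<eta> x)"])
      have i: "integrable lborel (\<lambda>\<eta>. \<beta> \<eta> * plane_wave \<eta> x)"
        by (rule exp_decay_integrable[OF \<beta>c \<beta>B, where A=1]) (auto intro!: continuous_intros)
      then show "integrable lborel (\<lambda>\<eta>. cmod (\<beta> \<eta> * plane_wave \<eta> x))" by (rule integrable_norm)
      show meas: "(\<lambda>\<eta>. \<beta> \<eta> * plane_wave \<eta> x) \<in> borel_measurable lborel"
        using i by (rule borel_measurable_integrable)
      show "(\<lambda>\<eta>. of_real (exp (- ((norm \<eta>)\<^sup>2 / (4 * l)))) * (\<beta> \<eta>
          * plane_wave \<eta> x)) \<in> borel_measurable lborel" for l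
        by (rule borel_measurable_times[OF _ meas]) simp
      show "\<forall>\<^sub>F l in at_top. AE \<eta> in lborel. norm (of_real (exp (- ((norm \<eta>)\<^sup>2 / (4 * l)))) * (\<beta> \<eta>
          * plane_wave \<eta> x))
          \<le> cmod (\<beta> \<eta> * plane_wave \<eta> x)"
        using eventually_ge_at_top[of "1::real"]
      proof eventually_elim
        case (elim l)
        show ?case
        proof (rule AE_I2)
          fix \<eta> :: "real^'n"
          have "exp (- ((norm \<eta>)\<^sup>2 / (4 * l))) \<le> 1" using elim by simp
          then show "norm (of_real (exp (- ((norm \<eta>)\<^sup>2 / (4 * l)))) * (\<beta> \<eta> * plane_wave \<eta> x))
              \<le> cmod (\<beta> \<eta> * plane_wave \<eta> x)"
            unfolding norm_mult[of "of_real _"] norm_of_real abs_exp_cancel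
              by (intro mult_left_le_one_le) auto
        qed
      qed
      show "AE \<eta> in lborel. ((\<lambda>l. of_real (exp (- ((norm \<eta>)\<^sup>2 / (4 * l)))) * (\<beta> \<eta> * plane_wave \<eta> x))
          \<longlongrightarrow> \<beta> \<eta> * plane_wave \<eta> x) at_top"
      proof (rule AE_I2)
        fix \<eta> :: "real^'n"
        have "((\<lambda>l. exp (- ((norm \<eta>)\<^sup>2 / (4 * l)))) \<longlongrightarrow> 1) at_top" by real_asymp
        then have "((\<lambda>l. of_real (exp (- ((norm \<eta>)\<^sup>2 / (4 * l)))) * (\<beta> \<eta> * plane_wave \<eta> x))
          \<longlongrightarrow> of_real 1 * (\<beta> \<eta> * plane_wave \<eta> x)) at_top" by (intro tendsto_intros)
        then show "((\<lambda>l. of_real (exp (- ((norm \<eta>)\<^sup>2 / (4 * l)))) * (\<beta> \<eta> * plane_wave \<eta> x))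
          \<longlongrightarrow> \<beta> \<eta> * plane_wave \<eta> x) at_top" by simp
      qed
    qed
    ultimately show ?thesis using tendsto_unique[OF trivial_limit_at_top_linorder] by blast
  qed
  have "\<beta> 0 = 0"
    by (rule fourier_transform_injective[OF \<beta>c \<beta>B], rule fourier_transform_continuation[OF \<beta>c \<beta>B near])
  then show ?thesis by (simp add: \<beta>_def b_def)
qed

theorem theorem5p1:
  fixes \<O> Cstar :: "(real^'n) set"
    and V :: "(real^'n \<Rightarrow> complex) \<Rightarrow> complex"
  assumes "open \<O>" and "convex \<O>" and "0 \<in> \<O>"
    and "V \<in> H_dual \<O>"
    and "closed Cstar" and "convex Cstar" and "origin_cone Cstar" and "\<not> contains_line Cstar"
    and "dist_support V \<subseteq> Cstar"
    and "\<exists>\<phi>\<in>H_space \<O>. V \<phi> \<noteq> 0"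
  shows "\<forall>C. closed C \<and> origin_cone C \<and> carried_by (uminus ` \<O>) (inv_fourier_dual V) C \<longrightarrow> C = UNIV"
proof (intro allI impI, elim conjE)
  fix C :: "(real^'n) set"
  assume C: "closed C" "origin_cone C" and carr: "carried_by (uminus ` \<O>) (inv_fourier_dual V) C"
  obtain \<phi> where \<phi>: "\<phi> \<in> H_space \<O>" "V \<phi> \<noteq> 0" using assms(10) by blast
  show "C = UNIV"
  proof (rule ccontr)
    assume "C \<noteq> UNIV"
    then have "V \<rho> = 0" if "\<rho> \<in> test_functions UNIV" for \<rho>
      by (rule test_functions_annihilated[OF assms(1-9) C _ carr that])
    then have "V \<phi> = 0" by (rule H_dual_eq_zero[OF assms(4) assms(1-3) _ \<phi>(1)])
    then show False using \<phi>(2) by blast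
  qed
qed

end
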